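(* Let $S_n=\frac{X_1+\cdots+X_n}{\sqrt n}$, $n\ge1$. Assume that there exists $n_0\ge1$ such that $I(S_{n_0})<\infty$ and $$\beta:=\max\Big\{\sup_{k\ge n_0+1}\mathbb{E}|X_k|^4,\ \sup_{k\ge n_0+1}\mathbb{E}|\tau_k(X_k)|^8,\ \sup_{k\ge n_0+1}\mathbb{E}|\tau_k'(X_k)|^8\Big\}<\infty.$$ Then $$I(S_n\|Z)\le\frac{C_{n_0,\beta,\bar\beta}}{n}\qquad\forall\,n\ge n_0,$$ where $C_{n_0,\beta,\bar\beta}$ is a positive constant depending only on $n_0$, $\beta$ and $\bar\beta:=\sup_{k\ge n_0+1}\mathbb{E}|\tau_k(X_k)|^2$.
   Context: Setting. $(X_k)_{k\ge1}$ is a sequence of independent real-valued random variables (not necessarily identically distributed) with $\mathbb{E}[X_k]=0$ and $\mathrm{Var}(X_k)=1$ for all $k\ge1$. For each $k$, the distribution of $X_k$ has a differentiable density $p_k$ supported on some connected interval of $\mathbb{R}$. The Stein kernel of $X_k$ is $\tau_k(x)=\frac{1}{p_k(x)}\int_x^\infty y\,p_k(y)\,dy$ for $x$ in the support of $p_k$, and $\tau_k'$ is its derivative. Fisher information. For a random variable $F$ with an absolutely continuous density $p_F$ and score function $\rho_F=p_F'/p_F$ (where $p_F'$ is a Radon-Nikodym derivative of $p_F$), $I(F)=\int_{-\infty}^\infty\frac{p_F'(x)^2}{p_F(x)}dx=\mathbb{E}[\rho_F^2(F)]$. If moreover $\mathbb{E}[F]=0$ and $\mathrm{Var}(F)=1$,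 and $Z\sim N(0,1)$, the Fisher information distance of $F$ to $Z$ is $I(F\|Z)=\mathbb{E}[(\rho_F(F)+F)^2]=I(F)-I(Z)$.
   Formalization: The constant C may depend on I(S_{n_0}) as well as on n_0, β and β̄; without this the claim fails at n=n_0=1 when X_k is standard normal for k≥2 and X_1 has arbitrarily large finite Fisher information. *)

theory Defs
  imports "HOL-Probability.Probability"
begin

definition stein_kernel :: "(real \<Rightarrow> real) \<Rightarrow> real \<Rightarrow> real" where
  "stein_kernel p x = (LINT y:{x..}|lborel. y * p y) / p x"

(* The support of p is the set where p > 0; the Stein kernel, which divides by p, is only
   meaningful there. Differentiability is asked for in the interior of the support, so that densities
   with jumps at the ends of the support (uniform, exponential) are admitted along with densities
   differentiable on the whole line; the end points carry no mass. *)
definition diff_density_on_interval :: "(real \<Rightarrow> real) \<Rightarrow> bool" where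
  "diff_density_on_interval p \<longleftrightarrow>
     (\<forall>x. 0 \<le> p x) \<and>
     connected {x. 0 < p x} \<and>
     (\<forall>x \<in> interior {x. 0 < p x}. p differentiable (at x))"

(* The sequences are indexed by k \<ge> 1; X 0 and p 0 are never used. *)
definition stein_setting ::
    "'a measure \<Rightarrow> (nat \<Rightarrow> 'a \<Rightarrow> real) \<Rightarrow> (nat \<Rightarrow> real \<Rightarrow> real) \<Rightarrow> bool" where
  "stein_setting M X p \<longleftrightarrow>
     prob_space M \<and>
     prob_space.indep_vars M (\<lambda>_. borel) X {1..} \<and>
     (\<forall>k\<ge>1.
        integrable M (X k) \<and> prob_space.expectation M (X k) = 0 \<and>
        integrable M (\<lambda>\<omega>. (X k \<omega>)\<^sup>2) \<and> prob_space.variance M (X k) = 1 \<and>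
        distributed M lborel (X k) (\<lambda>x. ennreal (p k x)) \<and>
        diff_density_on_interval (p k))"

definition norm_sum :: "(nat \<Rightarrow> 'a \<Rightarrow> real) \<Rightarrow> nat \<Rightarrow> 'a \<Rightarrow> real" where
  "norm_sum X n \<omega> = (\<Sum>k=1..n. X k \<omega>) / sqrt (real n)"

(* f is an absolutely continuous density of F and f' is a Radon-Nikodym derivative of f. *)
definition ac_density ::
    "'a measure \<Rightarrow> ('a \<Rightarrow> real) \<Rightarrow> (real \<Rightarrow> real) \<Rightarrow> (real \<Rightarrow> real) \<Rightarrow> bool" where
  "ac_density M F f f' \<longleftrightarrow>
     distributed M lborel F (\<lambda>x. ennreal (f x)) \<and>
     (\<forall>x. 0 \<le> f x) \<and>
     (\<forall>a b. a \<le> b \<longrightarrow>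
        set_integrable lborel {a..b} f' \<and> f b - f a = (LINT x:{a..b}|lborel. f' x))"

(* The absolutely continuous density is unique and its derivative is unique almost everywhere, so the
   infima below run over a single value; they are \<infinity> when there is no such density.
   Almost everywhere on {f = 0} the derivative vanishes, in agreement with 0 / 0 = 0. *)
definition fisher_information :: "'a measure \<Rightarrow> ('a \<Rightarrow> real) \<Rightarrow> ennreal" where
  "fisher_information M F =
     (INF (f, f') \<in> {(f, f'). ac_density M F f f'}. \<integral>\<^sup>+ x. ennreal ((f' x)\<^sup>2 / f x) \<partial>lborel)"

(* I(F || Z) with Z standard normal, for F of mean 0 and variance 1; f' / f is the score of F. *)
definition fisher_distance :: "'a measure \<Rightarrow> ('a \<Rightarrow> real) \<Rightarrow> ennreal" where
  "fisher_distance M F =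
     (INF (f, f') \<in> {(f, f'). ac_density M F f f'}.
        \<integral>\<^sup>+ \<omega>. ennreal ((f' (F \<omega>) / f (F \<omega>) + F \<omega>)\<^sup>2) \<partial>M)"

definition abs_moment :: "'a measure \<Rightarrow> nat \<Rightarrow> ('a \<Rightarrow> real) \<Rightarrow> ennreal" where
  "abs_moment M r Y = (\<integral>\<^sup>+ \<omega>. ennreal (\<bar>Y \<omega>\<bar> ^ r) \<partial>M)"

definition stein_beta ::
    "'a measure \<Rightarrow> (nat \<Rightarrow> 'a \<Rightarrow> real) \<Rightarrow> (nat \<Rightarrow> real \<Rightarrow> real) \<Rightarrow> nat \<Rightarrow> ennreal" where
  "stein_beta M X p n\<^sub>0 =
     Max {SUP k\<in>{n\<^sub>0 + 1..}. abs_moment M 4 (X k),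
          SUP k\<in>{n\<^sub>0 + 1..}. abs_moment M 8 (\<lambda>\<omega>. stein_kernel (p k) (X k \<omega>)),
          SUP k\<in>{n\<^sub>0 + 1..}. abs_moment M 8 (\<lambda>\<omega>. deriv (stein_kernel (p k)) (X k \<omega>))}"

definition stein_beta_bar ::
    "'a measure \<Rightarrow> (nat \<Rightarrow> 'a \<Rightarrow> real) \<Rightarrow> (nat \<Rightarrow> real \<Rightarrow> real) \<Rightarrow> nat \<Rightarrow> ennreal" where
  "stein_beta_bar M X p n\<^sub>0 =
     (SUP k\<in>{n\<^sub>0 + 1..}. abs_moment M 2 (\<lambda>\<omega>. stein_kernel (p k) (X k \<omega>)))"

end

theory Submission
  imports Defs
begin

text \<open>
  Let \<open>S = S_{n0}\<close>, \<open>V = X_{n0+1} + ... + X_n\<close>, \<open>T = \<tau>_{n0+1}(X_{n0+1}) + ... + \<tau>_n(X_n)\<close> and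
  \<open>\<sigma> = sqrt n0\<close>, so that \<open>F = S_n = (\<sigma> S + V) / sqrt n\<close>.

  If a weight \<open>G\<close> satisfies \<open>E[\<phi>'(F)] = E[\<phi>(F) G]\<close> for enough test functions \<open>\<phi>\<close>, then the score of \<open>F\<close>
  evaluated at \<open>F\<close> is \<open>- E[G | F]\<close>. Conditional expectations contract the mean square, so
  \<open>I(F||Z) \<le> E[(G - F)\<^sup>2]\<close>: this is \<open>fisher_distance_le_score_residual\<close>. It remains to find a weight that is
  close to \<open>F\<close>.

  The weight comes from the vector field \<open>\<partial>_S + \<Sum>_k \<tau>_k(X_k) \<partial>_k\<close>, which turns \<open>\<phi>(F)\<close> into
  \<open>\<phi>'(F) (\<sigma> + T) / sqrt n\<close>. Dividing by \<open>\<sigma> + T\<close> and integrating by parts in each independent coordinate,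
  with the score \<open>\<rho>\<close> of \<open>S\<close> in the first (\<open>score_identity\<close>) and with the identity of the Stein kernel in
  the others (\<open>stein_identity\<close>), gives \<open>integration_by_parts\<close> for

    \<open>G = sqrt n ((V - \<rho>(S)) / (\<sigma> + T) + (\<Sum>_k \<tau>_k \<tau>_k') / (\<sigma> + T)\<^sup>2)\<close>.

  Stein kernels are nonnegative, hence \<open>\<sigma> + T \<ge> 1\<close>. This is what the hypothesis on \<open>I(S_{n0})\<close> buys: in the
  directions \<open>k > n0\<close> alone the denominator would be \<open>T\<close>, whose negative moments can be infinite.

  Each \<open>\<tau>_k(X_k)\<close> has mean \<open>Var X_k = 1\<close>, so \<open>T\<close> concentrates at \<open>n - n0\<close> and \<open>G\<close> is close to \<open>V / sqrt n\<close> and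
  thus to \<open>F\<close>. The difference \<open>G - F\<close> is \<open>sqrt n\<close> times four terms of mean square \<open>O(1 / n\<^sup>2)\<close>
  (\<open>t1_bound\<close> to \<open>t4_bound\<close>). Two facts on independent sums suffice for this: a centred sum with
  bounded fourth moments has fourth moment \<open>O(n\<^sup>2)\<close> (\<open>sum_fourth_moment\<close>), and a sum of nonnegative
  variables of mean \<open>1\<close> and bounded second moments falls below half its mean with exponentially small
  probability (\<open>lower_tail_nonneg_sum\<close>).
\<close>

section \<open>Ramp functions and elementary estimates\<close>

text \<open>The antiderivative of the indicator of \<open>{a<..b}\<close> that vanishes at \<open>-\<infinity>\<close>. Testing with these functions
  determines a law, since their derivatives pick out the probabilities of intervals.\<close>

definition ramp :: "real \<Rightarrow> real \<Rightarrow> real \<Rightarrow> real" where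
  "ramp a b x = max 0 (min (x - a) (b - a))"

lemma ramp_measurable [measurable]: "ramp a b \<in> borel_measurable borel"
  unfolding ramp_def by measurable

lemma ramp_bounds: "a \<le> b \<Longrightarrow> 0 \<le> ramp a b x" "a \<le> b \<Longrightarrow> ramp a b x \<le> b - a"
  by (auto simp: ramp_def)

lemma ramp_continuous: "isCont (ramp a b) x"
  unfolding ramp_def by (intro continuous_intros)

lemma ramp_eq_integral:
  assumes "a \<le> b"
  shows "ramp a b x = (LINT t|lborel. indicator {a<..b} t * indicator {t<..} x)"
proof -
  have "(LINT t|lborel. indicator {a<..b} t * indicator {t<..} x) = (LINT t|lborel. indicator {a<..b} t * indicator {..<x} t :: real)"
    by (intro Bochner_Integration.integral_cong) (auto simp: indicator_def)
  also have "\<dots> = (LINT t|lborel. indicator ({a<..b} \<inter> {..<x}) t :: real)"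
    by (intro Bochner_Integration.integral_cong) (auto simp: indicator_def)
  also have "\<dots> = measure lborel ({a<..b} \<inter> {..<x})"
    by simp
  also have "({a<..b} \<inter> {..<x}) = (if x \<le> b then {a<..<x} else {a<..b})"
    by auto
  also have "measure lborel \<dots> = ramp a b x"
    using assms by (cases "a \<le> x") (auto simp: ramp_def)
  finally show ?thesis by simp
qed

text \<open>Fubini for the representation of the ramp as an integral of half-line indicators. It turns
  integration by parts against ramps into a statement on tail integrals, and it is used both for the
  weight \<open>G\<close> on the probability space and for the derivative of a density on the line.\<close>

lemma integral_ramp_mult:
  fixes g w :: "'b \<Rightarrow> real"
  assumes "sigma_finite_measure N" and ab: "a \<le> b" and g: "integrable N g" and w[measurable]: "w \<in> borel_measurable N"
  shows "(LINT y|N. ramp a b (w y) * g y) =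
         (LINT t:{a<..b}|lborel. (LINT y|N. indicator {t<..} (w y) * g y))"
proof -
  interpret N: sigma_finite_measure N by fact
  interpret pair_sigma_finite lborel N ..
  have [measurable]: "g \<in> borel_measurable N" using g by simp
  define k where "k = (\<lambda>t y. indicator {a<..b} t * (indicator {t<..} (w y) * g y))"
  have k_alt: "k = (\<lambda>t y. indicator {a<..b} t * ((if t < w y then 1 else 0) * g y))"
    by (auto simp: k_def fun_eq_iff indicator_def)
  have int0: "integrable (lborel \<Otimes>\<^sub>M N) (\<lambda>(t,y). indicator {a<..b} t * g y)"
  proof (rule Fubini_integrable)
    have "(\<lambda>x. LINT y|N. norm ((case (x, y) of (t, y) \<Rightarrow> indicator {a<..b} t * g y)::real))
        = (\<lambda>x. indicator {a<..b} x * (LINT y|N. \<bar>g y\<bar>))"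
      by (simp add: abs_mult)
    thus "integrable lborel (\<lambda>x. LINT y|N. norm ((case (x, y) of (t, y) \<Rightarrow> indicator {a<..b} t * g y)::real))"
      using ab by simp
  qed (use g in auto)
  have int: "integrable (lborel \<Otimes>\<^sub>M N) (case_prod k)"
    by (rule Bochner_Integration.integrable_bound[OF int0])
       (auto simp: k_alt abs_mult split: prod.splits)
  have "(LINT y|N. ramp a b (w y) * g y) = (LINT y|N. (LINT t|lborel. k t y))"
    by (simp add: ramp_eq_integral[OF ab] k_def mult.assoc[symmetric])
  also have "\<dots> = (LINT t|lborel. (LINT y|N. k t y))"
    using Fubini_integral[OF int] by simp
  also have "\<dots> = (LINT t:{a<..b}|lborel. (LINT y|N. indicator {t<..} (w y) * g y))"
    by (simp add: k_def set_lebesgue_integral_def)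
  finally show ?thesis .
qed

lemma ramp_deriv:
  assumes "a < b" "x \<noteq> a" "x \<noteq> b"
  shows "(ramp a b has_real_derivative indicator {a<..b} x) (at x)"
proof -
  consider "x < a" | "a < x" "x < b" | "b < x" using assms by linarith
  thus ?thesis
  proof cases
    case 1
    have "((\<lambda>_. 0) has_real_derivative indicator {a<..b} x) (at x)" using 1 by simp
    thus ?thesis by (rule has_field_derivative_transform_within_open[where S="{..<a}"]) (use 1 assms in \<open>auto simp: ramp_def\<close>)
  next
    case 2
    have "((\<lambda>x. x - a) has_real_derivative indicator {a<..b} x) (at x)" using 2 by (auto intro!: derivative_eq_intros)
    thus ?thesis by (rule has_field_derivative_transform_within_open[where S="{a<..<b}"]) (use 2 assms in \<open>auto simp: ramp_def\<close>)
  next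
    case 3
    have "((\<lambda>_. b - a) has_real_derivative indicator {a<..b} x) (at x)" using 3 by simp
    thus ?thesis by (rule has_field_derivative_transform_within_open[where S="{b<..}"]) (use 3 assms in \<open>auto simp: ramp_def\<close>)
  qed
qed

lemma integrable_bounded_mult:
  fixes w Y :: "'a \<Rightarrow> real"
  assumes "w \<in> borel_measurable M" "\<And>\<omega>. \<bar>w \<omega>\<bar> \<le> c" "integrable M Y"
  shows "integrable M (\<lambda>\<omega>. w \<omega> * Y \<omega>)"
proof (rule Bochner_Integration.integrable_bound)
  show "integrable M (\<lambda>\<omega>. c * Y \<omega>)" using assms(3) by simp
  show "AE \<omega> in M. norm (w \<omega> * Y \<omega>) \<le> norm (c * Y \<omega>)"
    using order.trans[OF assms(2) abs_ge_self] by (auto simp: abs_mult intro!: mult_right_mono)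
qed (use assms in measurable)

lemma ratio_bounds:
  fixes t D :: real
  assumes "0 \<le> t" "t \<le> D" "1 \<le> D"
  shows "0 \<le> t / D" "t / D \<le> 1" "0 \<le> t / D\<^sup>2" "t / D\<^sup>2 \<le> 1"
proof -
  show 1: "0 \<le> t / D" "t / D \<le> 1" "0 \<le> t / D\<^sup>2" using assms by auto
  have "t / D\<^sup>2 = (t / D) / D" by (simp add: power2_eq_square)
  also have "\<dots> \<le> (t / D) / 1" by (rule divide_left_mono) (use 1 assms in auto)
  finally show "t / D\<^sup>2 \<le> 1" using 1 by simp
qed

lemma LIMSEQ_eq_beyond:
  fixes r :: real
  assumes "\<And>n. r < real n \<Longrightarrow> X n = l"
  shows "X \<longlonglongrightarrow> l"
proof (rule tendsto_eventually)
  show "eventually (\<lambda>n. X n = l) sequentially"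
    using eventually_gt_at_top[of "nat \<lceil>r\<rceil>"] by eventually_elim (rule assms, linarith)
qed

section \<open>Bounding the Fisher distance by a score weight\<close>

text \<open>The measure \<open>B \<mapsto> E[G; F \<in> B]\<close> is absolutely continuous as soon as the law of \<open>F\<close> is, so it has a
  Radon-Nikodym derivative \<open>D\<close>; in terms of the density \<open>f\<close> of \<open>F\<close>, \<open>D(x) = E[G | F = x] f(x)\<close>.\<close>

lemma (in prob_space) weighted_law_density_nonneg:
  fixes F G :: "'a \<Rightarrow> real"
  assumes F[measurable]: "F \<in> borel_measurable M" and G: "integrable M G" and pos: "\<And>\<omega>. 0 \<le> G \<omega>"
    and ac: "absolutely_continuous lborel (distr M lborel F)"
  obtains D where "integrable lborel D"
    "\<And>\<phi>. \<phi> \<in> borel_measurable borel \<Longrightarrow> (LINT x|lborel. \<phi> x * D x) = expectation (\<lambda>\<omega>. \<phi> (F \<omega>) * G \<omega>)"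
proof -
  have Gm[measurable]: "G \<in> borel_measurable M" using G by simp
  define N where "N = distr (density M (\<lambda>\<omega>. ennreal (G \<omega>))) lborel F"
  have fin: "finite_measure N"
  proof (rule finite_measureI)
    have "emeasure N (space N) = emeasure (density M (\<lambda>\<omega>. ennreal (G \<omega>))) (space M)"
      unfolding N_def by (subst emeasure_distr) auto
    also have "\<dots> = (\<integral>\<^sup>+\<omega>. ennreal (G \<omega>) \<partial>M)"
      by (subst emeasure_density) (auto intro!: nn_integral_cong)
    also have "\<dots> = ennreal (expectation G)"
      by (rule nn_integral_eq_integral) (use G pos in auto)
    finally show "emeasure N (space N) \<noteq> \<infinity>" by simp
  qed
  have acN: "absolutely_continuous lborel N"
    unfolding absolutely_continuous_def
  proof
    fix A assume A: "A \<in> null_sets (lborel :: real measure)"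
    have "A \<in> null_sets (distr M lborel F)" using ac A by (auto simp: absolutely_continuous_def)
    hence "F -` A \<inter> space M \<in> null_sets M" using A by (subst (asm) null_sets_distr_iff) auto
    hence "F -` A \<inter> space M \<in> null_sets (density M (\<lambda>\<omega>. ennreal (G \<omega>)))"
      using absolutely_continuousI_density[of "\<lambda>\<omega>. ennreal (G \<omega>)" M] by (auto simp: absolutely_continuous_def)
    thus "A \<in> null_sets N" unfolding N_def using A by (subst null_sets_distr_iff) auto
  qed
  have sN: "sets N = sets lborel" by (simp add: N_def)
  obtain D where D: "D \<in> borel_measurable lborel" "AE x in lborel. RN_deriv lborel N x = ennreal (D x)" "\<And>x. 0 \<le> D x"
    using sigma_finite_measure.real_RN_deriv[OF sigma_finite_lborel fin acN sN] by blast
  note [measurable] = D(1)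
  have ND: "N = density lborel (\<lambda>x. ennreal (D x))"
    using sigma_finite_measure.density_RN_deriv[OF sigma_finite_lborel acN sN] density_cong[OF _ _ D(2)] D(1) by simp
  show ?thesis
  proof
    interpret N: finite_measure N by fact
    have "integrable N (\<lambda>_. 1::real)" by simp
    thus "integrable lborel D" unfolding ND by (subst (asm) integrable_density) (use D in auto)
    fix \<phi> :: "real \<Rightarrow> real" assume [measurable]: "\<phi> \<in> borel_measurable borel"
    have "(LINT x|lborel. \<phi> x * D x) = integral\<^sup>L N \<phi>"
      unfolding ND by (subst integral_density) (use D in \<open>auto simp: mult.commute\<close>)
    also have "\<dots> = integral\<^sup>L (density M (\<lambda>\<omega>. ennreal (G \<omega>))) (\<lambda>\<omega>. \<phi> (F \<omega>))"
      unfolding N_def by (subst integral_distr) auto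
    also have "\<dots> = expectation (\<lambda>\<omega>. \<phi> (F \<omega>) * G \<omega>)"
      by (subst integral_density) (use pos in \<open>auto simp: mult.commute\<close>)
    finally show "(LINT x|lborel. \<phi> x * D x) = expectation (\<lambda>\<omega>. \<phi> (F \<omega>) * G \<omega>)" .
  qed
qed

lemma (in prob_space) weighted_law_density:
  fixes F G :: "'a \<Rightarrow> real"
  assumes F[measurable]: "F \<in> borel_measurable M" and G: "integrable M G"
    and ac: "absolutely_continuous lborel (distr M lborel F)"
  obtains D where "integrable lborel D"
    "\<And>\<phi> K. \<phi> \<in> borel_measurable borel \<Longrightarrow> (\<And>x. \<bar>\<phi> x\<bar> \<le> K) \<Longrightarrow>
       (LINT x|lborel. \<phi> x * D x) = expectation (\<lambda>\<omega>. \<phi> (F \<omega>) * G \<omega>)"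
proof -
  have Gm[measurable]: "G \<in> borel_measurable M" using G by simp
  have i1: "integrable M (\<lambda>\<omega>. max 0 (G \<omega>))" and i2: "integrable M (\<lambda>\<omega>. max 0 (- G \<omega>))"
    using G by (auto intro!: integrable_max)
  obtain D1 where D1: "integrable lborel D1"
    "\<And>\<phi>. \<phi> \<in> borel_measurable borel \<Longrightarrow> (LINT x|lborel. \<phi> x * D1 x) = expectation (\<lambda>\<omega>. \<phi> (F \<omega>) * max 0 (G \<omega>))"
    using weighted_law_density_nonneg[OF F i1 _ ac] by auto
  obtain D2 where D2: "integrable lborel D2"
    "\<And>\<phi>. \<phi> \<in> borel_measurable borel \<Longrightarrow> (LINT x|lborel. \<phi> x * D2 x) = expectation (\<lambda>\<omega>. \<phi> (F \<omega>) * max 0 (- G \<omega>))"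
    using weighted_law_density_nonneg[OF F i2 _ ac] by auto
  show ?thesis
  proof
    show "integrable lborel (\<lambda>x. D1 x - D2 x)" using D1 D2 by simp
    fix \<phi> :: "real \<Rightarrow> real" and K assume m[measurable]: "\<phi> \<in> borel_measurable borel" and b: "\<And>x. \<bar>\<phi> x\<bar> \<le> K"
    have bl: "integrable lborel (\<lambda>x. \<phi> x * D x)" if "integrable lborel D" for D
      by (rule integrable_bounded_mult[OF _ b that]) measurable
    have bm: "integrable M (\<lambda>\<omega>. \<phi> (F \<omega>) * Y \<omega>)" if "integrable M Y" for Y
      by (rule integrable_bounded_mult[OF _ b that]) measurable
    have "(LINT x|lborel. \<phi> x * (D1 x - D2 x)) = (LINT x|lborel. \<phi> x * D1 x) - (LINT x|lborel. \<phi> x * D2 x)"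
      using bl[OF D1(1)] bl[OF D2(1)] by (simp add: right_diff_distrib)
    also have "\<dots> = expectation (\<lambda>\<omega>. \<phi> (F \<omega>) * max 0 (G \<omega>)) - expectation (\<lambda>\<omega>. \<phi> (F \<omega>) * max 0 (- G \<omega>))"
      using D1(2)[OF m] D2(2)[OF m] by simp
    also have "\<dots> = expectation (\<lambda>\<omega>. \<phi> (F \<omega>) * max 0 (G \<omega>) - \<phi> (F \<omega>) * max 0 (- G \<omega>))"
      using bm[OF i1] bm[OF i2] by simp
    also have "\<dots> = expectation (\<lambda>\<omega>. \<phi> (F \<omega>) * G \<omega>)"
      by (intro Bochner_Integration.integral_cong) (auto simp: max_def)
    finally show "(LINT x|lborel. \<phi> x * (D1 x - D2 x)) = expectation (\<lambda>\<omega>. \<phi> (F \<omega>) * G \<omega>)" .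
  qed
qed

text \<open>By \<open>integral_ramp_mult\<close> the hypothesis says that the tail function \<open>H t = E[G; t < F]\<close> integrates to
  \<open>P(a < F \<le> b)\<close> over every interval. As \<open>H\<close> is continuous from the right by dominated convergence, a
  negative value would make some interval have negative probability.\<close>

lemma (in prob_space) law_has_tail_density:
  fixes F G :: "'a \<Rightarrow> real"
  assumes F[measurable]: "F \<in> borel_measurable M" and G: "integrable M G"
    and ibp: "\<And>a b. a < b \<Longrightarrow> prob {\<omega>\<in>space M. F \<omega> \<in> {a<..b}} = expectation (\<lambda>\<omega>. ramp a b (F \<omega>) * G \<omega>)"
  defines "H \<equiv> \<lambda>t. expectation (\<lambda>\<omega>. indicator {t<..} (F \<omega>) * G \<omega>)"
  shows "\<And>t. 0 \<le> H t" and "distributed M lborel F (\<lambda>x. ennreal (H x))"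
proof -
  have Gm[measurable]: "G \<in> borel_measurable M" using G by simp
  have H_meas[measurable]: "H \<in> borel_measurable borel"
  proof -
    have "H = (\<lambda>t. expectation (\<lambda>\<omega>. (if t < F \<omega> then 1 else 0) * G \<omega>))"
      unfolding H_def by (auto simp: indicator_def intro!: Bochner_Integration.integral_cong)
    thus ?thesis by simp
  qed
  have Hb: "\<bar>H t\<bar> \<le> expectation (\<lambda>\<omega>. \<bar>G \<omega>\<bar>)" for t
  proof -
    have "\<bar>H t\<bar> \<le> expectation (\<lambda>\<omega>. \<bar>indicator {t<..} (F \<omega>) * G \<omega>\<bar>)" unfolding H_def by (rule integral_abs_bound)
    also have "\<dots> \<le> expectation (\<lambda>\<omega>. \<bar>G \<omega>\<bar>)"
      by (rule integral_mono_AE) (use G in \<open>auto simp: indicator_def intro!: Bochner_Integration.integrable_bound[OF G]\<close>)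
    finally show ?thesis .
  qed
  have const_int: "integrable lborel (\<lambda>x. indicator {a<..b} x * c)" for a b c :: real
    by (cases "a \<le> b") auto
  have Hset: "set_integrable lborel {a<..b} H" for a b
    unfolding set_integrable_def
    by (rule Bochner_Integration.integrable_bound[OF const_int[of a b "expectation (\<lambda>\<omega>. \<bar>G \<omega>\<bar>)"]])
       (use Hb order.trans[OF abs_ge_zero Hb] in \<open>auto simp: indicator_def\<close>)
  have Hint: "prob {\<omega>\<in>space M. F \<omega> \<in> {a<..b}} = (LINT t:{a<..b}|lborel. H t)" if "a < b" for a b
    unfolding ibp[OF that] H_def
    by (rule integral_ramp_mult) (use that G in \<open>auto intro: sigma_finite_measure_axioms\<close>)
  have Hrc: "(H \<longlongrightarrow> H t) (at_right t)" for t
    unfolding H_def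
  proof (rule tendsto_at_right_sequentially[of t "t+1"])
    fix S :: "nat \<Rightarrow> real" assume S: "\<And>n. t < S n" "\<And>n. S n < t + 1" "decseq S" "S \<longlonglongrightarrow> t"
    show "(\<lambda>n. expectation (\<lambda>\<omega>. indicator {S n<..} (F \<omega>) * G \<omega>)) \<longlonglongrightarrow> expectation (\<lambda>\<omega>. indicator {t<..} (F \<omega>) * G \<omega>)"
    proof (rule integral_dominated_convergence[where w="\<lambda>\<omega>. \<bar>G \<omega>\<bar>"])
      show "AE \<omega> in M. (\<lambda>i. indicator {S i<..} (F \<omega>) * G \<omega>) \<longlonglongrightarrow> indicator {t<..} (F \<omega>) * G \<omega>"
      proof (rule AE_I2)
        fix \<omega>
        have "eventually (\<lambda>i. indicator {S i<..} (F \<omega>) * G \<omega> = indicator {t<..} (F \<omega>) * G \<omega>) sequentially"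
        proof (cases "t < F \<omega>")
          case True
          hence "eventually (\<lambda>i. S i < F \<omega>) sequentially" using S(4) order_tendstoD(2) by blast
          thus ?thesis by eventually_elim (use True in auto)
        next
          case False
          hence "\<not> S i < F \<omega>" for i using S(1)[of i] by simp
          thus ?thesis using False by simp
        qed
        thus "(\<lambda>i. indicator {S i<..} (F \<omega>) * G \<omega>) \<longlonglongrightarrow> indicator {t<..} (F \<omega>) * G \<omega>"
          by (rule tendsto_eventually)
      qed
    qed (use G in \<open>auto simp: indicator_def\<close>)
  qed simp
  show Hpos: "0 \<le> H t" for t
  proof (rule ccontr)
    assume "\<not> 0 \<le> H t"
    hence neg: "H t < 0" by simp
    have "eventually (\<lambda>s. H s < H t / 2) (at_right t)"
      using order_tendstoD(2)[OF Hrc, of t "H t / 2"] neg by simp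
    then obtain b where b: "t < b" "\<And>s. t < s \<Longrightarrow> s < b \<Longrightarrow> H s < H t / 2"
      by (auto simp: eventually_at_right_field)
    define c where "c = (t + b) / 2"
    have c: "t < c" "c < b" using b by (auto simp: c_def)
    have "(LINT s:{t<..c}|lborel. H s) \<le> (LINT s:{t<..c}|lborel. H t / 2)"
      by (rule set_integral_mono) (use Hset c b in \<open>auto simp: set_integrable_def intro!: less_imp_le\<close>)
    also have "\<dots> = (c - t) * (H t / 2)" using c by (simp add: set_lebesgue_integral_def)
    also have "\<dots> < 0" using c neg by (simp add: mult_pos_neg)
    finally show False using Hint[OF c(1)] measure_nonneg[of M "{\<omega>\<in>space M. F \<omega> \<in> {t<..c}}"] by linarith
  qed
  have "distr M lborel F = density lborel (\<lambda>x. ennreal (H x))"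
  proof (rule measure_eqI_generator_eq[where \<Omega>=UNIV and E="range (\<lambda>(a, b). {a <.. b::real})" and A="\<lambda>i. {- real i <.. real i}"])
    fix Y :: "real set" assume "Y \<in> range (\<lambda>(a, b). {a <.. b::real})"
    then obtain a b where Y: "Y = {a<..b}" by auto
    show "emeasure (distr M lborel F) Y = emeasure (density lborel (\<lambda>x. ennreal (H x))) Y"
    proof (cases "a < b")
      case True
      have "emeasure (distr M lborel F) Y = ennreal (prob {\<omega>\<in>space M. F \<omega> \<in> {a<..b}})"
        unfolding Y by (subst emeasure_distr) (auto simp: emeasure_eq_measure vimage_def Int_def conj_commute)
      also have "\<dots> = ennreal (LINT t|lborel. indicator {a<..b} t * H t)"
        using Hint[OF True] by (simp add: set_lebesgue_integral_def)
      also have "\<dots> = (\<integral>\<^sup>+t. ennreal (indicator {a<..b} t * H t) \<partial>lborel)"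
        by (rule nn_integral_eq_integral[symmetric]) (use Hset[of a b] Hpos in \<open>auto simp: set_integrable_def\<close>)
      also have "\<dots> = emeasure (density lborel (\<lambda>x. ennreal (H x))) Y"
        unfolding Y by (subst emeasure_density) (auto intro!: nn_integral_cong simp: indicator_def)
      finally show ?thesis .
    qed (simp add: Y)
  next
    show "Int_stable (range (\<lambda>(a, b). {a <.. b::real}))" by (auto simp: Int_stable_def)
    show "\<Union> (range (\<lambda>i. {- real i<..real i})) = UNIV"
    proof safe
      fix x :: real
      obtain n where "\<bar>x\<bar> < real n" using reals_Archimedean2 by blast
      hence "x \<in> {- real n<..real n}" by auto
      thus "x \<in> \<Union> (range (\<lambda>i. {- real i<..real i}))" by blast
    qed simp
    show "emeasure (distr M lborel F) {- real i<..real i} \<noteq> \<infinity>" for i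
      by (subst emeasure_distr) (auto simp: emeasure_eq_measure)
  qed (auto simp: borel_sigma_sets_Ioc)
  thus "distributed M lborel F (\<lambda>x. ennreal (H x))" by (auto simp: distributed_def)
qed

text \<open>Increments of the tail density are \<open>- E[G; a < F \<le> b]\<close>, which the density of the weighted law
  writes as an integral. So integration by parts against ramps alone already yields an
  absolutely continuous density together with its derivative.\<close>

lemma (in prob_space) law_has_ac_density:
  fixes F G :: "'a \<Rightarrow> real"
  assumes F[measurable]: "F \<in> borel_measurable M" and G: "integrable M G"
    and ibp: "\<And>a b. a < b \<Longrightarrow> prob {\<omega>\<in>space M. F \<omega> \<in> {a<..b}} = expectation (\<lambda>\<omega>. ramp a b (F \<omega>) * G \<omega>)"
  obtains f f' where "ac_density M F f f'" "f' \<in> borel_measurable borel"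
    "\<And>\<phi> K. \<phi> \<in> borel_measurable borel \<Longrightarrow> (\<And>x. \<bar>\<phi> x\<bar> \<le> K) \<Longrightarrow>
       (LINT x|lborel. \<phi> x * f' x) = - expectation (\<lambda>\<omega>. \<phi> (F \<omega>) * G \<omega>)"
proof -
  have Gm[measurable]: "G \<in> borel_measurable M" using G by simp
  define H where "H = (\<lambda>t. expectation (\<lambda>\<omega>. indicator {t<..} (F \<omega>) * G \<omega>))"
  have Hpos: "0 \<le> H t" for t unfolding H_def by (rule law_has_tail_density(1)[OF F G ibp])
  have dist: "distributed M lborel F (\<lambda>x. ennreal (H x))"
    unfolding H_def by (rule law_has_tail_density(2)[OF F G ibp])
  have "H \<in> borel_measurable lborel" by (rule distributed_real_measurable[OF _ dist]) (use Hpos in auto)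
  hence "absolutely_continuous lborel (distr M lborel F)"
    using dist absolutely_continuousI_density[of "\<lambda>x. ennreal (H x)" lborel] by (simp add: distributed_def)
  then obtain D where D: "integrable lborel D"
    "\<And>\<phi> K. \<phi> \<in> borel_measurable borel \<Longrightarrow> (\<And>x. \<bar>\<phi> x\<bar> \<le> K) \<Longrightarrow>
       (LINT x|lborel. \<phi> x * D x) = expectation (\<lambda>\<omega>. \<phi> (F \<omega>) * G \<omega>)"
    using weighted_law_density[OF F G] by blast
  have Dm[measurable]: "D \<in> borel_measurable borel" using D(1) by simp
  show ?thesis
  proof
    show "ac_density M F H (\<lambda>x. - D x)"
      unfolding ac_density_def
    proof (intro conjI allI impI)
      fix a b :: real assume ab: "a \<le> b"
      show "set_integrable lborel {a..b} (\<lambda>x. - D x)"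
        using D(1) unfolding set_integrable_def by (intro integrable_mult_indicator) auto
      have gi: "integrable M (\<lambda>\<omega>. indicator {t<..} (F \<omega>) * G \<omega>)" for t
        by (rule Bochner_Integration.integrable_bound[OF G]) (auto simp: indicator_def)
      have "H b - H a = expectation (\<lambda>\<omega>. indicator {b<..} (F \<omega>) * G \<omega> - indicator {a<..} (F \<omega>) * G \<omega>)"
        unfolding H_def by (rule Bochner_Integration.integral_diff[symmetric]) (rule gi)+
      also have "\<dots> = expectation (\<lambda>\<omega>. - (indicator {a<..b} (F \<omega>) * G \<omega>))"
        by (intro Bochner_Integration.integral_cong) (use ab in \<open>auto simp: indicator_def\<close>)
      also have "\<dots> = - (LINT x|lborel. indicator {a<..b} x * D x)"
        by (subst D(2)[of "indicator {a<..b}" 1]) (auto simp: indicator_def)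
      also have "\<dots> = (LINT x|lborel. indicator {a<..b} x * (- D x))" by simp
      also have "\<dots> = (LINT x|lborel. indicator {a..b} x * (- D x))"
        by (intro integral_cong_AE) (use AE_lborel_singleton[of a] in \<open>auto simp: indicator_def elim!: eventually_mono\<close>)
      finally show "H b - H a = (LINT x:{a..b}|lborel. - D x)" by (simp add: set_lebesgue_integral_def)
    qed (use dist Hpos in auto)
  qed (use D(2) in auto)
qed

text \<open>With \<open>s\<close> the score of \<open>F\<close> shifted by the identity, testing with \<open>v = s\<close> would give
  \<open>E[s(F)\<^sup>2] = E[s(F) (F - G)] \<le> (E[s(F)\<^sup>2] + E[(G - F)\<^sup>2]) / 2\<close>. This is the contraction of conditional
  expectation in disguise. As \<open>s(F)\<close> is not known to be square integrable beforehand, \<open>s\<close> is cut off at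
  level \<open>n\<close> and Fatou's lemma removes the cut.\<close>

lemma (in prob_space) fisher_distance_le_score_residual:
  fixes F G :: "'a \<Rightarrow> real"
  assumes F: "integrable M F" and G: "integrable M G"
    and sq: "integrable M (\<lambda>\<omega>. (G \<omega> - F \<omega>)\<^sup>2)"
    and ibp: "\<And>a b. a < b \<Longrightarrow> prob {\<omega>\<in>space M. F \<omega> \<in> {a<..b}} = expectation (\<lambda>\<omega>. ramp a b (F \<omega>) * G \<omega>)"
  shows "fisher_distance M F \<le> ennreal (expectation (\<lambda>\<omega>. (G \<omega> - F \<omega>)\<^sup>2))"
proof -
  have Fm[measurable]: "F \<in> borel_measurable M" and Gm[measurable]: "G \<in> borel_measurable M" using F G by auto
  obtain f f' where ff: "ac_density M F f f'" and f'm[measurable]: "f' \<in> borel_measurable borel"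
    and f'_int: "\<And>\<phi> K. \<phi> \<in> borel_measurable borel \<Longrightarrow> (\<And>x. \<bar>\<phi> x\<bar> \<le> K) \<Longrightarrow>
       (LINT x|lborel. \<phi> x * f' x) = - expectation (\<lambda>\<omega>. \<phi> (F \<omega>) * G \<omega>)"
    using law_has_ac_density[OF Fm G ibp] by blast
  have dist: "distributed M lborel F (\<lambda>x. ennreal (f x))" and fpos: "\<And>x. 0 \<le> f x"
    using ff by (auto simp: ac_density_def)
  have fm[measurable]: "f \<in> borel_measurable borel"
    using distributed_real_measurable[OF _ dist] fpos by simp
  have f_pos_AE: "AE \<omega> in M. f (F \<omega>) > 0"
  proof -
    have "AE x in distr M lborel F. f x > 0"
      unfolding distributed_distr_eq_density[OF dist] by (subst AE_density) (auto simp: less_le fpos)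
    thus ?thesis by (subst (asm) AE_distr_iff) auto
  qed
  define s where "s = (\<lambda>x. f' x / f x + x)"
  have sm[measurable]: "s \<in> borel_measurable borel" unfolding s_def by measurable
  define R where "R = expectation (\<lambda>\<omega>. (G \<omega> - F \<omega>)\<^sup>2)"
  have bound: "(\<integral>\<^sup>+\<omega>. ennreal ((if \<bar>s (F \<omega>)\<bar> \<le> real n then s (F \<omega>) else 0)\<^sup>2) \<partial>M) \<le> ennreal R" for n
  proof -
    define v where "v = (\<lambda>x. if \<bar>s x\<bar> \<le> real n then s x else 0)"
    have vm[measurable]: "v \<in> borel_measurable borel" unfolding v_def by measurable
    have vb: "\<bar>v x\<bar> \<le> real n" for x by (auto simp: v_def)
    \<comment> \<open>The identity for \<open>f'\<close> also sees \<open>{f = 0}\<close>, which the law of \<open>F\<close> does not charge.\<close>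
    define u where "u = (\<lambda>x. v x * indicator {0<..} (f x))"
    have um[measurable]: "u \<in> borel_measurable borel" unfolding u_def by measurable
    have ub: "\<bar>u x\<bar> \<le> real n" for x using vb[of x] by (auto simp: u_def indicator_def)
    have vint: "integrable M (\<lambda>\<omega>. v (F \<omega>) * Y \<omega>)" if Y: "integrable M Y" for Y
      by (rule integrable_bounded_mult[OF _ vb Y]) measurable
    have v2int: "integrable M (\<lambda>\<omega>. (v (F \<omega>))\<^sup>2)"
      by (rule integrable_const_bound[where B="(real n)\<^sup>2"]) (use vb in \<open>auto intro!: power_mono simp: abs_le_square_iff[symmetric]\<close>)
    have "expectation (\<lambda>\<omega>. u (F \<omega>) * (f' (F \<omega>) / f (F \<omega>))) = (LINT x|lborel. f x * (u x * (f' x / f x)))"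
      by (rule distributed_integral[OF dist, symmetric]) (use fpos in auto)
    also have "\<dots> = (LINT x|lborel. u x * f' x)"
      by (intro Bochner_Integration.integral_cong) (auto simp: u_def indicator_def)
    also have "\<dots> = - expectation (\<lambda>\<omega>. u (F \<omega>) * G \<omega>)"
      by (rule f'_int[OF um ub])
    also have "expectation (\<lambda>\<omega>. u (F \<omega>) * G \<omega>) = expectation (\<lambda>\<omega>. v (F \<omega>) * G \<omega>)"
      by (rule integral_cong_AE) (use f_pos_AE in \<open>auto simp: u_def elim!: eventually_mono\<close>)
    finally have e1: "expectation (\<lambda>\<omega>. v (F \<omega>) * (f' (F \<omega>) / f (F \<omega>))) = - expectation (\<lambda>\<omega>. v (F \<omega>) * G \<omega>)"
      using f_pos_AE by (subst integral_cong_AE[where g="\<lambda>\<omega>. u (F \<omega>) * (f' (F \<omega>) / f (F \<omega>))"]) (auto simp: u_def elim!: eventually_mono)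
    have v2: "(v x)\<^sup>2 = v x * (f' x / f x) + v x * x" for x
      by (auto simp: v_def s_def power2_eq_square distrib_left)
    have i1: "integrable M (\<lambda>\<omega>. v (F \<omega>) * (f' (F \<omega>) / f (F \<omega>)))"
      using Bochner_Integration.integrable_diff[OF v2int vint[OF F]] by (simp add: v2)
    have "expectation (\<lambda>\<omega>. (v (F \<omega>))\<^sup>2) = expectation (\<lambda>\<omega>. v (F \<omega>) * (f' (F \<omega>) / f (F \<omega>))) + expectation (\<lambda>\<omega>. v (F \<omega>) * F \<omega>)"
      unfolding v2 by (rule Bochner_Integration.integral_add[OF i1 vint[OF F]])
    also have "\<dots> = expectation (\<lambda>\<omega>. v (F \<omega>) * F \<omega> - v (F \<omega>) * G \<omega>)"
      unfolding e1 using vint[OF F] vint[OF G] by simp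
    also have "\<dots> \<le> expectation (\<lambda>\<omega>. (v (F \<omega>))\<^sup>2 / 2 + (G \<omega> - F \<omega>)\<^sup>2 / 2)"
    proof (rule integral_mono)
      show "v (F \<omega>) * F \<omega> - v (F \<omega>) * G \<omega> \<le> (v (F \<omega>))\<^sup>2 / 2 + (G \<omega> - F \<omega>)\<^sup>2 / 2" for \<omega>
        using zero_le_power2[of "v (F \<omega>) + (G \<omega> - F \<omega>)"] by (simp add: power2_eq_square field_simps)
    qed (use vint[OF F] vint[OF G] v2int sq in auto)
    also have "\<dots> = expectation (\<lambda>\<omega>. (v (F \<omega>))\<^sup>2) / 2 + R / 2"
      using v2int sq by (simp add: R_def)
    finally have "expectation (\<lambda>\<omega>. (v (F \<omega>))\<^sup>2) \<le> R" by simp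
    moreover have "(\<integral>\<^sup>+\<omega>. ennreal ((v (F \<omega>))\<^sup>2) \<partial>M) = ennreal (expectation (\<lambda>\<omega>. (v (F \<omega>))\<^sup>2))"
      by (rule nn_integral_eq_integral[OF v2int]) simp
    ultimately show ?thesis unfolding v_def by (simp add: ennreal_leI)
  qed
  have "(\<integral>\<^sup>+\<omega>. ennreal ((s (F \<omega>))\<^sup>2) \<partial>M)
      \<le> (\<integral>\<^sup>+\<omega>. liminf (\<lambda>n. ennreal ((if \<bar>s (F \<omega>)\<bar> \<le> real n then s (F \<omega>) else 0)\<^sup>2)) \<partial>M)"
  proof (rule nn_integral_mono)
    fix \<omega>
    have ev: "eventually (\<lambda>n. \<bar>s (F \<omega>)\<bar> \<le> real n) sequentially"
      using eventually_ge_at_top[of "nat \<lceil>\<bar>s (F \<omega>)\<bar>\<rceil>"] by eventually_elim linarith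
    show "ennreal ((s (F \<omega>))\<^sup>2) \<le> liminf (\<lambda>n. ennreal ((if \<bar>s (F \<omega>)\<bar> \<le> real n then s (F \<omega>) else 0)\<^sup>2))"
      by (rule Liminf_bounded, rule eventually_mono[OF ev]) simp
  qed
  also have "\<dots> \<le> liminf (\<lambda>n. \<integral>\<^sup>+\<omega>. ennreal ((if \<bar>s (F \<omega>)\<bar> \<le> real n then s (F \<omega>) else 0)\<^sup>2) \<partial>M)"
    by (rule nn_integral_liminf) measurable
  also have "\<dots> \<le> ennreal R"
    by (rule order.trans[OF Liminf_le_Limsup Limsup_bounded]) (auto simp: bound)
  finally have "(\<integral>\<^sup>+\<omega>. ennreal ((f' (F \<omega>) / f (F \<omega>) + F \<omega>)\<^sup>2) \<partial>M) \<le> ennreal R" by (simp add: s_def)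
  moreover have "fisher_distance M F \<le> (\<integral>\<^sup>+\<omega>. ennreal ((f' (F \<omega>) / f (F \<omega>) + F \<omega>)\<^sup>2) \<partial>M)"
    unfolding fisher_distance_def by (rule INF_lower2[of "(f, f')"]) (use ff in auto)
  ultimately show ?thesis unfolding R_def by simp
qed

section \<open>Integration by parts for a law of finite Fisher information\<close>

text \<open>At a zero of \<open>f \<ge> 0\<close> the difference quotients from the right are nonnegative and those from the left
  nonpositive, and almost everywhere both converge to \<open>f'\<close>. The differentiation theorem
  \<open>integrable_ccontinuous_explicit\<close> is one-sided, whence the second application to the reflected function.\<close>

lemma ae_deriv_zero_on_zero_set:
  fixes f f' :: "real \<Rightarrow> real"
  assumes pos: "\<And>x. 0 \<le> f x"
    and int: "\<And>a b. a \<le> b \<Longrightarrow> set_integrable lborel {a..b} f'"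
    and ac: "\<And>a b. a \<le> b \<Longrightarrow> f b - f a = (LINT x:{a..b}|lborel. f' x)"
  shows "AE x in lborel. f x = 0 \<longrightarrow> f' x = 0"
proof -
  have io: "f' integrable_on {a..b}" for a b
    using set_borel_integral_eq_integral(1)[OF int] by (cases "a \<le> b") auto
  have fd: "integral {a..b} f' = f b - f a" if "a \<le> b" for a b
    using set_borel_integral_eq_integral(2)[OF int[OF that]] ac[OF that] by simp
  have "\<And>a b. f' integrable_on cbox a b" using io by simp
  then obtain N1 where N1: "negligible N1"
    "\<And>x e. \<lbrakk>x \<notin> N1; 0 < e\<rbrakk> \<Longrightarrow> \<exists>d>0. \<forall>h. 0 < h \<and> h < d \<longrightarrow>
         norm (integral (cbox x (x + h *\<^sub>R One)) f' /\<^sub>R h ^ DIM(real) - f' x) < e"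
    using integrable_ccontinuous_explicit[of f'] by blast
  have "\<And>a b. (\<lambda>x. f' (- x)) integrable_on cbox a b" 
    using io Henstock_Kurzweil_Integration.integrable_reflect_real[where f=f' and a="- b" and b="- a" for a b] by simp
  then obtain N2 where N2: "negligible N2"
    "\<And>x e. \<lbrakk>x \<notin> N2; 0 < e\<rbrakk> \<Longrightarrow> \<exists>d>0. \<forall>h. 0 < h \<and> h < d \<longrightarrow>
         norm (integral (cbox x (x + h *\<^sub>R One)) (\<lambda>x. f' (- x)) /\<^sub>R h ^ DIM(real) - f' (- x)) < e"
    using integrable_ccontinuous_explicit[of "\<lambda>x. f' (- x)"] by blast
  have zero: "f' x = 0" if x: "x \<notin> N1" "- x \<notin> N2" "f x = 0" for x
  proof (rule antisym)
    show "0 \<le> f' x"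
    proof (rule ccontr)
      assume "\<not> 0 \<le> f' x"
      then obtain d where d: "d > 0" "\<And>h. 0 < h \<Longrightarrow> h < d \<Longrightarrow> \<bar>integral {x..x+h} f' / h - f' x\<bar> < - f' x"
        using N1(2)[OF x(1), of "- f' x"] by (auto simp: divide_inverse mult.commute)
      have "integral {x..x + d/2} f' = f (x + d/2)" using fd[of x "x + d/2"] d x by simp
      hence "0 \<le> integral {x..x + d/2} f' / (d/2)" using pos d by simp
      thus False using d(2)[of "d/2"] d(1) by linarith
    qed
    show "f' x \<le> 0"
    proof (rule ccontr)
      assume "\<not> f' x \<le> 0"
      then obtain d where d: "d > 0" "\<And>h. 0 < h \<Longrightarrow> h < d \<Longrightarrow> \<bar>integral {-x..-x+h} (\<lambda>x. f' (- x)) / h - f' x\<bar> < f' x"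
        using N2(2)[OF x(2), of "f' x"] by (auto simp: divide_inverse mult.commute)
      have "integral {-x..-x+d/2} (\<lambda>x. f' (- x)) = integral {x-d/2..x} f'"
        using Henstock_Kurzweil_Integration.integral_reflect_real[of x "x - d/2" f'] by simp
      also have "\<dots> = - f (x - d/2)" using fd[of "x - d/2" x] d x by simp
      finally have "integral {-x..-x+d/2} (\<lambda>x. f' (- x)) / (d/2) \<le> 0"
        using pos[of "x - d/2"] d by (simp add: divide_nonpos_pos)
      thus False using d(2)[of "d/2"] d(1) by linarith
    qed
  qed
  have "negligible (uminus ` N2)"
    by (rule negligible_differentiable_image_negligible[OF _ N2(1)]) (auto intro!: derivative_intros simp: differentiable_on_def)
  hence "negligible (N1 \<union> uminus ` N2)" using N1(1) by simp
  hence "AE x in lebesgue. x \<notin> N1 \<union> uminus ` N2"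
    by (intro AE_not_in) (simp add: negligible_iff_null_sets)
  hence "AE x in lebesgue. f x = 0 \<longrightarrow> f' x = 0"
    by eventually_elim (use zero in \<open>force intro: rev_image_eqI\<close>)
  thus ?thesis by (simp add: AE_completion_iff)
qed

locale finite_fisher = prob_space M for M :: "'a measure" +
  fixes S :: "'a \<Rightarrow> real" and f f' :: "real \<Rightarrow> real"
  assumes ac: "ac_density M S f f'"
    and fin: "(\<integral>\<^sup>+ x. ennreal ((f' x)\<^sup>2 / f x) \<partial>lborel) < \<infinity>"
begin

definition \<rho> :: "real \<Rightarrow> real" where "\<rho> x = f' x / f x"

lemma f_nonneg: "0 \<le> f x" and dist: "distributed M lborel S (\<lambda>x. ennreal (f x))"
  and f'_int: "a \<le> b \<Longrightarrow> set_integrable lborel {a..b} f'"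
  and f_diff: "a \<le> b \<Longrightarrow> f b - f a = (LINT x:{a..b}|lborel. f' x)"
  using ac by (auto simp: ac_density_def)

lemma f_measurable [measurable]: "f \<in> borel_measurable borel"
  using distributed_real_measurable[OF _ dist] f_nonneg by simp

lemma S_measurable [measurable]: "S \<in> borel_measurable M"
  using dist by (simp add: distributed_def)

lemma f'_measurable [measurable]: "f' \<in> borel_measurable borel"
proof (rule borel_measurable_LIMSEQ_real)
  fix x :: real
  show "(\<lambda>n. indicator {- real n..real n} x *\<^sub>R f' x) \<longlonglongrightarrow> f' x"
    by (rule LIMSEQ_eq_beyond[where r="\<bar>x\<bar>"]) (auto simp: abs_le_iff indicator_def)
next
  show "(\<lambda>x. indicator {- real n..real n} x *\<^sub>R f' x) \<in> borel_measurable borel" for n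
    using f'_int[of "- real n" "real n"] by (simp add: set_integrable_def)
qed

lemma rho_measurable [measurable]: "\<rho> \<in> borel_measurable borel"
  unfolding \<rho>_def[abs_def] by measurable

lemma integrable_f: "integrable lborel f"
  and integral_f: "(LINT x|lborel. f x) = 1"
proof -
  have "(\<integral>\<^sup>+x. ennreal (f x) \<partial>lborel) = (\<integral>\<^sup>+\<omega>. 1 \<partial>M)"
    using distributed_nn_integral[OF dist, of "\<lambda>_. 1"] by simp
  also have "\<dots> = ennreal 1" by (simp add: emeasure_space_1)
  finally have *: "(\<integral>\<^sup>+x. ennreal (f x) \<partial>lborel) = ennreal 1" .
  show "integrable lborel f"
    by (rule integrableI_nn_integral_finite[OF _ _ *]) (auto simp: f_nonneg)
  show "(LINT x|lborel. f x) = 1" by (rule integral_eq_nn_integral[THEN trans]) (auto simp: f_nonneg *)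
qed

lemma f'_zero: "AE x in lborel. f x = 0 \<longrightarrow> f' x = 0"
  by (rule ae_deriv_zero_on_zero_set[OF f_nonneg f'_int f_diff])

lemma integrable_fisher: "integrable lborel (\<lambda>x. (f' x)\<^sup>2 / f x)"
  by (rule integrableI_bounded) (use fin f_nonneg in auto)

text \<open>Where \<open>f > 0\<close>, \<open>|f'| \<le> f'\<^sup>2 / f + f\<close>; elsewhere \<open>f'\<close> vanishes almost everywhere.\<close>

lemma integrable_f': "integrable lborel f'"
proof (rule Bochner_Integration.integrable_bound)
  show "integrable lborel (\<lambda>x. (f' x)\<^sup>2 / f x + f x)" using integrable_fisher integrable_f by simp
  show "AE x in lborel. norm (f' x) \<le> norm ((f' x)\<^sup>2 / f x + f x)"
    using f'_zero
  proof eventually_elim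
    fix x assume *: "f x = 0 \<longrightarrow> f' x = 0"
    show "norm (f' x) \<le> norm ((f' x)\<^sup>2 / f x + f x)"
    proof (cases "f x = 0")
      case False
      hence fp: "0 < f x" using f_nonneg[of x] by simp
      have "0 \<le> (\<bar>f' x\<bar> - f x)\<^sup>2" by simp
      hence "2 * (f x * \<bar>f' x\<bar>) \<le> (f' x)\<^sup>2 + f x * f x"
        by (simp add: power2_eq_square algebra_simps)
      moreover have "0 \<le> f x * \<bar>f' x\<bar>" using fp by simp
      ultimately have "f x * \<bar>f' x\<bar> \<le> (f' x)\<^sup>2 + f x * f x" by linarith
      hence "\<bar>f' x\<bar> \<le> (f' x)\<^sup>2 / f x + f x" using fp by (simp add: field_simps)
      thus ?thesis by simp
    qed (use * in simp)
  qed
qed simp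

text \<open>As \<open>f'\<close> is integrable, \<open>f\<close> has a limit at \<open>\<infinity>\<close>, and a positive limit would contradict the integrability
  of \<open>f\<close>.\<close>

lemma f_tail: "f t = - (LINT y|lborel. indicator {t<..} y * f' y)"
proof -
  have lim: "((\<lambda>b. LINT y|lborel. indicator {t..b} y *\<^sub>R f' y) \<longlongrightarrow> (LINT y|lborel. indicator {t<..} y * f' y)) at_top"
  proof (rule integral_dominated_convergence_at_top[where w="\<lambda>y. \<bar>f' y\<bar>"])
    show "AE y in lborel. ((\<lambda>b. indicator {t..b} y *\<^sub>R f' y) \<longlongrightarrow> indicator {t<..} y * f' y) at_top"
      using AE_lborel_singleton[of t]
    proof eventually_elim
      fix y assume y: "y \<noteq> t"
      have "eventually (\<lambda>b. indicator {t..b} y *\<^sub>R f' y = indicator {t<..} y * f' y) at_top"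
        using eventually_ge_at_top[of y] by eventually_elim (use y in \<open>auto simp: indicator_def\<close>)
      thus "((\<lambda>b. indicator {t..b} y *\<^sub>R f' y) \<longlongrightarrow> indicator {t<..} y * f' y) at_top" by (rule tendsto_eventually)
    qed
  qed (use integrable_f' in \<open>auto simp: indicator_def\<close>)
  define l where "l = f t + (LINT y|lborel. indicator {t<..} y * f' y)"
  have "((\<lambda>b. f t + (LINT y|lborel. indicator {t..b} y *\<^sub>R f' y)) \<longlongrightarrow> l) at_top"
    unfolding l_def by (intro tendsto_intros lim)
  moreover have "eventually (\<lambda>b. f t + (LINT y|lborel. indicator {t..b} y *\<^sub>R f' y) = f b) at_top"
    using eventually_ge_at_top[of t]
  proof eventually_elim
    fix b assume "t \<le> b"
    from f_diff[OF this] show "f t + (LINT y|lborel. indicator {t..b} y *\<^sub>R f' y) = f b"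
      by (simp add: set_lebesgue_integral_def)
  qed
  ultimately have fl: "(f \<longlongrightarrow> l) at_top" by (rule Lim_transform_eventually)
  have "l = 0"
  proof (rule ccontr)
    assume "l \<noteq> 0"
    moreover have "0 \<le> l" by (rule tendsto_lowerbound[OF fl]) (use f_nonneg in auto)
    ultimately have l: "0 < l" by simp
    have "eventually (\<lambda>x. l / 2 < f x) at_top" using order_tendstoD(1)[OF fl, of "l/2"] l by simp
    then obtain A where A: "\<And>x. A \<le> x \<Longrightarrow> l / 2 < f x" by (auto simp: eventually_at_top_linorder)
    define m where "m = 2 * (1 / (l / 2))"
    have m: "0 < m" using l by (simp add: m_def)
    have "(LINT x|lborel. indicator {A..A+m} x * (l / 2)) \<le> (LINT x|lborel. f x)"
    proof (rule integral_mono)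
      show "integrable lborel (\<lambda>x. indicator {A..A+m} x * (l / 2))" using m by simp
      show "indicator {A..A+m} x * (l / 2) \<le> f x" for x
        using A[of x] f_nonneg[of x] by (auto simp: indicator_def)
    qed (rule integrable_f)
    hence "m * (l / 2) \<le> 1" using m integral_f by simp
    thus False using l by (simp add: m_def)
  qed
  thus ?thesis by (simp add: l_def)
qed

lemma integrable_rho_sq: "integrable M (\<lambda>\<omega>. (\<rho> (S \<omega>))\<^sup>2)"
  and expectation_rho_sq: "ennreal (expectation (\<lambda>\<omega>. (\<rho> (S \<omega>))\<^sup>2)) = (\<integral>\<^sup>+ x. ennreal ((f' x)\<^sup>2 / f x) \<partial>lborel)"
proof -
  have "(\<integral>\<^sup>+\<omega>. ennreal ((\<rho> (S \<omega>))\<^sup>2) \<partial>M) = (\<integral>\<^sup>+x. ennreal (f x) * ennreal ((\<rho> x)\<^sup>2) \<partial>lborel)"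
    by (rule distributed_nn_integral[OF dist, symmetric]) simp
  also have "\<dots> = (\<integral>\<^sup>+x. ennreal ((f' x)\<^sup>2 / f x) \<partial>lborel)"
    by (intro nn_integral_cong) (auto simp: \<rho>_def ennreal_mult[symmetric] f_nonneg power2_eq_square)
  finally have *: "(\<integral>\<^sup>+\<omega>. ennreal ((\<rho> (S \<omega>))\<^sup>2) \<partial>M) = (\<integral>\<^sup>+ x. ennreal ((f' x)\<^sup>2 / f x) \<partial>lborel)" .
  show i: "integrable M (\<lambda>\<omega>. (\<rho> (S \<omega>))\<^sup>2)"
    by (rule integrableI_bounded) (use * fin in auto)
  show "ennreal (expectation (\<lambda>\<omega>. (\<rho> (S \<omega>))\<^sup>2)) = (\<integral>\<^sup>+ x. ennreal ((f' x)\<^sup>2 / f x) \<partial>lborel)"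
    using nn_integral_eq_integral[OF i] * by simp
qed

text \<open>Integration by parts for a linear function of \<open>S\<close>: after \<open>integral_ramp_mult\<close> the inner integral of \<open>f'\<close>
  over a half-line is a value of \<open>f\<close>, and an affine substitution restores the expectation.\<close>

lemma score_identity:
  assumes \<alpha>: "0 < \<alpha>" and ab: "a \<le> b"
  shows "expectation (\<lambda>\<omega>. \<alpha> * indicator {a<..b} (\<alpha> * S \<omega> + s)) = - expectation (\<lambda>\<omega>. ramp a b (\<alpha> * S \<omega> + s) * \<rho> (S \<omega>))"
proof -
  have "expectation (\<lambda>\<omega>. ramp a b (\<alpha> * S \<omega> + s) * \<rho> (S \<omega>)) = (LINT y|lborel. f y * (ramp a b (\<alpha> * y + s) * \<rho> y))"
    by (rule distributed_integral[OF dist, symmetric]) (use f_nonneg in auto)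
  also have "\<dots> = (LINT y|lborel. ramp a b (\<alpha> * y + s) * f' y)"
    by (rule integral_cong_AE) (use f'_zero in \<open>auto simp: \<rho>_def elim!: eventually_mono\<close>)
  also have "\<dots> = (LINT t:{a<..b}|lborel. (LINT y|lborel. indicator {t<..} (\<alpha> * y + s) * f' y))"
    by (rule integral_ramp_mult[OF sigma_finite_lborel ab integrable_f']) simp
  also have "\<dots> = (LINT t:{a<..b}|lborel. - f ((t - s) / \<alpha>))"
  proof -
    have "(LINT y|lborel. indicator {t<..} (\<alpha> * y + s) * f' y) = - f ((t - s) / \<alpha>)" for t
      unfolding f_tail[of "(t - s) / \<alpha>"]
      using \<alpha> by (simp, intro Bochner_Integration.integral_cong) (auto simp: indicator_def field_simps)
    thus ?thesis by simp
  qed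
  also have "\<dots> = - (LINT t|lborel. indicator {a<..b} t * f ((t - s) / \<alpha>))"
    by (simp add: set_lebesgue_integral_def)
  also have "(LINT t|lborel. indicator {a<..b} t * f ((t - s) / \<alpha>)) = \<bar>\<alpha>\<bar> *\<^sub>R (LINT y|lborel. indicator {a<..b} (s + \<alpha> * y) * f ((s + \<alpha> * y - s) / \<alpha>))"
    by (rule lborel_integral_real_affine) (use \<alpha> in auto)
  also have "\<dots> = (LINT y|lborel. f y * (\<alpha> * indicator {a<..b} (\<alpha> * y + s)))"
    using \<alpha> by (simp, subst integral_mult_right_zero[symmetric]) (auto intro!: Bochner_Integration.integral_cong simp: mult_ac add.commute)
  also have "\<dots> = expectation (\<lambda>\<omega>. \<alpha> * indicator {a<..b} (\<alpha> * S \<omega> + s))"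
    by (rule distributed_integral[OF dist]) (use f_nonneg in auto)
  finally show ?thesis by simp
qed

end

section \<open>The identity of a Stein kernel\<close>

text \<open>Every frontier point of an interval bounds it on one side, and a set has at most one bound on each
  side inside its closure.\<close>

lemma finite_frontier_interval:
  fixes I :: "real set"
  assumes "is_interval I"
  shows "finite (frontier I)"
proof -
  define U where "U = {x \<in> closure I. \<forall>y\<in>I. y \<le> x}"
  define L where "L = {x \<in> closure I. \<forall>y\<in>I. x \<le> y}"
  have U: "x \<le> u" if "x \<in> closure I" "\<forall>y\<in>I. y \<le> u" for x u
  proof -
    have "closure I \<subseteq> {..u}" by (rule closure_minimal) (use that in auto)
    thus ?thesis using that by auto
  qed
  have L: "u \<le> x" if "x \<in> closure I" "\<forall>y\<in>I. u \<le> y" for x u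
  proof -
    have "closure I \<subseteq> {u..}" by (rule closure_minimal) (use that in auto)
    thus ?thesis using that by auto
  qed
  have "finite U"
  proof (cases "U = {}")
    case False
    then obtain x where x: "x \<in> U" by blast
    have "U \<subseteq> {x}" using U x unfolding U_def by (auto intro: antisym)
    thus ?thesis by (rule finite_subset) simp
  qed simp
  moreover have "finite L"
  proof (cases "L = {}")
    case False
    then obtain x where x: "x \<in> L" by blast
    have "L \<subseteq> {x}" using L x unfolding L_def by (auto intro: antisym)
    thus ?thesis by (rule finite_subset) simp
  qed simp
  moreover have "frontier I \<subseteq> U \<union> L"
  proof
    fix x assume x: "x \<in> frontier I"
    show "x \<in> U \<union> L"
    proof (rule ccontr)
      assume "x \<notin> U \<union> L"
      then obtain y z where yz: "y \<in> I" "x < y" "z \<in> I" "z < x"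
        using x unfolding U_def L_def frontier_def by (auto simp: not_le)
      have "{z..y} \<subseteq> I"
      proof
        fix w assume "w \<in> {z..y}"
        thus "w \<in> I" using mem_is_interval_1_I[OF assms yz(3) yz(1), of w] by simp
      qed
      hence "x \<in> interior I" by (intro interiorI[of "{z<..<y}"]) (use yz in auto)
      thus False using x by (simp add: frontier_def)
    qed
  qed
  ultimately show ?thesis by (meson finite_UnI finite_subset)
qed

lemma continuous_tail_integral:
  fixes g :: "real \<Rightarrow> real"
  assumes g: "integrable lborel g"
  shows "isCont (\<lambda>t. LINT y:{t..}|lborel. g y) x"
proof -
  have [measurable]: "g \<in> borel_measurable borel" using g by simp
  have "(\<lambda>n. LINT y|lborel. indicator {X n..} y *\<^sub>R g y) \<longlonglongrightarrow> (LINT y|lborel. indicator {x..} y *\<^sub>R g y)"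
    if X: "X \<longlonglongrightarrow> x" for X
  proof (rule integral_dominated_convergence[where w="\<lambda>y. \<bar>g y\<bar>"])
    show "AE y in lborel. (\<lambda>i. indicator {X i..} y *\<^sub>R g y) \<longlonglongrightarrow> indicator {x..} y *\<^sub>R g y"
      using AE_lborel_singleton[of x]
    proof eventually_elim
      fix y assume "y \<noteq> x"
      then consider "y < x" | "x < y" by linarith
      hence "eventually (\<lambda>i. indicator {X i..} y *\<^sub>R g y = indicator {x..} y *\<^sub>R g y) sequentially"
      proof cases
        case 1
        have "eventually (\<lambda>i. y < X i) sequentially" using order_tendstoD(1)[OF X 1] .
        thus ?thesis by eventually_elim (use 1 in auto)
      next
        case 2
        have "eventually (\<lambda>i. X i < y) sequentially" using order_tendstoD(2)[OF X 2] .
        thus ?thesis by eventually_elim (use 2 in auto)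
      qed
      thus "(\<lambda>i. indicator {X i..} y *\<^sub>R g y) \<longlonglongrightarrow> indicator {x..} y *\<^sub>R g y" by (rule tendsto_eventually)
    qed
  qed (use g in \<open>auto simp: indicator_def\<close>)
  thus ?thesis unfolding continuous_at_sequentially set_lebesgue_integral_def by (auto simp: o_def)
qed

text \<open>A centred density as in the hypotheses on each \<open>X_k\<close>. The support is an interval on whose interior \<open>J\<close>
  the kernel is \<open>\<tau> = q / p\<close>, where the tail integral \<open>q\<close> satisfies \<open>q' = - x p(x)\<close>.\<close>

locale stein_density =
  fixes p :: "real \<Rightarrow> real"
  assumes diff_density: "diff_density_on_interval p"
    and p_measurable [measurable]: "p \<in> borel_measurable borel"
    and integrable_p: "integrable lborel p"
    and integrable_xp: "integrable lborel (\<lambda>x. x * p x)"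
    and mean_zero: "(LINT x|lborel. x * p x) = 0"
begin

definition J :: "real set" where "J = interior {x. 0 < p x}"

definition q :: "real \<Rightarrow> real" where "q x = (LINT y:{x..}|lborel. y * p y)"

abbreviation \<tau> :: "real \<Rightarrow> real" where "\<tau> \<equiv> stein_kernel p"

text \<open>The derivative of the kernel, set to \<open>0\<close> off \<open>J\<close>, where \<^const>\<open>deriv\<close> may be an arbitrary value at
  the end points. This makes \<open>\<tau>'\<close> measurable without changing it almost surely.\<close>

definition \<tau>' :: "real \<Rightarrow> real" where "\<tau>' x = indicator J x * deriv \<tau> x"

lemma p_nonneg: "0 \<le> p x"
  using diff_density by (simp add: diff_density_on_interval_def)

lemma p_pos: "x \<in> J \<Longrightarrow> 0 < p x"
  unfolding J_def using interior_subset by blast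

lemma open_J: "open J" by (simp add: J_def)

lemma J_measurable [measurable]: "J \<in> sets borel"
  using open_J by simp

lemma is_interval_support: "is_interval {x. 0 < p x}"
  using diff_density by (simp add: diff_density_on_interval_def is_interval_connected_1)

lemma is_interval_J: "is_interval J"
  using is_interval_support unfolding J_def is_interval_convex_1 by (rule convex_interior)

lemma finite_frontier_J: "finite (frontier J)"
  by (rule finite_frontier_interval[OF is_interval_J])

lemma AE_J: "AE x in lborel. x \<notin> J \<longrightarrow> p x = 0"
proof -
  have "finite {x. 0 < p x \<and> x \<notin> J}"
    by (rule finite_subset[OF _ finite_frontier_interval[OF is_interval_support]])
       (use closure_subset[of "{x. 0 < p x}"] in \<open>auto simp: frontier_def J_def\<close>)
  hence "AE x in lborel. x \<notin> {x. 0 < p x \<and> x \<notin> J}"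
    by (intro AE_not_in) (auto intro: finite_imp_null_set_lborel)
  thus ?thesis by eventually_elim (use p_nonneg in \<open>auto simp: less_le\<close>)
qed

lemma outside_J:
  assumes "x \<notin> J"
  shows "(\<forall>y\<in>J. y < x) \<or> (\<forall>y\<in>J. x < y)"
proof (rule ccontr)
  assume "\<not> ?thesis"
  then obtain y z where "y \<in> J" "x \<le> y" "z \<in> J" "z \<le> x" by (auto simp: not_less)
  thus False using mem_is_interval_1_I[OF is_interval_J, of z y x] assms by auto
qed

lemma set_int_xp: "A \<in> sets borel \<Longrightarrow> set_integrable lborel A (\<lambda>y. y * p y)"
  using integrable_xp unfolding set_integrable_def by (intro integrable_mult_indicator) auto

text \<open>The mean is zero, so the tail integral can be taken over either side. Hence \<open>q \<ge> 0\<close>, and \<open>q\<close> vanishes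
  beyond both ends of the support.\<close>

lemma q_alt: "q x = - (LINT y:{..<x}|lborel. y * p y)"
proof -
  have "(LINT y:({..<x} \<union> {x..})|lborel. y * p y) = (LINT y:{..<x}|lborel. y * p y) + q x"
    unfolding q_def by (rule set_integral_Un) (auto intro: set_int_xp)
  moreover have "({..<x} \<union> {x..}) = (UNIV :: real set)" by auto
  ultimately show ?thesis using mean_zero by (simp add: set_lebesgue_integral_def)
qed

lemma q_nonneg: "0 \<le> q x"
proof (cases "0 \<le> x")
  case True
  thus ?thesis unfolding q_def set_lebesgue_integral_def
    by (intro Bochner_Integration.integral_nonneg) (auto simp: indicator_def p_nonneg)
next
  case False
  have "0 \<le> (LINT y|lborel. indicator {..<x} y * (- (y * p y)))"
    by (intro Bochner_Integration.integral_nonneg)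
       (use False in \<open>auto simp: indicator_def p_nonneg mult_nonpos_nonneg\<close>)
  thus ?thesis unfolding q_alt set_lebesgue_integral_def by simp
qed

lemma q_outside_J: assumes "x \<notin> J" shows "q x = 0"
  using outside_J[OF assms]
proof
  assume *: "\<forall>y\<in>J. y < x"
  have "AE y in lborel. indicator {x..} y *\<^sub>R (y * p y) = 0"
    using AE_J by eventually_elim (use * in \<open>auto simp: indicator_def\<close>)
  thus ?thesis unfolding q_def set_lebesgue_integral_def by (rule integral_eq_zero_AE)
next
  assume *: "\<forall>y\<in>J. x < y"
  have "AE y in lborel. indicator {..<x} y *\<^sub>R (y * p y) = 0"
    using AE_J by eventually_elim (use * in \<open>auto simp: indicator_def\<close>)
  thus ?thesis unfolding q_alt set_lebesgue_integral_def by (subst integral_eq_zero_AE) auto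
qed

lemma isCont_q: "isCont q x"
  using continuous_tail_integral[OF integrable_xp] unfolding q_def .

lemma q_measurable [measurable]: "q \<in> borel_measurable borel"
  by (intro borel_measurable_continuous_onI continuous_at_imp_continuous_on ballI isCont_q)

lemma tau_eq: "\<tau> x = q x / p x"
  by (simp add: stein_kernel_def q_def)

lemma tau_measurable [measurable]: "\<tau> \<in> borel_measurable borel"
  unfolding tau_eq by measurable

lemma tau_nonneg: "0 \<le> \<tau> x"
  by (simp add: tau_eq q_nonneg p_nonneg)

lemma q_lim: "(\<lambda>n. q (real n)) \<longlonglongrightarrow> 0" "(\<lambda>n. q (- real n)) \<longlonglongrightarrow> 0"
proof -
  have "(\<lambda>n. LINT y|lborel. indicator {real n..} y *\<^sub>R (y * p y)) \<longlonglongrightarrow> (LINT y|(lborel::real measure). (0::real))"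
  proof (rule integral_dominated_convergence[where w="\<lambda>y. \<bar>y * p y\<bar>"])
    show "AE y in lborel. (\<lambda>n. indicator {real n..} y *\<^sub>R (y * p y)) \<longlonglongrightarrow> 0"
    proof (rule AE_I2)
      fix y :: real
      show "(\<lambda>n. indicator {real n..} y *\<^sub>R (y * p y)) \<longlonglongrightarrow> 0"
        by (rule LIMSEQ_eq_beyond[where r="y"]) auto
    qed
  qed (use integrable_xp in \<open>auto simp: indicator_def\<close>)
  thus "(\<lambda>n. q (real n)) \<longlonglongrightarrow> 0" by (simp add: q_def set_lebesgue_integral_def)
  have "(\<lambda>n. LINT y|lborel. indicator {..<- real n} y *\<^sub>R (y * p y)) \<longlonglongrightarrow> (LINT y|(lborel::real measure). (0::real))"
  proof (rule integral_dominated_convergence[where w="\<lambda>y. \<bar>y * p y\<bar>"])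
    show "AE y in lborel. (\<lambda>n. indicator {..<- real n} y *\<^sub>R (y * p y)) \<longlonglongrightarrow> 0"
    proof (rule AE_I2)
      fix y :: real
      show "(\<lambda>n. indicator {..<- real n} y *\<^sub>R (y * p y)) \<longlonglongrightarrow> 0"
        by (rule LIMSEQ_eq_beyond[where r="- y"]) auto
    qed
  qed (use integrable_xp in \<open>auto simp: indicator_def\<close>)
  from tendsto_minus[OF this] show "(\<lambda>n. q (- real n)) \<longlonglongrightarrow> 0"
    by (simp add: q_alt set_lebesgue_integral_def)
qed

lemma p_differentiable: "x \<in> J \<Longrightarrow> p differentiable (at x)"
  using diff_density by (auto simp: diff_density_on_interval_def J_def)

lemma isCont_p: "x \<in> J \<Longrightarrow> isCont p x"
  using p_differentiable differentiable_imp_continuous_within by blast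

lemma q_deriv:
  assumes x: "x \<in> J"
  shows "(q has_real_derivative - (x * p x)) (at x)"
proof -
  obtain e where e: "e > 0" "cball x e \<subseteq> J" using open_J x open_contains_cball by blast
  define a where "a = x - e"
  define b where "b = x + e"
  have ab: "{a..b} \<subseteq> J" "a < x" "x < b"
    using e by (auto simp: a_def b_def cball_eq_atLeastAtMost)
  have cont: "continuous_on {a..b} (\<lambda>y. y * p y)"
    using ab isCont_p by (auto intro!: continuous_intros continuous_at_imp_continuous_on)
  have "((\<lambda>s. integral {a..s} (\<lambda>y. y * p y)) has_real_derivative x * p x) (at x within {a..b})"
    by (rule integral_has_real_derivative[OF cont]) (use ab in auto)
  hence "((\<lambda>s. integral {a..s} (\<lambda>y. y * p y)) has_real_derivative x * p x) (at x)"
    using ab by (simp add: at_within_Icc_at)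
  hence d: "((\<lambda>s. q a - integral {a..s} (\<lambda>y. y * p y)) has_real_derivative - (x * p x)) (at x)"
    by (auto intro!: derivative_eq_intros)
  have "q a - integral {a..s} (\<lambda>y. y * p y) = q s" if "s \<in> {a<..<b}" for s
  proof -
    have "q a = (LINT y:({a..<s} \<union> {s..})|lborel. y * p y)"
      unfolding q_def using that by (intro arg_cong[where f="\<lambda>A. (LINT y:A|lborel. y * p y)"]) auto
    also have "\<dots> = (LINT y:{a..<s}|lborel. y * p y) + q s"
      unfolding q_def by (rule set_integral_Un) (auto intro: set_int_xp)
    also have "(LINT y:{a..<s}|lborel. y * p y) = (LINT y:{a..s}|lborel. y * p y)"
      unfolding set_lebesgue_integral_def
      by (intro integral_cong_AE) (use AE_lborel_singleton[of s] in \<open>auto simp: indicator_def elim!: eventually_mono\<close>)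
    also have "\<dots> = integral {a..s} (\<lambda>y. y * p y)"
      by (rule set_borel_integral_eq_integral(2)[OF set_int_xp]) simp
    finally show ?thesis by simp
  qed
  thus ?thesis
    by (intro has_field_derivative_transform_within_open[OF d, of "{a<..<b}"]) (use ab in auto)
qed

lemma tau_deriv:
  assumes x: "x \<in> J"
  shows "(\<tau> has_real_derivative \<tau>' x) (at x)"
proof -
  obtain p' where p': "(p has_real_derivative p') (at x)"
    using p_differentiable[OF x] by (auto simp: real_differentiable_def)
  have "((\<lambda>x. q x / p x) has_real_derivative (- (x * p x) * p x - q x * p') / (p x * p x)) (at x)"
    using p_pos[OF x] by (intro DERIV_divide q_deriv p' x) auto
  hence "\<tau> field_differentiable (at x)"
    unfolding field_differentiable_def tau_eq[abs_def] by blast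
  thus ?thesis using x by (simp add: \<tau>'_def DERIV_deriv_iff_field_differentiable)
qed

lemma tau'_measurable [measurable]: "\<tau>' \<in> borel_measurable borel"
proof (rule borel_measurable_LIMSEQ_real)
  fix x
  show "(\<lambda>n. indicator J x * ((\<tau> (x + 1 / real (Suc n)) - \<tau> x) / (1 / real (Suc n)))) \<longlonglongrightarrow> \<tau>' x"
  proof (cases "x \<in> J")
    case True
    have "((\<lambda>h. (\<tau> (x + h) - \<tau> x) / h) \<longlongrightarrow> \<tau>' x) (at 0)"
      using tau_deriv[OF True] by (simp add: DERIV_def)
    moreover have "filterlim (\<lambda>n. 1 / real (Suc n)) (at 0) sequentially"
      unfolding filterlim_at using LIMSEQ_inverse_real_of_nat by (auto simp: inverse_eq_divide)
    ultimately show ?thesis using True by (auto dest: filterlim_compose)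
  qed (simp add: \<tau>'_def)
qed measurable

text \<open>On \<open>J\<close> the product rule gives \<open>(q u)' = q u' - x p u\<close>, and \<open>q u\<close> vanishes at both ends. Extended by zero it
  is continuous on the line, because \<open>u\<close> is bounded and \<open>q\<close> vanishes off \<open>J\<close>, and it is differentiable
  except at finitely many points. The derivative \<open>u'\<close> need not be continuous, since the density is
  only differentiable; the fundamental theorem for the gauge integral covers this case.\<close>

lemma stein_identity_J:
  assumes ub: "\<And>x. x \<in> J \<Longrightarrow> \<bar>u x\<bar> \<le> K"
    and uc: "\<And>x. x \<in> J \<Longrightarrow> isCont u x"
    and D: "finite D"
    and ud: "\<And>x. x \<in> J \<Longrightarrow> x \<notin> D \<Longrightarrow> (u has_real_derivative u' x) (at x)"
    and int: "integrable lborel (\<lambda>x. indicator J x * (q x * u' x))"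
  shows "integrable lborel (\<lambda>x. indicator J x * (x * p x * u x))"
    and "(LINT x|lborel. indicator J x * (q x * u' x)) = (LINT x|lborel. indicator J x * (x * p x * u x))"
proof -
  have um: "(\<lambda>x. indicator J x *\<^sub>R u x) \<in> borel_measurable borel"
    by (rule borel_measurable_continuous_on_indicator)
       (auto intro!: continuous_at_imp_continuous_on uc)
  have ub': "\<bar>indicator J x * u x\<bar> \<le> \<bar>K\<bar>" for x using ub[of x] by (auto simp: indicator_def)
  show int2: "integrable lborel (\<lambda>x. indicator J x * (x * p x * u x))"
  proof -
    have "integrable lborel (\<lambda>x. (indicator J x *\<^sub>R u x) * (x * p x))"
      by (rule integrable_bounded_mult[where c="\<bar>K\<bar>", OF _ _ integrable_xp]) (use um ub' in auto)
    thus ?thesis by (simp add: mult_ac)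
  qed
  define g where "g = (\<lambda>x. indicator J x * (q x * u x))"
  define w where "w = (\<lambda>x. indicator J x * (q x * u' x) - indicator J x * (x * p x * u x))"
  have wint: "integrable lborel w" unfolding w_def using int int2 by simp
  have gb: "\<bar>g x\<bar> \<le> \<bar>K\<bar> * q x" for x
  proof -
    have "\<bar>g x\<bar> = \<bar>indicator J x * u x\<bar> * q x" by (simp add: g_def abs_mult q_nonneg)
    thus ?thesis using ub'[of x] q_nonneg[of x] by (auto intro: mult_right_mono)
  qed
  have gc: "isCont g x" for x
  proof (cases "x \<in> J")
    case True
    have "isCont (\<lambda>x. q x * u x) x" by (intro isCont_mult isCont_q uc True)
    moreover have "eventually (\<lambda>y. g y = q y * u y) (nhds x)"
      using open_J True unfolding eventually_nhds g_def by (intro exI[of _ J]) auto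
    ultimately show ?thesis by (simp add: isCont_cong)
  next
    case False
    have "((\<lambda>y. \<bar>K\<bar> * q y) \<longlongrightarrow> \<bar>K\<bar> * q x) (at x)" using isCont_q[of x] by (intro tendsto_intros) (simp add: isCont_def)
    hence "((\<lambda>y. \<bar>K\<bar> * q y) \<longlongrightarrow> 0) (at x)" by (simp add: q_outside_J[OF False])
    hence "(g \<longlongrightarrow> 0) (at x)" by (rule Lim_null_comparison[rotated]) (use gb in auto)
    thus ?thesis using False by (simp add: isCont_def g_def)
  qed
  have gd: "(g has_real_derivative w x) (at x)" if x: "x \<notin> D \<union> frontier J" for x
  proof (cases "x \<in> J")
    case True
    have "((\<lambda>x. q x * u x) has_real_derivative - (x * p x) * u x + u' x * q x) (at x)"
      by (rule DERIV_mult[OF q_deriv[OF True] ud]) (use x True in auto)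
    hence "((\<lambda>x. q x * u x) has_real_derivative w x) (at x)" using True by (simp add: w_def mult.commute)
    thus ?thesis
      by (rule has_field_derivative_transform_within_open[OF _ open_J True]) (auto simp: g_def)
  next
    case False
    have *: "open (- closure J)" "x \<in> - closure J" using x False open_J by (auto simp: frontier_def interior_open)
    have "((\<lambda>_. 0) has_real_derivative w x) (at x)" using False by (simp add: w_def)
    thus ?thesis
      by (rule has_field_derivative_transform_within_open[OF _ *]) (use closure_subset in \<open>auto simp: g_def indicator_def\<close>)
  qed
  have ftc: "(LINT x:{- real n..real n}|lborel. w x) = g (real n) - g (- real n)" for n
  proof -
    have si: "set_integrable lborel {- real n..real n} w"
      using wint unfolding set_integrable_def by (intro integrable_mult_indicator) auto
    have "(w has_integral (g (real n) - g (- real n))) {- real n..real n}"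
      by (rule fundamental_theorem_of_calculus_interior_strong[where S="D \<union> frontier J"])
         (use D finite_frontier_J gd gc in \<open>auto simp: has_real_derivative_iff_has_vector_derivative[symmetric] intro!: continuous_at_imp_continuous_on\<close>)
    thus ?thesis using set_borel_integral_eq_integral(2)[OF si] by (simp add: integral_unique)
  qed
  have "(\<lambda>n. LINT x|lborel. indicator {- real n..real n} x *\<^sub>R w x) \<longlonglongrightarrow> (LINT x|lborel. w x)"
  proof (rule integral_dominated_convergence[where w="\<lambda>y. \<bar>w y\<bar>"])
    show "AE x in lborel. (\<lambda>n. indicator {- real n..real n} x *\<^sub>R w x) \<longlonglongrightarrow> w x"
    proof (rule AE_I2)
      fix x :: real
      show "(\<lambda>n. indicator {- real n..real n} x *\<^sub>R w x) \<longlonglongrightarrow> w x"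
        by (rule LIMSEQ_eq_beyond[where r="\<bar>x\<bar>"]) (auto simp: abs_le_iff indicator_def)
    qed
  qed (use wint in \<open>auto simp: indicator_def\<close>)
  hence lim1: "(\<lambda>n. g (real n) - g (- real n)) \<longlonglongrightarrow> (LINT x|lborel. w x)"
    by (simp only: ftc[symmetric] set_lebesgue_integral_def)
  have "(\<lambda>n. \<bar>K\<bar> * q (real n)) \<longlonglongrightarrow> 0" "(\<lambda>n. \<bar>K\<bar> * q (- real n)) \<longlonglongrightarrow> 0"
    using tendsto_mult_right_zero[OF q_lim(1)] tendsto_mult_right_zero[OF q_lim(2)] by blast+
  hence "(\<lambda>n. g (real n)) \<longlonglongrightarrow> 0" "(\<lambda>n. g (- real n)) \<longlonglongrightarrow> 0"
    by (auto intro: Lim_null_comparison[where g="\<lambda>n. \<bar>K\<bar> * q (real n)"]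
          Lim_null_comparison[where g="\<lambda>n. \<bar>K\<bar> * q (- real n)"] simp: gb)
  hence "(\<lambda>n. g (real n) - g (- real n)) \<longlonglongrightarrow> 0" using tendsto_diff by fastforce
  from LIMSEQ_unique[OF lim1 this] have "(LINT x|lborel. w x) = 0" .
  thus "(LINT x|lborel. indicator J x * (q x * u' x)) = (LINT x|lborel. indicator J x * (x * p x * u x))"
    unfolding w_def using int int2 by simp
qed

lemma stein_identity:
  assumes ub: "\<And>x. x \<in> J \<Longrightarrow> \<bar>u x\<bar> \<le> K"
    and um[measurable]: "u \<in> borel_measurable borel"
    and u'm[measurable]: "u' \<in> borel_measurable borel"
    and uc: "\<And>x. x \<in> J \<Longrightarrow> isCont u x"
    and D: "finite D"
    and ud: "\<And>x. x \<in> J \<Longrightarrow> x \<notin> D \<Longrightarrow> (u has_real_derivative u' x) (at x)"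
    and int: "integrable lborel (\<lambda>x. p x * (\<tau> x * u' x))"
  shows "(LINT x|lborel. p x * (\<tau> x * u' x)) = (LINT x|lborel. p x * (x * u x))"
proof -
  have ae1: "AE x in lborel. p x * (\<tau> x * u' x) = indicator J x * (q x * u' x)"
    using AE_J
  proof eventually_elim
    fix x assume "x \<notin> J \<longrightarrow> p x = 0"
    thus "p x * (\<tau> x * u' x) = indicator J x * (q x * u' x)"
      using p_pos[of x] by (cases "x \<in> J") (auto simp: tau_eq)
  qed
  have ae2: "AE x in lborel. p x * (x * u x) = indicator J x * (x * p x * u x)"
    using AE_J by eventually_elim (auto simp: indicator_def)
  have "integrable lborel (\<lambda>x. indicator J x * (q x * u' x))"
    using int ae1 by (subst (asm) integrable_cong_AE) auto
  note * = stein_identity_J[OF ub uc D ud this]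
  show ?thesis using *(2) ae1 ae2
    by (subst integral_cong_AE[OF _ _ ae1], simp, simp, subst integral_cong_AE[OF _ _ ae2]) auto
qed

text \<open>The Stein identity for \<open>u(x) = x\<close> says that the kernel has mean \<open>Var X\<close>. That function is unbounded,
  so it is clipped to \<open>{- N n..N n}\<close> first.\<close>

lemma expectation_stein_kernel:
  assumes x2: "integrable lborel (\<lambda>x. x\<^sup>2 * p x)" and int: "integrable lborel (\<lambda>x. p x * \<tau> x)"
  shows "(LINT x|lborel. p x * \<tau> x) = (LINT x|lborel. x\<^sup>2 * p x)"
proof -
  \<comment> \<open>The levels start at \<open>1\<close>, as \<open>ramp_deriv\<close> asks for an interval of positive length.\<close>
  define N where "N n = real (Suc n)" for n
  define c where "c n x = ramp (- N n) (N n) x - N n" for n x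
  have c_eq: "c n x = max (- N n) (min x (N n))" for n x by (simp add: c_def ramp_def)
  have eq: "(LINT x|lborel. p x * (\<tau> x * indicator {- N n<..N n} x)) = (LINT x|lborel. p x * (x * c n x))" for n
  proof (rule stein_identity[where K="N n" and D="{- N n, N n}"])
    show "(c n has_real_derivative indicator {- N n<..N n} x) (at x)" if "x \<notin> {- N n, N n}" for x
      unfolding c_def using ramp_deriv[of "- N n" "N n" x] that
      by (auto intro!: derivative_eq_intros simp: N_def)
    show "isCont (c n) x" for x unfolding c_def by (intro continuous_intros ramp_continuous)
    show "c n \<in> borel_measurable borel" unfolding c_def by measurable
    show "integrable lborel (\<lambda>x. p x * (\<tau> x * indicator {- N n<..N n} x))"
      by (rule Bochner_Integration.integrable_bound[OF int]) (auto simp: indicator_def)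
  qed (auto simp: c_eq N_def)
  have l1: "(\<lambda>n. LINT x|lborel. p x * (\<tau> x * indicator {- N n<..N n} x)) \<longlonglongrightarrow> (LINT x|lborel. p x * \<tau> x)"
  proof (rule integral_dominated_convergence[where w="\<lambda>x. p x * \<tau> x"])
    show "AE x in lborel. (\<lambda>n. p x * (\<tau> x * indicator {- N n<..N n} x)) \<longlonglongrightarrow> p x * \<tau> x"
    proof (rule AE_I2)
      fix x :: real
      show "(\<lambda>n. p x * (\<tau> x * indicator {- N n<..N n} x)) \<longlonglongrightarrow> p x * \<tau> x"
        by (rule LIMSEQ_eq_beyond[where r="\<bar>x\<bar>"]) (auto simp: abs_less_iff indicator_def N_def)
    qed
  qed (use int in \<open>auto simp: indicator_def p_nonneg tau_nonneg\<close>)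
  have l2: "(\<lambda>n. LINT x|lborel. p x * (x * c n x)) \<longlonglongrightarrow> (LINT x|lborel. x\<^sup>2 * p x)"
  proof (rule integral_dominated_convergence[where w="\<lambda>x. x\<^sup>2 * p x"])
    show "AE x in lborel. (\<lambda>n. p x * (x * c n x)) \<longlonglongrightarrow> x\<^sup>2 * p x"
    proof (rule AE_I2)
      fix x :: real
      show "(\<lambda>n. p x * (x * c n x)) \<longlonglongrightarrow> x\<^sup>2 * p x"
        by (rule LIMSEQ_eq_beyond[where r="\<bar>x\<bar>"]) (auto simp: c_eq N_def power2_eq_square)
    qed
    show "AE x in lborel. norm (p x * (x * c n x)) \<le> x\<^sup>2 * p x" for n
    proof (rule AE_I2)
      fix x
      have "\<bar>c n x\<bar> \<le> \<bar>x\<bar>" by (auto simp: c_eq N_def)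
      hence "\<bar>x\<bar> * \<bar>c n x\<bar> \<le> \<bar>x\<bar> * \<bar>x\<bar>" by (intro mult_left_mono) auto
      hence "p x * (\<bar>x\<bar> * \<bar>c n x\<bar>) \<le> p x * (\<bar>x\<bar> * \<bar>x\<bar>)" by (rule mult_left_mono) (rule p_nonneg)
      thus "norm (p x * (x * c n x)) \<le> x\<^sup>2 * p x" by (simp add: abs_mult p_nonneg power2_eq_square mult.commute)
    qed
  qed (use x2 in \<open>auto simp: c_def\<close>)
  show ?thesis using LIMSEQ_unique[OF l1] l2 by (simp add: eq)
qed

end

text \<open>The Stein identity for \<open>u(x) = ramp a b (\<gamma> x + s) / (c + \<tau>(x))\<close>, where \<open>s\<close> and \<open>c\<close> stand for the
  contributions of the other coordinates. Since \<open>\<tau> \<ge> 0\<close> and \<open>c \<ge> 1\<close>, both \<open>u\<close> and the factors \<open>\<tau> / (c + \<tau>)\<close>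
  and \<open>\<tau> / (c + \<tau>)\<^sup>2\<close> are bounded.\<close>

lemma (in stein_density) stein_identity_normalized:
  assumes int: "integrable lborel (\<lambda>x. p x * \<tau>' x)"
    and c: "1 \<le> c" and \<gamma>: "0 < \<gamma>" and ab: "a < b"
  shows "(LINT x|lborel. p x * (\<tau> x * (\<gamma> * indicator {a<..b} (\<gamma> * x + s) / (c + \<tau> x)
             - ramp a b (\<gamma> * x + s) * \<tau>' x / (c + \<tau> x)\<^sup>2)))
       = (LINT x|lborel. p x * (x * (ramp a b (\<gamma> * x + s) / (c + \<tau> x))))" (is "?L = ?R")
proof (rule stein_identity[where K="b - a" and D="{(a - s) / \<gamma>, (b - s) / \<gamma>}"])
  have cp: "1 \<le> c + \<tau> x" for x using c tau_nonneg[of x] by simp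
  have rb: "0 \<le> ramp a b y" "ramp a b y \<le> b - a" for y using ramp_bounds[of a b] ab by auto
  show "\<bar>ramp a b (\<gamma> * x + s) / (c + \<tau> x)\<bar> \<le> b - a" for x
  proof -
    have "ramp a b (\<gamma> * x + s) / (c + \<tau> x) \<le> ramp a b (\<gamma> * x + s) / 1"
      by (rule divide_left_mono) (use cp[of x] rb in auto)
    thus ?thesis using rb[of "\<gamma> * x + s"] cp[of x] by simp
  qed
  show "isCont (\<lambda>x. ramp a b (\<gamma> * x + s) / (c + \<tau> x)) x" if "x \<in> J" for x
  proof -
    have "isCont \<tau> x" using tau_deriv[OF that] by (rule DERIV_isCont)
    moreover have "isCont (\<lambda>x. ramp a b (\<gamma> * x + s)) x"
      by (rule isCont_o2[OF _ ramp_continuous]) (intro continuous_intros)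
    ultimately show ?thesis using cp[of x] by (intro continuous_intros) auto
  qed
  show "((\<lambda>x. ramp a b (\<gamma> * x + s) / (c + \<tau> x)) has_real_derivative
       (\<gamma> * indicator {a<..b} (\<gamma> * x + s) / (c + \<tau> x) - ramp a b (\<gamma> * x + s) * \<tau>' x / (c + \<tau> x)\<^sup>2)) (at x)"
    if "x \<in> J" "x \<notin> {(a - s) / \<gamma>, (b - s) / \<gamma>}" for x
  proof -
    have "\<gamma> * x + s \<noteq> a" "\<gamma> * x + s \<noteq> b" using that(2) \<gamma> by (auto simp: field_simps)
    from ramp_deriv[OF ab this] have "((\<lambda>x. ramp a b (\<gamma> * x + s)) has_real_derivative indicator {a<..b} (\<gamma> * x + s) * \<gamma>) (at x)"
      by (rule DERIV_chain2) (auto intro!: derivative_eq_intros)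
    moreover have "((\<lambda>x. c + \<tau> x) has_real_derivative \<tau>' x) (at x)"
      using tau_deriv[OF that(1)] by (auto intro!: derivative_eq_intros)
    moreover have "c + \<tau> x \<noteq> 0" using cp[of x] by simp
    ultimately have "((\<lambda>x. ramp a b (\<gamma> * x + s) / (c + \<tau> x)) has_real_derivative
        (indicator {a<..b} (\<gamma> * x + s) * \<gamma> * (c + \<tau> x) - ramp a b (\<gamma> * x + s) * \<tau>' x) / ((c + \<tau> x) * (c + \<tau> x))) (at x)"
      by (rule DERIV_divide)
    moreover have "(i * \<gamma> * g - r * d) / (g * g) = \<gamma> * i / g - r * d / g\<^sup>2" if "1 \<le> g" for i g r d :: real
      using that by (simp add: field_simps power2_eq_square)
    ultimately show ?thesis using cp[of x] by simp
  qed
  show "integrable lborel (\<lambda>x. p x * (\<tau> x * (\<gamma> * indicator {a<..b} (\<gamma> * x + s) / (c + \<tau> x)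
             - ramp a b (\<gamma> * x + s) * \<tau>' x / (c + \<tau> x)\<^sup>2)))"
  proof (rule Bochner_Integration.integrable_bound)
    show "integrable lborel (\<lambda>x. \<gamma> * p x + (b - a) * \<bar>p x * \<tau>' x\<bar>)"
      using int integrable_p by simp
    show "AE x in lborel. norm (p x * (\<tau> x * (\<gamma> * indicator {a<..b} (\<gamma> * x + s) / (c + \<tau> x)
             - ramp a b (\<gamma> * x + s) * \<tau>' x / (c + \<tau> x)\<^sup>2))) \<le> norm (\<gamma> * p x + (b - a) * \<bar>p x * \<tau>' x\<bar>)"
    proof (rule AE_I2)
      fix x
      define y where "y = \<gamma> * x + s"
      define t where "t = \<tau> x / (c + \<tau> x)"
      have t: "0 \<le> t" "t \<le> 1" using cp[of x] tau_nonneg[of x] c by (auto simp: t_def field_simps)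
      have t2: "t / (c + \<tau> x) \<le> 1" "0 \<le> t / (c + \<tau> x)" using t cp[of x] by (auto simp: field_simps)
      define A where "A = \<tau> x * (\<gamma> * indicator {a<..b} y / (c + \<tau> x) - ramp a b y * \<tau>' x / (c + \<tau> x)\<^sup>2)"
      have "A = t * (\<gamma> * indicator {a<..b} y) - (t / (c + \<tau> x)) * (ramp a b y * \<tau>' x)"
        by (simp add: A_def t_def field_simps power2_eq_square)
      also have "\<bar>\<dots>\<bar> \<le> \<bar>t * (\<gamma> * indicator {a<..b} y)\<bar> + \<bar>(t / (c + \<tau> x)) * (ramp a b y * \<tau>' x)\<bar>" by (rule abs_triangle_ineq4)
      also have "\<dots> = t * (\<gamma> * indicator {a<..b} y) + (t / (c + \<tau> x)) * (ramp a b y * \<bar>\<tau>' x\<bar>)"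
        using t t2 \<gamma> rb[of y] cp[of x] by (simp add: abs_mult)
      also have "\<dots> \<le> 1 * (\<gamma> * 1) + 1 * ((b - a) * \<bar>\<tau>' x\<bar>)"
        using t t2 \<gamma> rb[of y] by (intro add_mono mult_mono) (auto simp: indicator_def)
      finally have "p x * \<bar>A\<bar> \<le> p x * (\<gamma> + (b - a) * \<bar>\<tau>' x\<bar>)"
        using p_nonneg[of x] by (intro mult_left_mono) auto
      also have "\<dots> = \<gamma> * p x + (b - a) * \<bar>p x * \<tau>' x\<bar>"
        using p_nonneg[of x] by (simp add: abs_mult distrib_left mult_ac)
      finally have "norm (p x * A) \<le> norm (\<gamma> * p x + (b - a) * \<bar>p x * \<tau>' x\<bar>)"
        using p_nonneg[of x] by (simp add: abs_mult)
      thus "norm (p x * (\<tau> x * (\<gamma> * indicator {a<..b} (\<gamma> * x + s) / (c + \<tau> x)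
             - ramp a b (\<gamma> * x + s) * \<tau>' x / (c + \<tau> x)\<^sup>2))) \<le> norm (\<gamma> * p x + (b - a) * \<bar>p x * \<tau>' x\<bar>)"
        by (simp only: A_def y_def)
    qed
  qed measurable
qed measurable

section \<open>Moments and lower tails of independent sums\<close>

lemma square_le_fourth: "x\<^sup>2 \<le> (1 + x ^ 4) / 2" for x :: real
  using zero_le_power2[of "x\<^sup>2 - 1"] by (simp add: power2_eq_square power4_eq_xxxx algebra_simps)

lemma fourth_power_add: "(x + y) ^ 4 \<le> 8 * (x ^ 4 + y ^ 4)" for x y :: real
proof -
  have sq: "(u + v)\<^sup>2 \<le> 2 * (u\<^sup>2 + v\<^sup>2)" for u v :: real
    using zero_le_power2[of "u - v"] by (simp add: power2_eq_square algebra_simps)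
  have "(x + y) ^ 4 = ((x + y)\<^sup>2)\<^sup>2" by simp
  also have "\<dots> \<le> (2 * (x\<^sup>2 + y\<^sup>2))\<^sup>2" by (rule power_mono[OF sq]) simp
  also have "\<dots> = 4 * (x\<^sup>2 + y\<^sup>2)\<^sup>2" by (simp only: power_mult_distrib) simp
  also have "\<dots> \<le> 4 * (2 * ((x\<^sup>2)\<^sup>2 + (y\<^sup>2)\<^sup>2))" by (rule mult_left_mono[OF sq]) simp
  finally show ?thesis by simp
qed

lemma square_sum4: "(a - b - c + d)\<^sup>2 \<le> 4 * (a\<^sup>2 + b\<^sup>2 + c\<^sup>2 + d\<^sup>2)" for a b c d :: real
proof -
  have "0 \<le> (a + b)\<^sup>2 + (a + c)\<^sup>2 + (a - d)\<^sup>2 + (b - c)\<^sup>2 + (b + d)\<^sup>2 + (c + d)\<^sup>2" by simp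
  thus ?thesis by (simp add: power2_eq_square algebra_simps)
qed

lemma bound_by_majorant:
  fixes Y W :: "'a \<Rightarrow> real"
  assumes "Y \<in> borel_measurable M" "integrable M W" "\<And>\<omega>. \<omega> \<in> space M \<Longrightarrow> 0 \<le> Y \<omega>" "\<And>\<omega>. \<omega> \<in> space M \<Longrightarrow> Y \<omega> \<le> W \<omega>"
  shows "integrable M Y" "integral\<^sup>L M Y \<le> integral\<^sup>L M W"
proof -
  show i: "integrable M Y"
    by (rule Bochner_Integration.integrable_bound[OF assms(2,1)]) (use assms(3,4) in force)
  show "integral\<^sup>L M Y \<le> integral\<^sup>L M W" by (rule integral_mono[OF i assms(2)]) (use assms(4) in auto)
qed

lemma (in prob_space) integrable_from_power4:
  assumes "g \<in> borel_measurable M" "integrable M (\<lambda>\<omega>. (g \<omega>) ^ 4)" "i \<le> 4"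
  shows "integrable M (\<lambda>\<omega>. (g \<omega>) ^ i :: real)"
proof (rule Bochner_Integration.integrable_bound)
  show "integrable M (\<lambda>\<omega>. 1 + (g \<omega>) ^ 4)" using assms(2) by simp
  show "AE \<omega> in M. norm ((g \<omega>) ^ i) \<le> norm (1 + (g \<omega>) ^ 4)"
  proof (rule AE_I2)
    fix \<omega>
    have e: "\<bar>g \<omega>\<bar> ^ 4 = (g \<omega>) ^ 4" by (simp add: power_even_abs)
    have "\<bar>g \<omega>\<bar> ^ i \<le> 1 + \<bar>g \<omega>\<bar> ^ 4"
    proof (cases "\<bar>g \<omega>\<bar> \<le> 1")
      case True
      thus ?thesis using power_le_one[of "\<bar>g \<omega>\<bar>" i] by (smt (verit) abs_ge_zero zero_le_power)
    next
      case False
      thus ?thesis using power_increasing[OF assms(3), of "\<bar>g \<omega>\<bar>"] by simp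
    qed
    thus "norm ((g \<omega>) ^ i) \<le> norm (1 + (g \<omega>) ^ 4)" by (simp add: power_abs e)
  qed
qed (use assms in measurable)

lemma (in prob_space) second_moment_le:
  assumes "integrable M (\<lambda>\<omega>. Y \<omega> ^ 2)" "integrable M (\<lambda>\<omega>. Y \<omega> ^ 4)" "expectation (\<lambda>\<omega>. Y \<omega> ^ 4) \<le> b" "1 \<le> b"
  shows "expectation (\<lambda>\<omega>. (Y \<omega>)\<^sup>2 :: real) \<le> b"
proof -
  have "expectation (\<lambda>\<omega>. (Y \<omega>)\<^sup>2) \<le> expectation (\<lambda>\<omega>. (1 + Y \<omega> ^ 4) / 2)"
    by (rule integral_mono) (use assms square_le_fourth in auto)
  also have "\<dots> = (1 + expectation (\<lambda>\<omega>. Y \<omega> ^ 4)) / 2" using assms(2) by (simp add: prob_space)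
  finally show ?thesis using assms(3,4) by simp
qed

lemma (in prob_space) indep_power_product:
  fixes A Y :: "'a \<Rightarrow> real"
  assumes "indep_var borel A borel Y" "integrable M (\<lambda>\<omega>. A \<omega> ^ i)" "integrable M (\<lambda>\<omega>. Y \<omega> ^ j)"
  shows "integrable M (\<lambda>\<omega>. A \<omega> ^ i * Y \<omega> ^ j)"
    and "expectation (\<lambda>\<omega>. A \<omega> ^ i * Y \<omega> ^ j) = expectation (\<lambda>\<omega>. A \<omega> ^ i) * expectation (\<lambda>\<omega>. Y \<omega> ^ j)"
proof -
  have "indep_var borel ((\<lambda>x. x ^ i) \<circ> A) borel ((\<lambda>x. x ^ j) \<circ> Y)"
    by (rule indep_var_compose[OF assms(1)]) auto
  hence *: "indep_var borel (\<lambda>\<omega>. A \<omega> ^ i) borel (\<lambda>\<omega>. Y \<omega> ^ j)" by (simp add: comp_def)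
  show "integrable M (\<lambda>\<omega>. A \<omega> ^ i * Y \<omega> ^ j)" by (rule indep_var_integrable[OF * assms(2,3)])
  show "expectation (\<lambda>\<omega>. A \<omega> ^ i * Y \<omega> ^ j) = expectation (\<lambda>\<omega>. A \<omega> ^ i) * expectation (\<lambda>\<omega>. Y \<omega> ^ j)"
    by (rule indep_var_lebesgue_integral[OF * assms(2,3)])
qed

lemma (in prob_space) sum_second_moment:
  fixes Y :: "'i \<Rightarrow> 'a \<Rightarrow> real"
  assumes "finite I" "indep_vars (\<lambda>_. borel) Y I"
    and "\<And>i. i \<in> I \<Longrightarrow> integrable M (\<lambda>\<omega>. Y i \<omega>)" "\<And>i. i \<in> I \<Longrightarrow> expectation (Y i) = 0"
    and "\<And>i. i \<in> I \<Longrightarrow> integrable M (\<lambda>\<omega>. (Y i \<omega>)\<^sup>2)"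
    and "\<And>i. i \<in> I \<Longrightarrow> expectation (\<lambda>\<omega>. (Y i \<omega>)\<^sup>2) \<le> b"
  shows "integrable M (\<lambda>\<omega>. (\<Sum>i\<in>I. Y i \<omega>)\<^sup>2) \<and> expectation (\<lambda>\<omega>. (\<Sum>i\<in>I. Y i \<omega>)\<^sup>2) \<le> real (card I) * b"
  using assms
proof (induction I rule: finite_induct)
  case (insert k I)
  let ?A = "\<lambda>\<omega>. \<Sum>i\<in>I. Y i \<omega>"
  have ind: "indep_var borel (Y k) borel ?A" by (rule indep_vars_sum) (use insert in auto)
  have IH: "integrable M (\<lambda>\<omega>. (?A \<omega>)\<^sup>2)" "expectation (\<lambda>\<omega>. (?A \<omega>)\<^sup>2) \<le> real (card I) * b"
    using insert.IH insert.prems indep_vars_subset[of "\<lambda>_. borel" Y "insert k I" I] by auto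
  have A1: "integrable M ?A" using insert.prems by auto
  have Y: "integrable M (Y k)" "expectation (Y k) = 0" "integrable M (\<lambda>\<omega>. (Y k \<omega>)\<^sup>2)" "expectation (\<lambda>\<omega>. (Y k \<omega>)\<^sup>2) \<le> b"
    using insert.prems by auto
  have c: "integrable M (\<lambda>\<omega>. Y k \<omega> * ?A \<omega>)" "expectation (\<lambda>\<omega>. Y k \<omega> * ?A \<omega>) = 0"
    using indep_power_product[OF ind, of 1 1] A1 Y by auto
  have eq: "(\<Sum>i\<in>insert k I. Y i \<omega>)\<^sup>2 = (?A \<omega>)\<^sup>2 + 2 * (Y k \<omega> * ?A \<omega>) + (Y k \<omega>)\<^sup>2" for \<omega>
    using insert.hyps by (simp add: power2_eq_square algebra_simps)
  show ?case unfolding eq using IH Y c insert.hyps by (simp add: algebra_simps)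
qed simp

text \<open>Adding an independent centred \<open>Y\<close> to \<open>A\<close> raises the fourth moment by \<open>6 E[A\<^sup>2] E[Y\<^sup>2] + E[Y^4]\<close>, as the
  other mixed terms contain the factor \<open>E[A]\<close> or \<open>E[Y]\<close>. With \<open>E[A\<^sup>2] \<le> |I| b\<close> this sums to order \<open>|I|\<^sup>2\<close>.\<close>

lemma (in prob_space) sum_fourth_moment:
  fixes Y :: "'i \<Rightarrow> 'a \<Rightarrow> real"
  assumes "finite I" "indep_vars (\<lambda>_. borel) Y I" and b: "1 \<le> b"
    and "\<And>i. i \<in> I \<Longrightarrow> integrable M (\<lambda>\<omega>. (Y i \<omega>) ^ 4)" "\<And>i. i \<in> I \<Longrightarrow> expectation (Y i) = 0"
    and "\<And>i. i \<in> I \<Longrightarrow> expectation (\<lambda>\<omega>. (Y i \<omega>)\<^sup>2) \<le> b"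
    and "\<And>i. i \<in> I \<Longrightarrow> expectation (\<lambda>\<omega>. (Y i \<omega>) ^ 4) \<le> b"
  shows "integrable M (\<lambda>\<omega>. (\<Sum>i\<in>I. Y i \<omega>) ^ 4) \<and> expectation (\<lambda>\<omega>. (\<Sum>i\<in>I. Y i \<omega>) ^ 4) \<le> 3 * (real (card I) * b)\<^sup>2"
  using assms(1,2,4-)
proof (induction I rule: finite_induct)
  case (insert k I)
  let ?A = "\<lambda>\<omega>. \<Sum>i\<in>I. Y i \<omega>"
  have rv: "Y i \<in> borel_measurable M" if "i \<in> insert k I" for i
    using insert.prems(1) that by (auto simp: indep_vars_def)
  have Yi: "integrable M (\<lambda>\<omega>. Y i \<omega> ^ j)" if "i \<in> insert k I" "j \<le> 4" for i j
    using integrable_from_power4[OF rv[OF that(1)] insert.prems(2)[OF that(1)] that(2)] .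
  have indI: "indep_vars (\<lambda>_. borel) Y I" by (rule indep_vars_subset[OF insert.prems(1)]) auto
  have ind: "indep_var borel (Y k) borel ?A" by (rule indep_vars_sum) (use insert in auto)
  have IH: "integrable M (\<lambda>\<omega>. (?A \<omega>) ^ 4)" "expectation (\<lambda>\<omega>. (?A \<omega>) ^ 4) \<le> 3 * (real (card I) * b)\<^sup>2"
    using insert.IH[OF indI] insert.prems by auto
  have Am: "?A \<in> borel_measurable M" using rv by (intro borel_measurable_sum) auto
  have Ai: "integrable M (\<lambda>\<omega>. ?A \<omega> ^ j)" if "j \<le> 4" for j
    using integrable_from_power4[OF Am IH(1) that] .
  have A0: "expectation ?A = 0"
    using Yi[of _ 1] insert.prems(3) by (subst Bochner_Integration.integral_sum) auto
  have A2: "expectation (\<lambda>\<omega>. (?A \<omega>)\<^sup>2) \<le> real (card I) * b"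
    using sum_second_moment[OF insert.hyps(1) indI, of b] Yi[of _ 1] Yi[of _ 2] insert.prems by auto
  have Y0: "expectation (Y k) = 0" and Y2: "expectation (\<lambda>\<omega>. (Y k \<omega>)\<^sup>2) \<le> b" and Y4: "expectation (\<lambda>\<omega>. (Y k \<omega>) ^ 4) \<le> b"
    using insert.prems by auto
  have c: "integrable M (\<lambda>\<omega>. Y k \<omega> ^ i * ?A \<omega> ^ j)"
    "expectation (\<lambda>\<omega>. Y k \<omega> ^ i * ?A \<omega> ^ j) = expectation (\<lambda>\<omega>. Y k \<omega> ^ i) * expectation (\<lambda>\<omega>. ?A \<omega> ^ j)" if "i \<le> 4" "j \<le> 4" for i j
    using indep_power_product[OF ind, of i j] Ai[OF that(2)] Yi[OF _ that(1), of k] by auto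
  have eq: "(\<Sum>i\<in>insert k I. Y i \<omega>) ^ 4 = ?A \<omega> ^ 4 + 4 * (Y k \<omega> ^ 1 * ?A \<omega> ^ 3) + 6 * (Y k \<omega> ^ 2 * ?A \<omega> ^ 2)
      + 4 * (Y k \<omega> ^ 3 * ?A \<omega> ^ 1) + Y k \<omega> ^ 4" for \<omega>
  proof -
    have "(\<Sum>i\<in>insert k I. Y i \<omega>) = Y k \<omega> + ?A \<omega>" using insert.hyps by simp
    moreover have "(y + x) ^ 4 = x ^ 4 + 4 * (y ^ 1 * x ^ 3) + 6 * (y ^ 2 * x ^ 2) + 4 * (y ^ 3 * x ^ 1) + y ^ 4" for x y :: real
      by (simp add: eval_nat_numeral algebra_simps)
    ultimately show ?thesis by simp
  qed
  have int: "integrable M (\<lambda>\<omega>. (\<Sum>i\<in>insert k I. Y i \<omega>) ^ 4)"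
    unfolding eq by (intro Bochner_Integration.integrable_add integrable_mult_right c Ai Yi) auto
  have "expectation (\<lambda>\<omega>. (\<Sum>i\<in>insert k I. Y i \<omega>) ^ 4)
      = expectation (\<lambda>\<omega>. ?A \<omega> ^ 4) + 6 * (expectation (\<lambda>\<omega>. Y k \<omega> ^ 2) * expectation (\<lambda>\<omega>. ?A \<omega> ^ 2)) + expectation (\<lambda>\<omega>. Y k \<omega> ^ 4)"
    unfolding eq using c[of 1 3] c[of 2 2] c[of 3 1] Ai[of 4] Yi[of k 4] A0 Y0 by simp
  also have "\<dots> \<le> 3 * (real (card I) * b)\<^sup>2 + 6 * (b * (real (card I) * b)) + b"
    by (intro add_mono mult_left_mono mult_mono IH Y2 A2 Y4) (use b in auto)
  also have "\<dots> \<le> 3 * (real (card (insert k I)) * b)\<^sup>2"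
  proof -
    have "b * 1 \<le> b * b" by (rule mult_left_mono) (use b in auto)
    hence "b \<le> 3 * (b * b)" using b by simp
    moreover have "3 * (real (card (insert k I)) * b)\<^sup>2
        = 3 * (real (card I) * b)\<^sup>2 + 6 * (b * (real (card I) * b)) + 3 * (b * b)"
      using insert.hyps by (simp add: power2_eq_square algebra_simps)
    ultimately show ?thesis by linarith
  qed
  finally show ?case using int by simp
qed simp

text \<open>\<open>1 - x + x\<^sup>2/2\<close> times the lower Taylor bound \<open>1 + x + x\<^sup>2/2\<close> of \<open>exp x\<close> is \<open>1 + x^4/4\<close>.\<close>

lemma exp_neg_upper:
  fixes x :: real
  assumes "0 \<le> x"
  shows "exp (- x) \<le> 1 - x + x\<^sup>2 / 2"
proof -
  have pos: "0 < 1 - x + x\<^sup>2 / 2"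
    using zero_le_power2[of "x - 1"] by (simp add: power2_eq_square algebra_simps)
  have "1 \<le> (1 - x + x\<^sup>2 / 2) * (1 + x + x\<^sup>2 / 2)"
  proof -
    have "(1 - x + x\<^sup>2 / 2) * (1 + x + x\<^sup>2 / 2) = 1 + (x\<^sup>2)\<^sup>2 / 4"
      by (simp add: power2_eq_square field_simps)
    thus ?thesis by simp
  qed
  also have "\<dots> \<le> (1 - x + x\<^sup>2 / 2) * exp x"
    by (rule mult_left_mono[OF exp_lower_Taylor_quadratic[OF assms]]) (use pos in simp)
  finally show ?thesis by (simp add: exp_minus field_simps)
qed

text \<open>Chernoff bound. Nonnegativity gives \<open>E[exp(- l Y)] \<le> 1 - l + l\<^sup>2 b / 2\<close> from the second moment alone, and
  \<open>l = 1 / (2 b)\<close> leaves a fixed positive rate in the exponent.\<close>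

lemma (in prob_space) lower_tail_nonneg_sum:
  fixes Y :: "'i \<Rightarrow> 'a \<Rightarrow> real"
  assumes I: "finite I" "indep_vars (\<lambda>_. borel) Y I" and b: "1 \<le> b"
    and Y0: "\<And>i \<omega>. i \<in> I \<Longrightarrow> 0 \<le> Y i \<omega>"
    and Yi: "\<And>i. i \<in> I \<Longrightarrow> integrable M (Y i)" "\<And>i. i \<in> I \<Longrightarrow> expectation (Y i) = 1"
    and Y2: "\<And>i. i \<in> I \<Longrightarrow> integrable M (\<lambda>\<omega>. (Y i \<omega>)\<^sup>2)" "\<And>i. i \<in> I \<Longrightarrow> expectation (\<lambda>\<omega>. (Y i \<omega>)\<^sup>2) \<le> b"
  shows "prob {\<omega>\<in>space M. (\<Sum>i\<in>I. Y i \<omega>) < real (card I) / 2} \<le> exp (- real (card I) / (8 * b))"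
proof -
  define l where "l = 1 / (2 * b)"
  have l: "0 < l" using b by (simp add: l_def)
  let ?m = "real (card I)"
  let ?T = "\<lambda>\<omega>. \<Sum>i\<in>I. Y i \<omega>"
  have rv[measurable]: "Y i \<in> borel_measurable M" if "i \<in> I" for i
    using I(2) that by (auto simp: indep_vars_def)
  have Tm[measurable]: "?T \<in> borel_measurable M" by (intro borel_measurable_sum rv)
  have ei: "integrable M (\<lambda>\<omega>. exp (- (l * Y i \<omega>)))" if "i \<in> I" for i
    by (rule integrable_const_bound[where B=1]) (use that l Y0[OF that] in \<open>auto\<close>)
  have eb: "expectation (\<lambda>\<omega>. exp (- (l * Y i \<omega>))) \<le> exp (- l + l\<^sup>2 * b / 2)" if i: "i \<in> I" for i
  proof -
    have "expectation (\<lambda>\<omega>. exp (- (l * Y i \<omega>))) \<le> expectation (\<lambda>\<omega>. 1 - l * Y i \<omega> + l\<^sup>2 * (Y i \<omega>)\<^sup>2 / 2)"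
    proof (rule integral_mono)
      show "exp (- (l * Y i \<omega>)) \<le> 1 - l * Y i \<omega> + l\<^sup>2 * (Y i \<omega>)\<^sup>2 / 2" for \<omega>
        using exp_neg_upper[of "l * Y i \<omega>"] l Y0[OF i, of \<omega>] by (simp add: power_mult_distrib)
    qed (use ei[OF i] Yi(1)[OF i] Y2(1)[OF i] in auto)
    also have "\<dots> = 1 - l + l\<^sup>2 * expectation (\<lambda>\<omega>. (Y i \<omega>)\<^sup>2) / 2"
      using Yi[OF i] Y2(1)[OF i] by (simp add: prob_space)
    also have "\<dots> \<le> 1 + (- l + l\<^sup>2 * b / 2)"
      using mult_left_mono[OF Y2(2)[OF i], of "l\<^sup>2"] by simp
    also have "\<dots> \<le> exp (- l + l\<^sup>2 * b / 2)" by (rule exp_ge_add_one_self)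
    finally show ?thesis .
  qed
  have "indep_vars (\<lambda>_. borel) (\<lambda>i \<omega>. exp (- (l * Y i \<omega>))) I"
    by (rule indep_vars_compose2[OF I(2)]) measurable
  note P = indep_vars_lebesgue_integral[OF I(1) this ei] indep_vars_integrable[OF I(1) this ei]
  have pe: "(\<Prod>i\<in>I. exp (- (l * Y i \<omega>))) = exp (- (l * ?T \<omega>))" for \<omega>
    using exp_sum[OF I(1), of "\<lambda>i. - (l * Y i \<omega>)"] by (simp add: sum_negf sum_distrib_left)
  have "prob {\<omega>\<in>space M. ?T \<omega> < ?m / 2} = expectation (indicator {\<omega>\<in>space M. ?T \<omega> < ?m / 2})"
    by simp
  also have "\<dots> \<le> expectation (\<lambda>\<omega>. exp (l * (?m / 2)) * exp (- (l * ?T \<omega>)))"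
  proof (rule integral_mono)
    show "integrable M (\<lambda>\<omega>. exp (l * (?m / 2)) * exp (- (l * ?T \<omega>)))" using P(2) unfolding pe by simp
    show "indicator {\<omega>\<in>space M. ?T \<omega> < ?m / 2} \<omega> \<le> exp (l * (?m / 2)) * exp (- (l * ?T \<omega>))" for \<omega>
    proof (cases "?T \<omega> < ?m / 2")
      case True
      have "1 \<le> exp (l * (?m / 2) + - (l * ?T \<omega>))" using True l by simp
      thus ?thesis unfolding exp_add by (auto simp: indicator_def)
    qed (auto simp: indicator_def)
    have "{\<omega>\<in>space M. ?T \<omega> < ?m / 2} \<in> events" by (rule borel_measurable_less[OF Tm]) simp
    thus "integrable M (indicator {\<omega>\<in>space M. ?T \<omega> < ?m / 2} :: 'a \<Rightarrow> real)"
      by (intro integrable_real_indicator) (auto simp: emeasure_eq_measure)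
  qed
  also have "\<dots> = exp (l * (?m / 2)) * (\<Prod>i\<in>I. expectation (\<lambda>\<omega>. exp (- (l * Y i \<omega>))))"
    using P(1) unfolding pe by simp
  also have "\<dots> \<le> exp (l * (?m / 2)) * (\<Prod>i\<in>I. exp (- l + l\<^sup>2 * b / 2))"
    by (intro mult_left_mono prod_mono conjI eb) auto
  also have "\<dots> = exp (l * (?m / 2)) * exp (?m * (- l + l\<^sup>2 * b / 2))"
    by (simp add: exp_of_nat_mult)
  also have "\<dots> = exp (l * (?m / 2) + ?m * (- l + l\<^sup>2 * b / 2))" by (simp add: exp_add)
  also have "l * (?m / 2) + ?m * (- l + l\<^sup>2 * b / 2) = - ?m / (8 * b)"
    using b by (simp add: l_def power2_eq_square field_simps)
  finally show ?thesis .
qed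

lemma power8_le_exp:
  fixes c :: real
  assumes "0 < c"
  shows "real n ^ 8 \<le> (8 * c) ^ 8 * exp (real n / c)"
proof -
  have "real n / (8 * c) \<le> exp (real n / (8 * c))"
    using exp_ge_add_one_self[of "real n / (8 * c)"] by linarith
  hence "(real n / (8 * c)) ^ 8 \<le> exp (real n / (8 * c)) ^ 8"
    using assms by (intro power_mono) auto
  also have "exp (real n / (8 * c)) ^ 8 = exp (real n / c)"
    by (simp flip: exp_of_nat_mult)
  finally show ?thesis using assms by (simp add: power_divide field_simps)
qed

text \<open>Identities proved in one coordinate with the others frozen carry over to independent coordinates by
  Fubini. Both variables take values in one type, as independence of a pair is stated that way;
  below they are restrictions of the sequence to disjoint index sets.\<close>

lemma (in prob_space) expectation_eq_by_conditioning:
  fixes k1 k2 :: "'z \<Rightarrow> 'z \<Rightarrow> real"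
  assumes ind: "indep_var N Z L X"
    and m[measurable]: "case_prod k1 \<in> borel_measurable (N \<Otimes>\<^sub>M L)" "case_prod k2 \<in> borel_measurable (N \<Otimes>\<^sub>M L)"
    and i: "integrable M (\<lambda>\<omega>. k1 (Z \<omega>) (X \<omega>))" "integrable M (\<lambda>\<omega>. k2 (Z \<omega>) (X \<omega>))"
    and eq: "\<And>z. z \<in> space N \<Longrightarrow> expectation (\<lambda>\<omega>. k1 z (X \<omega>)) = expectation (\<lambda>\<omega>. k2 z (X \<omega>))"
  shows "expectation (\<lambda>\<omega>. k1 (Z \<omega>) (X \<omega>)) = expectation (\<lambda>\<omega>. k2 (Z \<omega>) (X \<omega>))"
proof -
  have [measurable]: "random_variable N Z" "random_variable L X"
    using ind by (auto dest: indep_var_rv1 indep_var_rv2)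
  have D: "distr M (N \<Otimes>\<^sub>M L) (\<lambda>\<omega>. (Z \<omega>, X \<omega>)) = distr M N Z \<Otimes>\<^sub>M distr M L X"
    using ind indep_var_distribution_eq[of N Z L X] by simp
  interpret Z: prob_space "distr M N Z" by (rule prob_space_distr) simp
  interpret X: prob_space "distr M L X" by (rule prob_space_distr) simp
  interpret P: pair_sigma_finite "distr M N Z" "distr M L X" ..
  have *: "expectation (\<lambda>\<omega>. k (Z \<omega>) (X \<omega>)) = (LINT z|distr M N Z. expectation (\<lambda>\<omega>. k z (X \<omega>)))"
    if [measurable]: "case_prod k \<in> borel_measurable (N \<Otimes>\<^sub>M L)" and int: "integrable M (\<lambda>\<omega>. k (Z \<omega>) (X \<omega>))"
    for k :: "'z \<Rightarrow> 'z \<Rightarrow> real"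
  proof -
    have "expectation (\<lambda>\<omega>. k (Z \<omega>) (X \<omega>)) = (LINT zx|distr M (N \<Otimes>\<^sub>M L) (\<lambda>\<omega>. (Z \<omega>, X \<omega>)). case_prod k zx)"
      by (subst integral_distr) auto
    also have "\<dots> = (LINT z|distr M N Z. (LINT x|distr M L X. k z x))"
    proof -
      have "integrable (distr M (N \<Otimes>\<^sub>M L) (\<lambda>\<omega>. (Z \<omega>, X \<omega>))) (case_prod k)"
        by (subst integrable_distr_eq) (use int in auto)
      thus ?thesis unfolding D by (rule P.integral_fst[symmetric])
    qed
    also have "\<dots> = (LINT z|distr M N Z. expectation (\<lambda>\<omega>. k z (X \<omega>)))"
      by (intro Bochner_Integration.integral_cong refl, subst integral_distr) (auto simp: measurable_Pair2')
    finally show ?thesis .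
  qed
  show ?thesis unfolding *[OF m(1) i(1)] *[OF m(2) i(2)]
    by (rule Bochner_Integration.integral_cong) (simp_all only: eq space_distr)
qed

section \<open>A score weight for the normalised sum\<close>

lemma stein_density_of_setting:
  assumes "stein_setting M X p" "1 \<le> k"
  shows "stein_density (p k)"
proof
  have s: "integrable M (X k)" "integral\<^sup>L M (X k) = 0" "diff_density_on_interval (p k)"
    and dist: "distributed M lborel (X k) (\<lambda>x. ennreal (p k x))" and "prob_space M"
    using assms by (auto simp: stein_setting_def)
  interpret prob_space M by fact
  have nn: "0 \<le> p k x" for x using s(3) by (simp add: diff_density_on_interval_def)
  show "diff_density_on_interval (p k)" by (rule s)
  show pm: "p k \<in> borel_measurable borel"
    using distributed_real_measurable[OF _ dist] nn by simp
  show "integrable lborel (p k)" using distributed_integrable[OF dist, of "\<lambda>_. 1"] nn by simp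
  show "integrable lborel (\<lambda>x. x * p k x)"
    using distributed_integrable[OF dist, of "\<lambda>x. x"] nn s(1) by (simp add: mult.commute)
  show "(LINT x|lborel. x * p k x) = 0"
    using distributed_integral[OF dist, of "\<lambda>x. x"] nn s(2) by (simp add: mult.commute)
qed

text \<open>Here \<open>f\<close> is a density of \<open>S_{n0}\<close> with derivative \<open>f'\<close>, and \<open>B\<close> bounds the fourth moments of \<open>X_k\<close>, of its
  Stein kernel and of the derivative of the kernel for all \<open>k > n0\<close>.\<close>

locale stein_sum = finite_fisher M "norm_sum X n\<^sub>0" f f'
  for M :: "'a measure" and X :: "nat \<Rightarrow> 'a \<Rightarrow> real" and n\<^sub>0 f f' +
  fixes p :: "nat \<Rightarrow> real \<Rightarrow> real" and B :: real and n :: nat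
  assumes setting: "stein_setting M X p"
    and n0: "1 \<le> n\<^sub>0" and n0_le: "n\<^sub>0 \<le> n"
    and X4: "n\<^sub>0 < k \<Longrightarrow> integrable M (\<lambda>\<omega>. (X k \<omega>) ^ 4) \<and> expectation (\<lambda>\<omega>. (X k \<omega>) ^ 4) \<le> B"
    and tau4: "n\<^sub>0 < k \<Longrightarrow> integrable M (\<lambda>\<omega>. (stein_kernel (p k) (X k \<omega>)) ^ 4) \<and>
                expectation (\<lambda>\<omega>. (stein_kernel (p k) (X k \<omega>)) ^ 4) \<le> B"
    and delta4: "n\<^sub>0 < k \<Longrightarrow> integrable M (\<lambda>\<omega>. (stein_density.\<tau>' (p k) (X k \<omega>)) ^ 4) \<and>
                expectation (\<lambda>\<omega>. (stein_density.\<tau>' (p k) (X k \<omega>)) ^ 4) \<le> B"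
begin

abbreviation S :: "'a \<Rightarrow> real" where "S \<equiv> norm_sum X n\<^sub>0"
abbreviation F :: "'a \<Rightarrow> real" where "F \<equiv> norm_sum X n"
abbreviation \<tau> :: "nat \<Rightarrow> real \<Rightarrow> real" where "\<tau> k \<equiv> stein_kernel (p k)"
abbreviation \<delta> :: "nat \<Rightarrow> real \<Rightarrow> real" where "\<delta> k \<equiv> stein_density.\<tau>' (p k)"
abbreviation K :: "nat set" where "K \<equiv> {n\<^sub>0 + 1..n}"

definition \<sigma> :: real where "\<sigma> = sqrt (real n\<^sub>0)"
definition \<gamma> :: real where "\<gamma> = 1 / sqrt (real n)"
definition T :: "'a \<Rightarrow> real" where "T \<omega> = (\<Sum>k\<in>K. \<tau> k (X k \<omega>))"
definition V :: "'a \<Rightarrow> real" where "V \<omega> = (\<Sum>k\<in>K. X k \<omega>)"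
definition Q :: "'a \<Rightarrow> real" where "Q \<omega> = (\<Sum>k\<in>K. \<tau> k (X k \<omega>) * \<delta> k (X k \<omega>))"

text \<open>The negative of \<open>G\<close> has the score of \<open>F\<close> as conditional expectation given \<open>F\<close>.\<close>

definition G :: "'a \<Rightarrow> real" where
  "G \<omega> = sqrt (real n) * ((V \<omega> - \<rho> (S \<omega>)) / (\<sigma> + T \<omega>) + Q \<omega> / (\<sigma> + T \<omega>)\<^sup>2)"

lemma indep: "indep_vars (\<lambda>_. borel) X {1..}"
  using setting by (simp add: stein_setting_def)

lemma X_facts:
  assumes "1 \<le> k"
  shows "integrable M (X k)" "expectation (X k) = 0" "integrable M (\<lambda>\<omega>. (X k \<omega>)\<^sup>2)"
    "expectation (\<lambda>\<omega>. (X k \<omega>)\<^sup>2) = 1"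
    "distributed M lborel (X k) (\<lambda>x. ennreal (p k x))" "diff_density_on_interval (p k)" "0 \<le> p k x"
proof -
  show *: "integrable M (X k)" "expectation (X k) = 0" "integrable M (\<lambda>\<omega>. (X k \<omega>)\<^sup>2)"
    "distributed M lborel (X k) (\<lambda>x. ennreal (p k x))" "diff_density_on_interval (p k)"
    and "0 \<le> p k x"
    using setting assms by (auto simp: stein_setting_def diff_density_on_interval_def)
  have "variance (X k) = 1" using setting assms by (auto simp: stein_setting_def)
  thus "expectation (\<lambda>\<omega>. (X k \<omega>)\<^sup>2) = 1" using *(2) by simp
qed

lemma X_measurable [measurable]: "1 \<le> k \<Longrightarrow> X k \<in> borel_measurable M"
  using X_facts(1) by blast

lemma expectation_X:
  assumes "1 \<le> k" and g: "g \<in> borel_measurable borel"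
  shows "integrable lborel (\<lambda>x. p k x * g x) \<longleftrightarrow> integrable M (\<lambda>\<omega>. g (X k \<omega>))"
    and "(LINT x|lborel. p k x * g x) = expectation (\<lambda>\<omega>. g (X k \<omega>))"
  using distributed_integrable[OF X_facts(5)[OF assms(1)], of g] distributed_integral[OF X_facts(5)[OF assms(1)], of g]
    X_facts(7)[OF assms(1)] g by auto

lemma stein_density: "1 \<le> k \<Longrightarrow> stein_density (p k)"
  by (rule stein_density_of_setting[OF setting])

lemma tau_meas [measurable]: "1 \<le> k \<Longrightarrow> \<tau> k \<in> borel_measurable borel"
  and delta_meas [measurable]: "1 \<le> k \<Longrightarrow> \<delta> k \<in> borel_measurable borel"
  and tau_nonneg: "1 \<le> k \<Longrightarrow> 0 \<le> \<tau> k x"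
  using stein_density.tau_measurable stein_density.tau'_measurable stein_density.tau_nonneg stein_density by auto

lemma K_ge: "k \<in> K \<Longrightarrow> 1 \<le> k" "k \<in> K \<Longrightarrow> n\<^sub>0 < k" "k \<in> K \<Longrightarrow> k \<in> {1..n}" by auto

lemma integrable_tau: "k \<in> K \<Longrightarrow> integrable M (\<lambda>\<omega>. \<tau> k (X k \<omega>))"
  and integrable_delta: "k \<in> K \<Longrightarrow> integrable M (\<lambda>\<omega>. \<delta> k (X k \<omega>))"
  using integrable_from_power4[of "\<lambda>\<omega>. \<tau> k (X k \<omega>)" 1] integrable_from_power4[of "\<lambda>\<omega>. \<delta> k (X k \<omega>)" 1]
    tau4[of k] delta4[of k] by (auto simp: K_ge)

lemma T_measurable [measurable]: "T \<in> borel_measurable M"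
  and V_measurable [measurable]: "V \<in> borel_measurable M"
  and Q_measurable [measurable]: "Q \<in> borel_measurable M"
  unfolding T_def[abs_def] V_def[abs_def] Q_def[abs_def] by (auto simp: K_ge)

lemma F_measurable [measurable]: "F \<in> borel_measurable M"
  unfolding norm_sum_def[abs_def] by auto

lemma G_measurable [measurable]: "G \<in> borel_measurable M"
  unfolding G_def[abs_def] by measurable

lemma T_nonneg: "0 \<le> T \<omega>"
  unfolding T_def by (intro sum_nonneg tau_nonneg) auto

lemma sigma_ge: "1 \<le> \<sigma>" using n0 by (simp add: \<sigma>_def)
lemma gamma_pos: "0 < \<gamma>" using n0 n0_le by (simp add: \<gamma>_def)
lemma sqrt_n_gamma: "sqrt (real n) * \<gamma> = 1" using n0 n0_le by (simp add: \<gamma>_def)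

lemma F_eq: "F \<omega> = \<gamma> * (\<sigma> * S \<omega> + V \<omega>)"
proof -
  have "{1..n} = {1..n\<^sub>0} \<union> K" "{1..n\<^sub>0} \<inter> K = {}" using n0_le by auto
  hence "(\<Sum>k=1..n. X k \<omega>) = (\<Sum>k=1..n\<^sub>0. X k \<omega>) + V \<omega>" by (simp add: V_def sum.union_disjoint)
  moreover have "(\<Sum>k=1..n\<^sub>0. X k \<omega>) = \<sigma> * S \<omega>" using n0 by (simp add: norm_sum_def \<sigma>_def)
  ultimately show ?thesis by (simp add: norm_sum_def[of X n] \<gamma>_def)
qed

text \<open>The \<open>k\<close>-th coordinate separated from the independent rest, in the two places where \<open>X_k\<close> enters.\<close>

lemma split_at:
  assumes k: "k \<in> K"
  shows "F \<omega> = \<gamma> * X k \<omega> + \<gamma> * (\<Sum>j\<in>{1..n}-{k}. X j \<omega>)"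
    and "\<sigma> + T \<omega> = \<sigma> + (\<Sum>j\<in>K-{k}. \<tau> j (X j \<omega>)) + \<tau> k (X k \<omega>)"
proof -
  have "(\<Sum>j\<in>{1..n}. X j \<omega>) = X k \<omega> + (\<Sum>j\<in>{1..n}-{k}. X j \<omega>)"
    by (rule sum.remove) (use k in auto)
  thus "F \<omega> = \<gamma> * X k \<omega> + \<gamma> * (\<Sum>j\<in>{1..n}-{k}. X j \<omega>)"
    by (simp add: norm_sum_def \<gamma>_def add_divide_distrib)
  show "\<sigma> + T \<omega> = \<sigma> + (\<Sum>j\<in>K-{k}. \<tau> j (X j \<omega>)) + \<tau> k (X k \<omega>)"
    unfolding T_def using sum.remove[OF _ k, of "\<lambda>j. \<tau> j (X j \<omega>)"] by simp
qed

lemma integrable_kernel_terms: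
  assumes k: "k \<in> K" and ab: "a < b"
    and y[measurable]: "y \<in> borel_measurable M" and D[measurable]: "D \<in> borel_measurable M"
    and D1: "\<And>\<omega>. 1 \<le> D \<omega>" and tD: "\<And>\<omega>. \<tau> k (X k \<omega>) \<le> D \<omega>"
  shows "integrable M (\<lambda>\<omega>. \<gamma> * \<tau> k (X k \<omega>) * indicator {a<..b} (y \<omega>) / D \<omega>)"
    and "integrable M (\<lambda>\<omega>. ramp a b (y \<omega>) * (X k \<omega> / D \<omega>))"
    and "integrable M (\<lambda>\<omega>. ramp a b (y \<omega>) * (\<tau> k (X k \<omega>) * \<delta> k (X k \<omega>) / (D \<omega>)\<^sup>2))"
proof -
  have k1: "1 \<le> k" using k by auto
  note [measurable] = X_measurable[OF k1] tau_meas[OF k1] delta_meas[OF k1]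
  have rb: "0 \<le> ramp a b z" "ramp a b z \<le> b - a" for z using ramp_bounds[of a b] ab by auto
  note tb = ratio_bounds[OF tau_nonneg[OF k1] tD D1]
  have "integrable M (\<lambda>\<omega>. (\<gamma> * (indicator {a<..b} (y \<omega>) * (\<tau> k (X k \<omega>) / D \<omega>))) * 1)"
  proof (rule integrable_bounded_mult[where c=\<gamma>])
    fix \<omega>
    have "\<gamma> * (indicator {a<..b} (y \<omega>) * (\<tau> k (X k \<omega>) / D \<omega>)) \<le> \<gamma> * (1 * 1)"
      using gamma_pos tb(1,2)[of \<omega>] by (intro mult_left_mono mult_mono) auto
    moreover have "0 \<le> \<gamma> * (indicator {a<..b} (y \<omega>) * (\<tau> k (X k \<omega>) / D \<omega>))"
      using gamma_pos tb(1)[of \<omega>] by (intro mult_nonneg_nonneg) auto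
    ultimately show "\<bar>\<gamma> * (indicator {a<..b} (y \<omega>) * (\<tau> k (X k \<omega>) / D \<omega>))\<bar> \<le> \<gamma>"
      by (simp only: abs_of_nonneg mult_1_right)
  qed simp_all
  thus "integrable M (\<lambda>\<omega>. \<gamma> * \<tau> k (X k \<omega>) * indicator {a<..b} (y \<omega>) / D \<omega>)"
    by (simp add: mult_ac)
  have "integrable M (\<lambda>\<omega>. (ramp a b (y \<omega>) / D \<omega>) * X k \<omega>)"
  proof (rule integrable_bounded_mult[where c="b - a", OF _ _ X_facts(1)[OF k1]])
    fix \<omega>
    have "ramp a b (y \<omega>) / D \<omega> \<le> ramp a b (y \<omega>) / 1"
      by (rule divide_left_mono) (use rb D1[of \<omega>] in auto)
    thus "\<bar>ramp a b (y \<omega>) / D \<omega>\<bar> \<le> b - a" using rb[of "y \<omega>"] D1[of \<omega>] by simp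
  qed measurable
  thus "integrable M (\<lambda>\<omega>. ramp a b (y \<omega>) * (X k \<omega> / D \<omega>))" by simp
  have "integrable M (\<lambda>\<omega>. (ramp a b (y \<omega>) * (\<tau> k (X k \<omega>) / (D \<omega>)\<^sup>2)) * \<delta> k (X k \<omega>))"
  proof (rule integrable_bounded_mult[where c="b - a", OF _ _ integrable_delta[OF k]])
    fix \<omega>
    have "ramp a b (y \<omega>) * (\<tau> k (X k \<omega>) / (D \<omega>)\<^sup>2) \<le> (b - a) * 1"
      by (rule mult_mono) (use rb[of "y \<omega>"] tb[of \<omega>] in auto)
    moreover have "0 \<le> ramp a b (y \<omega>) * (\<tau> k (X k \<omega>) / (D \<omega>)\<^sup>2)"
      by (rule mult_nonneg_nonneg) (use rb[of "y \<omega>"] tb[of \<omega>] in auto)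
    ultimately show "\<bar>ramp a b (y \<omega>) * (\<tau> k (X k \<omega>) / (D \<omega>)\<^sup>2)\<bar> \<le> b - a"
      by (simp only: abs_of_nonneg mult_1_right)
  qed measurable
  thus "integrable M (\<lambda>\<omega>. ramp a b (y \<omega>) * (\<tau> k (X k \<omega>) * \<delta> k (X k \<omega>) / (D \<omega>)\<^sup>2))"
    by (simp add: mult.assoc)
qed

text \<open>The Stein identity in the \<open>k\<close>-th coordinate with the others frozen: \<open>s\<close> stands for the rest of \<open>F\<close> and \<open>c\<close> for
  the rest of \<open>\<sigma> + T\<close>.\<close>

lemma kernel_identity_conditional:
  assumes k: "k \<in> K" and ab: "a < b" and c: "1 \<le> c"
  shows "expectation (\<lambda>\<omega>. \<gamma> * \<tau> k (X k \<omega>) * indicator {a<..b} (\<gamma> * X k \<omega> + s) / (c + \<tau> k (X k \<omega>)))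
       = expectation (\<lambda>\<omega>. ramp a b (\<gamma> * X k \<omega> + s) * (X k \<omega> / (c + \<tau> k (X k \<omega>)) + \<tau> k (X k \<omega>) * \<delta> k (X k \<omega>) / (c + \<tau> k (X k \<omega>))\<^sup>2))"
proof -
  have k1: "1 \<le> k" using k by auto
  interpret sd: stein_density "p k" by (rule stein_density[OF k1])
  have [measurable]: "X k \<in> borel_measurable M" using k1 by simp
  have cp: "1 \<le> c + \<tau> k x" for x using c tau_nonneg[OF k1, of x] by simp
  have id: "integrable lborel (\<lambda>x. p k x * sd.\<tau>' x)"
    using integrable_delta[OF k] expectation_X(1)[OF k1, of sd.\<tau>'] by simp
  let ?t = "\<lambda>\<omega>. \<tau> k (X k \<omega>)" and ?y = "\<lambda>\<omega>. \<gamma> * X k \<omega> + s"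
  have E: "expectation (\<lambda>\<omega>. ?t \<omega> * (\<gamma> * indicator {a<..b} (?y \<omega>) / (c + ?t \<omega>) - ramp a b (?y \<omega>) * \<delta> k (X k \<omega>) / (c + ?t \<omega>)\<^sup>2))
      = expectation (\<lambda>\<omega>. X k \<omega> * (ramp a b (?y \<omega>) / (c + ?t \<omega>)))"
    using sd.stein_identity_normalized[OF id c gamma_pos ab, of s]
    by (subst (asm) expectation_X(2)[OF k1], measurable, subst (asm) expectation_X(2)[OF k1], measurable)
  have [measurable]: "\<tau> k \<in> borel_measurable borel" by (rule tau_meas[OF k1])
  have tc: "?t \<omega> \<le> c + ?t \<omega>" for \<omega> using c by simp
  note i = integrable_kernel_terms[OF k ab, of ?y "\<lambda>\<omega>. c + ?t \<omega>", OF _ _ cp tc]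
  have i1: "integrable M (\<lambda>\<omega>. \<gamma> * ?t \<omega> * indicator {a<..b} (?y \<omega>) / (c + ?t \<omega>))"
    by (rule i(1)) auto
  have i3: "integrable M (\<lambda>\<omega>. ramp a b (?y \<omega>) * (X k \<omega> / (c + ?t \<omega>)))"
    by (rule i(2)) auto
  have i2: "integrable M (\<lambda>\<omega>. ramp a b (?y \<omega>) * (?t \<omega> * \<delta> k (X k \<omega>) / (c + ?t \<omega>)\<^sup>2))"
    by (rule i(3)) auto
  have "expectation (\<lambda>\<omega>. \<gamma> * ?t \<omega> * indicator {a<..b} (?y \<omega>) / (c + ?t \<omega>)) - expectation (\<lambda>\<omega>. ramp a b (?y \<omega>) * (?t \<omega> * \<delta> k (X k \<omega>) / (c + ?t \<omega>)\<^sup>2))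
      = expectation (\<lambda>\<omega>. ?t \<omega> * (\<gamma> * indicator {a<..b} (?y \<omega>) / (c + ?t \<omega>) - ramp a b (?y \<omega>) * \<delta> k (X k \<omega>) / (c + ?t \<omega>)\<^sup>2))"
    by (subst Bochner_Integration.integral_diff[OF i1 i2, symmetric])
       (auto intro!: Bochner_Integration.integral_cong simp: right_diff_distrib mult_ac)
  also have "\<dots> = expectation (\<lambda>\<omega>. ramp a b (?y \<omega>) * (X k \<omega> / (c + ?t \<omega>)))"
    unfolding E by (auto intro!: Bochner_Integration.integral_cong simp: mult_ac)
  finally show ?thesis
    unfolding distrib_left using Bochner_Integration.integral_add[OF i3 i2] by simp
qed

lemma denominator_measurable: "(\<lambda>\<omega>. \<sigma> + T \<omega>) \<in> borel_measurable M"
  by measurable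

lemma inv_bounds: "0 < \<sigma> + T \<omega>" "1 \<le> \<sigma> + T \<omega>"
  using sigma_ge T_nonneg[of \<omega>] by auto

lemma tau_le_T: "k \<in> K \<Longrightarrow> \<tau> k (X k \<omega>) \<le> T \<omega>"
  unfolding T_def by (rule member_le_sum) (auto intro: tau_nonneg)

lemma tau_le_denominator: "k \<in> K \<Longrightarrow> \<tau> k (X k \<omega>) \<le> \<sigma> + T \<omega>"
  using tau_le_T[of k \<omega>] sigma_ge by linarith

lemmas integrable_weighted_terms =
  integrable_kernel_terms[OF _ _ F_measurable denominator_measurable inv_bounds(2) tau_le_denominator]

lemma kernel_identity:
  assumes k: "k \<in> K" and ab: "a < b"
  shows "expectation (\<lambda>\<omega>. \<gamma> * \<tau> k (X k \<omega>) * indicator {a<..b} (F \<omega>) / (\<sigma> + T \<omega>))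
       = expectation (\<lambda>\<omega>. ramp a b (F \<omega>) * (X k \<omega> / (\<sigma> + T \<omega>)))
       + expectation (\<lambda>\<omega>. ramp a b (F \<omega>) * (\<tau> k (X k \<omega>) * \<delta> k (X k \<omega>) / (\<sigma> + T \<omega>)\<^sup>2))"
proof -
  have k1: "1 \<le> k" using k by auto
  have [measurable]: "X k \<in> borel_measurable M" "\<tau> k \<in> borel_measurable borel" "\<delta> k \<in> borel_measurable borel" using k1 by simp_all
  define R where "R = {1..n} - {k}"
  define s where "s z = \<gamma> * (\<Sum>j\<in>R. z j)" for z :: "nat \<Rightarrow> real"
  define c where "c z = \<sigma> + (\<Sum>j\<in>K-{k}. \<tau> j (z j))" for z :: "nat \<Rightarrow> real"
  have sm[measurable]: "s \<in> borel_measurable (PiM R (\<lambda>_. borel))" unfolding s_def[abs_def] by measurable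
  have "(\<lambda>z. \<tau> j (z j)) \<in> borel_measurable (PiM R (\<lambda>_. borel))" if "j \<in> K - {k}" for j
  proof (rule measurable_compose[where g="\<tau> j" and N=borel])
    show "(\<lambda>z. z j) \<in> PiM R (\<lambda>_. borel) \<rightarrow>\<^sub>M borel"
      by (rule measurable_component_singleton) (use that in \<open>auto simp: R_def\<close>)
  qed (use that in auto)
  hence cm[measurable]: "c \<in> borel_measurable (PiM R (\<lambda>_. borel))" unfolding c_def[abs_def] by (intro borel_measurable_add borel_measurable_sum) auto
  have km[measurable]: "(\<lambda>x. x k) \<in> borel_measurable (PiM {k} (\<lambda>_. borel))"
    by (rule measurable_component_singleton) simp
  define Z where "Z \<omega> = restrict (\<lambda>i. X i \<omega>) R" for \<omega>
  define W where "W \<omega> = restrict (\<lambda>i. X i \<omega>) {k}" for \<omega>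
  have ind: "indep_var (PiM R (\<lambda>_. borel)) Z (PiM {k} (\<lambda>_. borel)) W"
    unfolding Z_def[abs_def] W_def[abs_def] by (rule indep_var_restrict[OF indep]) (use k in \<open>auto simp: R_def\<close>)
  have W: "W \<omega> k = X k \<omega>" for \<omega> by (simp add: W_def)
  have FZ: "\<gamma> * X k \<omega> + s (Z \<omega>) = F \<omega>" for \<omega>
    unfolding split_at(1)[OF k, of \<omega>] s_def R_def[symmetric] by (simp add: Z_def)
  have cZ: "c (Z \<omega>) + \<tau> k (X k \<omega>) = \<sigma> + T \<omega>" for \<omega>
  proof -
    have "(\<Sum>j\<in>K-{k}. \<tau> j (Z \<omega> j)) = (\<Sum>j\<in>K-{k}. \<tau> j (X j \<omega>))"
      by (intro sum.cong) (auto simp: Z_def R_def)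
    thus ?thesis unfolding split_at(2)[OF k, of \<omega>] c_def by simp
  qed
  have c1: "1 \<le> c z" for z
  proof -
    have "0 \<le> (\<Sum>j\<in>K-{k}. \<tau> j (z j))" by (intro sum_nonneg tau_nonneg) auto
    thus ?thesis using sigma_ge by (simp add: c_def)
  qed
  define k1 where "k1 = (\<lambda>z x. \<gamma> * \<tau> k (x k) * indicator {a<..b} (\<gamma> * x k + s z) / (c z + \<tau> k (x k)))"
  define k2 where "k2 = (\<lambda>z x. ramp a b (\<gamma> * x k + s z) * (x k / (c z + \<tau> k (x k)) + \<tau> k (x k) * \<delta> k (x k) / (c z + \<tau> k (x k))\<^sup>2))"
  have e1: "k1 (Z \<omega>) (W \<omega>) = \<gamma> * \<tau> k (X k \<omega>) * indicator {a<..b} (F \<omega>) / (\<sigma> + T \<omega>)" for \<omega>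
    by (simp only: k1_def W FZ cZ)
  have e2: "k2 (Z \<omega>) (W \<omega>) = ramp a b (F \<omega>) * (X k \<omega> / (\<sigma> + T \<omega>)) + ramp a b (F \<omega>) * (\<tau> k (X k \<omega>) * \<delta> k (X k \<omega>) / (\<sigma> + T \<omega>)\<^sup>2)" for \<omega>
    by (simp only: k2_def W FZ cZ distrib_left)
  note int = integrable_weighted_terms[OF k ab k]
  have "expectation (\<lambda>\<omega>. k1 (Z \<omega>) (W \<omega>)) = expectation (\<lambda>\<omega>. k2 (Z \<omega>) (W \<omega>))"
  proof (rule expectation_eq_by_conditioning[OF ind])
    show "case_prod k1 \<in> borel_measurable (PiM R (\<lambda>_. borel) \<Otimes>\<^sub>M PiM {k} (\<lambda>_. borel))"
      unfolding k1_def case_prod_beta' by measurable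
    show "case_prod k2 \<in> borel_measurable (PiM R (\<lambda>_. borel) \<Otimes>\<^sub>M PiM {k} (\<lambda>_. borel))"
      unfolding k2_def case_prod_beta' by measurable
    show "integrable M (\<lambda>\<omega>. k1 (Z \<omega>) (W \<omega>))" unfolding e1 by (rule int)
    show "integrable M (\<lambda>\<omega>. k2 (Z \<omega>) (W \<omega>))" unfolding e2 using int(2,3) by simp
    show "expectation (\<lambda>\<omega>. k1 z (W \<omega>)) = expectation (\<lambda>\<omega>. k2 z (W \<omega>))" for z
      unfolding k1_def k2_def W by (rule kernel_identity_conditional[OF k ab c1])
  qed
  thus ?thesis unfolding e1 e2 using int by simp
qed

lemma integrable_score: "integrable M (\<lambda>\<omega>. \<rho> (S \<omega>))"
  by (rule square_integrable_imp_integrable[OF _ integrable_rho_sq]) simp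

text \<open>The direction of \<open>S\<close>, in which \<open>\<sigma> + T\<close> is constant; its coefficient \<open>\<sigma>\<close> is the part of the denominator
  that stays away from zero.\<close>

lemma score_term:
  assumes ab: "a < b"
  shows "integrable M (\<lambda>\<omega>. \<gamma> * \<sigma> * indicator {a<..b} (F \<omega>) / (\<sigma> + T \<omega>))"
    and "integrable M (\<lambda>\<omega>. ramp a b (F \<omega>) * (\<rho> (S \<omega>) / (\<sigma> + T \<omega>)))"
    and "expectation (\<lambda>\<omega>. \<gamma> * \<sigma> * indicator {a<..b} (F \<omega>) / (\<sigma> + T \<omega>))
       = - expectation (\<lambda>\<omega>. ramp a b (F \<omega>) * (\<rho> (S \<omega>) / (\<sigma> + T \<omega>)))"
proof -
  have rb: "0 \<le> ramp a b y" "ramp a b y \<le> b - a" for y using ramp_bounds[of a b] ab by auto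
  have inv: "0 \<le> 1 / (\<sigma> + T \<omega>)" "1 / (\<sigma> + T \<omega>) \<le> 1" for \<omega> using inv_bounds[of \<omega>] by auto
  have "integrable M (\<lambda>\<omega>. (indicator {a<..b} (F \<omega>) * (1 / (\<sigma> + T \<omega>))) * (\<gamma> * \<sigma>))"
    by (rule integrable_bounded_mult[where c=1]) (use inv inv_bounds(1) in \<open>auto simp: indicator_def less_imp_le\<close>)
  thus i1: "integrable M (\<lambda>\<omega>. \<gamma> * \<sigma> * indicator {a<..b} (F \<omega>) / (\<sigma> + T \<omega>))" by (simp add: mult_ac)
  have "integrable M (\<lambda>\<omega>. (ramp a b (F \<omega>) * (1 / (\<sigma> + T \<omega>))) * \<rho> (S \<omega>))"
  proof (rule integrable_bounded_mult[where c="b - a", OF _ _ integrable_score])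
    fix \<omega>
    have "ramp a b (F \<omega>) * (1 / (\<sigma> + T \<omega>)) \<le> (b - a) * 1"
      by (rule mult_mono) (use rb[of "F \<omega>"] inv[of \<omega>] in auto)
    moreover have "0 \<le> ramp a b (F \<omega>) * (1 / (\<sigma> + T \<omega>))"
      by (rule mult_nonneg_nonneg) (use rb[of "F \<omega>"] inv[of \<omega>] in auto)
    ultimately show "\<bar>ramp a b (F \<omega>) * (1 / (\<sigma> + T \<omega>))\<bar> \<le> b - a"
      by (simp only: abs_of_nonneg mult_1_right)
  qed measurable
  thus i2: "integrable M (\<lambda>\<omega>. ramp a b (F \<omega>) * (\<rho> (S \<omega>) / (\<sigma> + T \<omega>)))" by simp
  define s where "s z = \<gamma> * (\<Sum>j\<in>K. z j)" for z :: "nat \<Rightarrow> real"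
  define c where "c z = \<sigma> + (\<Sum>j\<in>K. \<tau> j (z j))" for z :: "nat \<Rightarrow> real"
  define y where "y x = (\<Sum>j\<in>{1..n\<^sub>0}. x j) / sqrt (real n\<^sub>0)" for x :: "nat \<Rightarrow> real"
  have sm[measurable]: "s \<in> borel_measurable (PiM K (\<lambda>_. borel))" unfolding s_def[abs_def] by measurable
  have "(\<lambda>z. \<tau> j (z j)) \<in> borel_measurable (PiM K (\<lambda>_. borel))" if "j \<in> K" for j
  proof (rule measurable_compose[where g="\<tau> j" and N=borel])
    show "(\<lambda>z. z j) \<in> PiM K (\<lambda>_. borel) \<rightarrow>\<^sub>M borel"
      by (rule measurable_component_singleton) (use that in auto)
  qed (use that in auto)
  hence cm[measurable]: "c \<in> borel_measurable (PiM K (\<lambda>_. borel))" unfolding c_def[abs_def] by (intro borel_measurable_add borel_measurable_sum) auto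
  have ym[measurable]: "y \<in> borel_measurable (PiM {1..n\<^sub>0} (\<lambda>_. borel))" unfolding y_def[abs_def] by measurable
  define Z where "Z \<omega> = restrict (\<lambda>i. X i \<omega>) K" for \<omega>
  define W where "W \<omega> = restrict (\<lambda>i. X i \<omega>) {1..n\<^sub>0}" for \<omega>
  have ind: "indep_var (PiM K (\<lambda>_. borel)) Z (PiM {1..n\<^sub>0} (\<lambda>_. borel)) W"
    unfolding Z_def[abs_def] W_def[abs_def] by (rule indep_var_restrict[OF indep]) auto
  have W: "y (W \<omega>) = S \<omega>" for \<omega> by (simp add: W_def y_def norm_sum_def)
  have FZ: "\<gamma> * \<sigma> * S \<omega> + s (Z \<omega>) = F \<omega>" for \<omega>
    unfolding F_eq V_def s_def by (simp add: Z_def algebra_simps)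
  have cZ: "c (Z \<omega>) = \<sigma> + T \<omega>" for \<omega> by (simp add: c_def T_def Z_def)
  define k1 where "k1 = (\<lambda>z x. \<gamma> * \<sigma> * indicator {a<..b} (\<gamma> * \<sigma> * y x + s z) / c z)"
  define k2 where "k2 = (\<lambda>z x. - (ramp a b (\<gamma> * \<sigma> * y x + s z) * (\<rho> (y x) / c z)))"
  have e1: "k1 (Z \<omega>) (W \<omega>) = \<gamma> * \<sigma> * indicator {a<..b} (F \<omega>) / (\<sigma> + T \<omega>)" for \<omega>
    by (simp only: k1_def W FZ cZ)
  have e2: "k2 (Z \<omega>) (W \<omega>) = - (ramp a b (F \<omega>) * (\<rho> (S \<omega>) / (\<sigma> + T \<omega>)))" for \<omega>
    by (simp only: k2_def W FZ cZ)
  have "expectation (\<lambda>\<omega>. k1 (Z \<omega>) (W \<omega>)) = expectation (\<lambda>\<omega>. k2 (Z \<omega>) (W \<omega>))"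
  proof (rule expectation_eq_by_conditioning[OF ind])
    show "case_prod k1 \<in> borel_measurable (PiM K (\<lambda>_. borel) \<Otimes>\<^sub>M PiM {1..n\<^sub>0} (\<lambda>_. borel))"
      unfolding k1_def case_prod_beta' by measurable
    show "case_prod k2 \<in> borel_measurable (PiM K (\<lambda>_. borel) \<Otimes>\<^sub>M PiM {1..n\<^sub>0} (\<lambda>_. borel))"
      unfolding k2_def case_prod_beta' by measurable
    show "integrable M (\<lambda>\<omega>. k1 (Z \<omega>) (W \<omega>))" unfolding e1 by (rule i1)
    show "integrable M (\<lambda>\<omega>. k2 (Z \<omega>) (W \<omega>))" unfolding e2 using i2 by simp
    show "expectation (\<lambda>\<omega>. k1 z (W \<omega>)) = expectation (\<lambda>\<omega>. k2 z (W \<omega>))" for z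
    proof -
      have "0 < \<gamma> * \<sigma>" using gamma_pos sigma_ge by simp
      from score_identity[OF this, of a b "s z"] ab
      have "expectation (\<lambda>\<omega>. \<gamma> * \<sigma> * indicator {a<..b} (\<gamma> * \<sigma> * S \<omega> + s z)) / c z = - expectation (\<lambda>\<omega>. ramp a b (\<gamma> * \<sigma> * S \<omega> + s z) * \<rho> (S \<omega>)) / c z" by simp
      thus ?thesis unfolding k1_def k2_def W by simp
    qed
  qed
  thus "expectation (\<lambda>\<omega>. \<gamma> * \<sigma> * indicator {a<..b} (F \<omega>) / (\<sigma> + T \<omega>))
       = - expectation (\<lambda>\<omega>. ramp a b (F \<omega>) * (\<rho> (S \<omega>) / (\<sigma> + T \<omega>)))" unfolding e1 e2 by simp
qed

text \<open>The indicator of \<open>{a<..b}\<close> is split as \<open>\<sigma> / (\<sigma> + T) + \<Sum>_k \<tau>_k / (\<sigma> + T) = 1\<close>, and each part is integrated by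
  parts in its own direction.\<close>

lemma integration_by_parts:
  assumes ab: "a < b"
  shows "prob {\<omega>\<in>space M. F \<omega> \<in> {a<..b}} = expectation (\<lambda>\<omega>. ramp a b (F \<omega>) * G \<omega>)"
proof -
  note sc = score_term[OF ab]
  have pos: "\<sigma> + T \<omega> \<noteq> 0" for \<omega> using inv_bounds[of \<omega>] by simp
  have lhs: "\<gamma> * indicator {a<..b} (F \<omega>) = \<gamma> * \<sigma> * indicator {a<..b} (F \<omega>) / (\<sigma> + T \<omega>)
      + (\<Sum>k\<in>K. \<gamma> * \<tau> k (X k \<omega>) * indicator {a<..b} (F \<omega>) / (\<sigma> + T \<omega>))" for \<omega>
  proof -
    have "(\<Sum>k\<in>K. \<gamma> * \<tau> k (X k \<omega>) * indicator {a<..b} (F \<omega>) / (\<sigma> + T \<omega>)) = \<gamma> * T \<omega> * indicator {a<..b} (F \<omega>) / (\<sigma> + T \<omega>)"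
    proof -
      have "(\<Sum>k\<in>K. \<gamma> * t k * i / c) = \<gamma> * (\<Sum>k\<in>K. t k) * i / c" for t :: "nat \<Rightarrow> real" and i c
        by (simp add: sum_distrib_left sum_distrib_right sum_divide_distrib)
      from this[of "\<lambda>k. \<tau> k (X k \<omega>)"] show ?thesis unfolding T_def[symmetric] .
    qed
    thus ?thesis using pos[of \<omega>] by (simp add: field_simps)
  qed
  have rhs: "ramp a b (F \<omega>) * G \<omega> = sqrt (real n) * ((\<Sum>k\<in>K. ramp a b (F \<omega>) * (X k \<omega> / (\<sigma> + T \<omega>)) + ramp a b (F \<omega>) * (\<tau> k (X k \<omega>) * \<delta> k (X k \<omega>) / (\<sigma> + T \<omega>)\<^sup>2))
      - ramp a b (F \<omega>) * (\<rho> (S \<omega>) / (\<sigma> + T \<omega>)))" for \<omega>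
  proof -
    have "(\<Sum>k\<in>K. ramp a b (F \<omega>) * (X k \<omega> / (\<sigma> + T \<omega>)) + ramp a b (F \<omega>) * (\<tau> k (X k \<omega>) * \<delta> k (X k \<omega>) / (\<sigma> + T \<omega>)\<^sup>2))
        = ramp a b (F \<omega>) * (V \<omega> / (\<sigma> + T \<omega>)) + ramp a b (F \<omega>) * (Q \<omega> / (\<sigma> + T \<omega>)\<^sup>2)"
      by (simp add: V_def Q_def sum.distrib sum_distrib_left sum_divide_distrib)
    thus ?thesis by (simp add: G_def algebra_simps diff_divide_distrib)
  qed
  have "\<gamma> * prob {\<omega>\<in>space M. F \<omega> \<in> {a<..b}} = expectation (\<lambda>\<omega>. \<gamma> * indicator {a<..b} (F \<omega>))"
  proof -
    have "expectation (\<lambda>\<omega>. indicator {a<..b} (F \<omega>)) = expectation (indicator {\<omega>\<in>space M. F \<omega> \<in> {a<..b}})"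
      by (intro Bochner_Integration.integral_cong) (auto simp: indicator_def)
    also have "\<dots> = prob {\<omega>\<in>space M. F \<omega> \<in> {a<..b}}" by simp
    finally show ?thesis by simp
  qed
  also have "\<dots> = expectation (\<lambda>\<omega>. \<gamma> * \<sigma> * indicator {a<..b} (F \<omega>) / (\<sigma> + T \<omega>))
      + (\<Sum>k\<in>K. expectation (\<lambda>\<omega>. \<gamma> * \<tau> k (X k \<omega>) * indicator {a<..b} (F \<omega>) / (\<sigma> + T \<omega>)))"
    unfolding lhs using sc(1) integrable_weighted_terms(1)[OF _ ab]
    by (subst Bochner_Integration.integral_add) (auto intro!: Bochner_Integration.integrable_sum simp: Bochner_Integration.integral_sum)
  also have "\<dots> = - expectation (\<lambda>\<omega>. ramp a b (F \<omega>) * (\<rho> (S \<omega>) / (\<sigma> + T \<omega>)))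
      + (\<Sum>k\<in>K. expectation (\<lambda>\<omega>. ramp a b (F \<omega>) * (X k \<omega> / (\<sigma> + T \<omega>))) + expectation (\<lambda>\<omega>. ramp a b (F \<omega>) * (\<tau> k (X k \<omega>) * \<delta> k (X k \<omega>) / (\<sigma> + T \<omega>)\<^sup>2)))"
    unfolding sc(3) using kernel_identity[OF _ ab] by (metis (no_types, lifting) sum.cong)
  also have "\<dots> = expectation (\<lambda>\<omega>. (\<Sum>k\<in>K. ramp a b (F \<omega>) * (X k \<omega> / (\<sigma> + T \<omega>)) + ramp a b (F \<omega>) * (\<tau> k (X k \<omega>) * \<delta> k (X k \<omega>) / (\<sigma> + T \<omega>)\<^sup>2))
      - ramp a b (F \<omega>) * (\<rho> (S \<omega>) / (\<sigma> + T \<omega>)))"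
    using integrable_weighted_terms(2,3)[OF _ ab] sc(2)
    by (subst Bochner_Integration.integral_diff) (auto intro!: Bochner_Integration.integrable_sum Bochner_Integration.integrable_add simp: Bochner_Integration.integral_sum)
  finally have *: "\<gamma> * prob {\<omega>\<in>space M. F \<omega> \<in> {a<..b}} = \<dots>" .
  have "prob {\<omega>\<in>space M. F \<omega> \<in> {a<..b}} = sqrt (real n) * (\<gamma> * prob {\<omega>\<in>space M. F \<omega> \<in> {a<..b}})"
    using sqrt_n_gamma by (simp add: mult.assoc[symmetric])
  also have "\<dots> = expectation (\<lambda>\<omega>. ramp a b (F \<omega>) * G \<omega>)"
    unfolding * rhs by simp
  finally show ?thesis .
qed

end

section \<open>The mean square of the residual\<close>

context stein_sum
begin

definition m :: real where "m = real (card K)"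
definition A :: real where "A = 2 * real n\<^sub>0"
definition L :: "'a \<Rightarrow> real" where "L \<omega> = 1 / (\<sigma> + T \<omega>)"

text \<open>The event on which the denominator \<open>\<sigma> + T\<close> can be smaller than order \<open>n\<close>. Off it \<open>L \<le> A / n\<close>, on it only
  \<open>L \<le> 1\<close> is available; its probability is at most \<open>K8 / n^8\<close>, which absorbs every power of \<open>n\<close> that
  occurs below.\<close>

definition bad :: "'a \<Rightarrow> real" where "bad = indicator {\<omega>\<in>space M. T \<omega> < m / 2}"
definition K8 :: real where "K8 = (8 * (8 * B)) ^ 8 * exp (real n\<^sub>0 / (8 * B))"

text \<open>The number \<open>16 B\<close> bounds the fourth moment of \<open>\<tau>_k(X_k) - 1\<close>, because \<open>(x - 1)^4 \<le> 8 (x^4 + 1)\<close> and \<open>B \<ge> 1\<close>.\<close>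

definition C4 :: real where "C4 = 3 * (16 * B)\<^sup>2"

lemma m_eq: "m = real n - real n\<^sub>0"
  using n0_le by (simp add: m_def of_nat_diff)

lemma n_pos: "0 < real n" using n0 n0_le by simp

lemma m_le: "0 \<le> m" "m \<le> real n" using m_eq n0_le by auto

lemma sigma_le: "\<sigma> \<le> real n\<^sub>0"
proof -
  have "sqrt (real n\<^sub>0) \<le> sqrt ((real n\<^sub>0)\<^sup>2)"
    using n0 by (intro real_sqrt_le_mono) (simp add: power2_eq_square)
  thus ?thesis by (simp add: \<sigma>_def)
qed

lemma bad_cases: "bad \<omega> = 0 \<or> bad \<omega> = 1" by (auto simp: bad_def indicator_def)

lemma L_bounds: "0 \<le> L \<omega>" "L \<omega> \<le> 1"
  using inv_bounds[of \<omega>] by (auto simp: L_def)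

text \<open>Here \<open>\<sigma> + T \<ge> 1 + m / 2 \<ge> n / (2 n0)\<close>, the latter because \<open>n = n0 + m\<close> and \<open>n0 \<ge> 1\<close>.\<close>

lemma L_good:
  assumes "\<omega> \<in> space M" "bad \<omega> = 0"
  shows "L \<omega> \<le> A / real n"
proof -
  have "m / 2 \<le> T \<omega>" using assms by (auto simp: bad_def indicator_def split: if_splits)
  hence ge: "1 + m / 2 \<le> \<sigma> + T \<omega>" using sigma_ge by simp
  have "real n \<le> real n\<^sub>0 * (2 + m)"
  proof -
    have "m * 1 \<le> m * real n\<^sub>0" using n0 m_le by (intro mult_left_mono) auto
    moreover have "real n\<^sub>0 * (2 + m) = 2 * real n\<^sub>0 + m * real n\<^sub>0" by (simp add: algebra_simps)
    ultimately show ?thesis using m_eq by linarith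
  qed
  hence "real n \<le> A * (1 + m / 2)" by (simp add: A_def algebra_simps)
  also have "\<dots> \<le> A * (\<sigma> + T \<omega>)" using ge by (intro mult_left_mono) (auto simp: A_def)
  finally show ?thesis using inv_bounds[of \<omega>] n_pos by (simp add: L_def field_simps)
qed

lemma A_nonneg: "0 \<le> A" by (simp add: A_def)

lemma L_pow:
  assumes "\<omega> \<in> space M"
  shows "(L \<omega>) ^ j \<le> (A / real n) ^ j + bad \<omega>"
proof (cases "bad \<omega> = 0")
  case True
  thus ?thesis using power_mono[OF L_good[OF assms True] L_bounds(1), of j] by simp
next
  case False
  hence "bad \<omega> = 1" using bad_cases by blast
  moreover have "(L \<omega>) ^ j \<le> 1" using L_bounds by (intro power_le_one)
  moreover have "0 \<le> (A / real n) ^ j" using A_nonneg by simp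
  ultimately show ?thesis by simp
qed

lemma n_eq_of_bad:
  assumes "\<omega> \<in> space M" "bad \<omega> = 1"
  shows "\<bar>real n - (\<sigma> + T \<omega>)\<bar> \<le> real n"
proof -
  have "T \<omega> < m / 2" using assms by (auto simp: bad_def indicator_def split: if_splits)
  thus ?thesis using inv_bounds[of \<omega>] sigma_le m_eq m_le by auto
qed

lemma integrable_T_moments:
  assumes "k \<in> K"
  shows "i \<le> 4 \<Longrightarrow> integrable M (\<lambda>\<omega>. (X k \<omega>) ^ i)" "i \<le> 4 \<Longrightarrow> integrable M (\<lambda>\<omega>. (\<tau> k (X k \<omega>)) ^ i)"
    "i \<le> 4 \<Longrightarrow> integrable M (\<lambda>\<omega>. (\<delta> k (X k \<omega>)) ^ i)"
  using integrable_from_power4[of "X k" i] integrable_from_power4[of "\<lambda>\<omega>. \<tau> k (X k \<omega>)" i] integrable_from_power4[of "\<lambda>\<omega>. \<delta> k (X k \<omega>)" i]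
    X4[of k] tau4[of k] delta4[of k] assms by auto

lemma expectation_tau:
  assumes k: "k \<in> K"
  shows "expectation (\<lambda>\<omega>. \<tau> k (X k \<omega>)) = 1"
proof -
  have k1: "1 \<le> k" using k by auto
  interpret sd: stein_density "p k" by (rule stein_density[OF k1])
  have "(LINT x|lborel. p k x * \<tau> k x) = (LINT x|lborel. x\<^sup>2 * p k x)"
  proof (rule sd.expectation_stein_kernel)
    show "integrable lborel (\<lambda>x. x\<^sup>2 * p k x)" using expectation_X(1)[OF k1, of "\<lambda>x. x\<^sup>2"] X_facts(3)[OF k1] by (simp add: mult.commute)
    show "integrable lborel (\<lambda>x. p k x * \<tau> k x)" using expectation_X(1)[OF k1, of "\<tau> k"] integrable_tau[OF k] by simp
  qed
  also have "(LINT x|lborel. x\<^sup>2 * p k x) = (LINT x|lborel. p k x * x\<^sup>2)" by (simp add: mult.commute)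
  finally show ?thesis
    using expectation_X(2)[OF k1, of "\<tau> k"] expectation_X(2)[OF k1, of "\<lambda>x. x\<^sup>2"] X_facts(4)[OF k1] by simp
qed

end

text \<open>With \<open>B \<ge> 1\<close> the bound \<open>B\<close> on fourth moments also bounds second moments.\<close>

locale stein_sum_bounded = stein_sum +
  assumes B1: "1 \<le> B"
begin

lemma prob_bad: "expectation bad \<le> exp (- m / (8 * B))"
  and prob_bad_poly: "real n ^ 8 * expectation bad \<le> K8"
proof -
  have "indep_vars (\<lambda>_. borel) (\<lambda>k \<omega>. \<tau> k (X k \<omega>)) K"
    by (rule indep_vars_compose2[OF indep_vars_subset[OF indep]]) auto
  hence "prob {\<omega>\<in>space M. (\<Sum>k\<in>K. \<tau> k (X k \<omega>)) < real (card K) / 2} \<le> exp (- real (card K) / (8 * B))"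
  proof (rule lower_tail_nonneg_sum[rotated])
    fix k assume k: "k \<in> K"
    show "expectation (\<lambda>\<omega>. (\<tau> k (X k \<omega>))\<^sup>2) \<le> B"
      by (rule second_moment_le) (use integrable_T_moments(2)[OF k] tau4[of k] k B1 in auto)
  qed (use integrable_tau expectation_tau integrable_T_moments(2)[of _ 2] B1 in \<open>auto intro: tau_nonneg\<close>)
  moreover have "expectation bad = prob {\<omega>\<in>space M. T \<omega> < m / 2}" by (simp add: bad_def)
  ultimately show *: "expectation bad \<le> exp (- m / (8 * B))" by (simp only: T_def m_def)
  have "real n ^ 8 * expectation bad \<le> ((8 * (8 * B)) ^ 8 * exp (real n / (8 * B))) * exp (- m / (8 * B))"
    by (rule mult_mono[OF power8_le_exp *]) (use B1 in \<open>auto simp: bad_def\<close>)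
  also have "\<dots> = (8 * (8 * B)) ^ 8 * exp (real n / (8 * B) + - m / (8 * B))"
    by (simp only: exp_add mult.assoc)
  also have "real n / (8 * B) + - m / (8 * B) = real n\<^sub>0 / (8 * B)"
    by (simp add: m_eq diff_divide_distrib)
  finally show "real n ^ 8 * expectation bad \<le> K8" by (simp add: K8_def)
qed

lemma integrable_bad: "integrable M bad"
  by (rule integrable_const_bound[where B=1]) (auto simp: bad_def indicator_def)

lemma prob_bad_pow:
  assumes "j \<le> 8" shows "real n ^ j * expectation bad \<le> K8"
proof -
  have "real n ^ j * expectation bad \<le> real n ^ 8 * expectation bad"
    using assms n_pos by (intro mult_right_mono power_increasing) (auto simp: bad_def)
  thus ?thesis using prob_bad_poly by linarith
qed

lemma K8_nonneg: "0 \<le> K8" using B1 by (simp add: K8_def)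
lemma V4: "integrable M (\<lambda>\<omega>. (V \<omega>) ^ 4)" "expectation (\<lambda>\<omega>. (V \<omega>) ^ 4) \<le> C4 * (real n)\<^sup>2"
proof -
  have *: "integrable M (\<lambda>\<omega>. (\<Sum>k\<in>K. X k \<omega>) ^ 4) \<and> expectation (\<lambda>\<omega>. (\<Sum>k\<in>K. X k \<omega>) ^ 4) \<le> 3 * (real (card K) * (16 * B))\<^sup>2"
  proof (rule sum_fourth_moment)
    fix k assume k: "k \<in> K"
    show "expectation (\<lambda>\<omega>. (X k \<omega>)\<^sup>2) \<le> 16 * B" using X_facts(4)[of k] k B1 by auto
    show "expectation (\<lambda>\<omega>. (X k \<omega>) ^ 4) \<le> 16 * B" using X4[of k] k B1 by auto
    show "expectation (X k) = 0" using X_facts(2)[of k] k by auto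
    show "integrable M (\<lambda>\<omega>. (X k \<omega>) ^ 4)" using X4[of k] k by auto
  qed (use B1 in \<open>auto intro: indep_vars_subset[OF indep]\<close>)
  show "integrable M (\<lambda>\<omega>. (V \<omega>) ^ 4)" using * by (simp add: V_def)
  have "expectation (\<lambda>\<omega>. (V \<omega>) ^ 4) \<le> 3 * (m * (16 * B))\<^sup>2" using * by (simp add: V_def m_def)
  also have "\<dots> \<le> 3 * (real n * (16 * B))\<^sup>2" using m_le B1 by (intro mult_left_mono power_mono mult_right_mono) auto
  finally show "expectation (\<lambda>\<omega>. (V \<omega>) ^ 4) \<le> C4 * (real n)\<^sup>2" by (simp add: C4_def power_mult_distrib mult_ac)
qed

lemma T4: "integrable M (\<lambda>\<omega>. (T \<omega> - m) ^ 4)" "expectation (\<lambda>\<omega>. (T \<omega> - m) ^ 4) \<le> C4 * (real n)\<^sup>2"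
proof -
  have i4: "integrable M (\<lambda>\<omega>. (\<tau> k (X k \<omega>) - 1) ^ 4)" "expectation (\<lambda>\<omega>. (\<tau> k (X k \<omega>) - 1) ^ 4) \<le> 16 * B" if k: "k \<in> K" for k
  proof -
    have k1: "1 \<le> k" using k by auto
    have bd: "(\<tau> k (X k \<omega>) - 1) ^ 4 \<le> 8 * ((\<tau> k (X k \<omega>)) ^ 4 + 1)" for \<omega>
      using fourth_power_add[of "\<tau> k (X k \<omega>)" "-1"] by simp
    have t4: "integrable M (\<lambda>\<omega>. (\<tau> k (X k \<omega>)) ^ 4)" "expectation (\<lambda>\<omega>. (\<tau> k (X k \<omega>)) ^ 4) \<le> B" using tau4[of k] k by auto
    show i: "integrable M (\<lambda>\<omega>. (\<tau> k (X k \<omega>) - 1) ^ 4)"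
    proof (rule Bochner_Integration.integrable_bound)
      show "integrable M (\<lambda>\<omega>. 8 * ((\<tau> k (X k \<omega>)) ^ 4 + 1))" using t4 by simp
      show "AE \<omega> in M. norm ((\<tau> k (X k \<omega>) - 1) ^ 4) \<le> norm (8 * ((\<tau> k (X k \<omega>)) ^ 4 + 1))"
        using bd by (auto simp: abs_of_nonneg)
    qed (use k1 in measurable)
    have "expectation (\<lambda>\<omega>. (\<tau> k (X k \<omega>) - 1) ^ 4) \<le> expectation (\<lambda>\<omega>. 8 * ((\<tau> k (X k \<omega>)) ^ 4 + 1))"
      by (rule integral_mono[OF i _ bd]) (use t4 in auto)
    also have "\<dots> = 8 * (expectation (\<lambda>\<omega>. (\<tau> k (X k \<omega>)) ^ 4) + 1)" using t4 by (simp add: prob_space)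
    finally show "expectation (\<lambda>\<omega>. (\<tau> k (X k \<omega>) - 1) ^ 4) \<le> 16 * B" using t4 B1 by simp
  qed
  have *: "integrable M (\<lambda>\<omega>. (\<Sum>k\<in>K. \<tau> k (X k \<omega>) - 1) ^ 4) \<and> expectation (\<lambda>\<omega>. (\<Sum>k\<in>K. \<tau> k (X k \<omega>) - 1) ^ 4) \<le> 3 * (real (card K) * (16 * B))\<^sup>2"
  proof (rule sum_fourth_moment)
    show "indep_vars (\<lambda>_. borel) (\<lambda>k \<omega>. \<tau> k (X k \<omega>) - 1) K"
      by (rule indep_vars_compose2[OF indep_vars_subset[OF indep]]) auto
    fix k assume k: "k \<in> K"
    have int: "integrable M (\<lambda>\<omega>. \<tau> k (X k \<omega>))" "integrable M (\<lambda>\<omega>. (\<tau> k (X k \<omega>))\<^sup>2)"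
      using integrable_tau[OF k] integrable_T_moments(2)[OF k, of 2] by auto
    show "expectation (\<lambda>\<omega>. \<tau> k (X k \<omega>) - 1) = 0" using int expectation_tau[OF k] by (simp add: prob_space)
    have "expectation (\<lambda>\<omega>. (\<tau> k (X k \<omega>) - 1)\<^sup>2) = expectation (\<lambda>\<omega>. (\<tau> k (X k \<omega>))\<^sup>2 - 2 * \<tau> k (X k \<omega>) + 1)"
      by (intro Bochner_Integration.integral_cong) (auto simp: power2_eq_square algebra_simps)
    also have "\<dots> = expectation (\<lambda>\<omega>. (\<tau> k (X k \<omega>))\<^sup>2) - 1"
      using int expectation_tau[OF k] by (simp add: prob_space)
    also have "\<dots> \<le> B - 1"
      using second_moment_le[of "\<lambda>\<omega>. \<tau> k (X k \<omega>)" B] integrable_T_moments(2)[OF k] tau4[of k] k B1 by auto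
    finally show "expectation (\<lambda>\<omega>. (\<tau> k (X k \<omega>) - 1)\<^sup>2) \<le> 16 * B" using B1 by simp
  qed (use B1 i4 in auto)
  have eq: "(\<Sum>k\<in>K. \<tau> k (X k \<omega>) - 1) = T \<omega> - m" for \<omega> by (simp add: T_def m_def sum_subtractf)
  show "integrable M (\<lambda>\<omega>. (T \<omega> - m) ^ 4)" using * unfolding eq by simp
  have "expectation (\<lambda>\<omega>. (T \<omega> - m) ^ 4) \<le> 3 * (m * (16 * B))\<^sup>2" using * unfolding eq by (simp add: m_def)
  also have "\<dots> \<le> 3 * (real n * (16 * B))\<^sup>2" using m_le B1 by (intro mult_left_mono power_mono mult_right_mono) auto
  finally show "expectation (\<lambda>\<omega>. (T \<omega> - m) ^ 4) \<le> C4 * (real n)\<^sup>2" by (simp add: C4_def power_mult_distrib mult_ac)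
qed

text \<open>The residual \<open>(G - F) / sqrt n\<close> is \<open>t1 - t2 - t3 + t4\<close>: the fluctuation of \<open>\<sigma> + T\<close> around \<open>n\<close>, the first \<open>n0\<close>
  summands of \<open>F\<close>, the score of \<open>S\<close>, and the term from differentiating \<open>1 / (\<sigma> + T)\<close>.\<close>

definition t1 where "t1 \<omega> = V \<omega> * L \<omega> * (real n - (\<sigma> + T \<omega>)) / real n"
definition t2 where "t2 \<omega> = \<sigma> * S \<omega> / real n"
definition t3 where "t3 \<omega> = \<rho> (S \<omega>) * L \<omega>"
definition t4 where "t4 \<omega> = Q \<omega> * (L \<omega>)\<^sup>2"

lemma L_measurable [measurable]: "L \<in> borel_measurable M"
  unfolding L_def[abs_def] by measurable

lemma t_measurable [measurable]:
  "t1 \<in> borel_measurable M" "t2 \<in> borel_measurable M" "t3 \<in> borel_measurable M" "t4 \<in> borel_measurable M"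
  unfolding t1_def[abs_def] t2_def[abs_def] t3_def[abs_def] t4_def[abs_def] by measurable

lemma residual_eq: "G \<omega> - F \<omega> = sqrt (real n) * (t1 \<omega> - t2 \<omega> - t3 \<omega> + t4 \<omega>)"
proof -
  have \<gamma>: "\<gamma> = sqrt (real n) / real n" using n_pos by (simp add: \<gamma>_def real_div_sqrt field_simps)
  have ne: "\<sigma> + T \<omega> \<noteq> 0" using inv_bounds[of \<omega>] by simp
  have t1: "t1 \<omega> = V \<omega> * L \<omega> - V \<omega> / real n"
    using ne n_pos by (simp add: t1_def L_def field_simps)
  show ?thesis unfolding G_def F_eq \<gamma> t1 t2_def t3_def t4_def L_def
    by (simp add: power_one_over diff_divide_distrib add_divide_distrib algebra_simps)
qed

text \<open>Here \<open>V\<close> and \<open>n - (\<sigma> + T)\<close> are both of order \<open>sqrt n\<close>, and \<open>L\<close> is of order \<open>1 / n\<close>. The weighted inequality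
  \<open>x y \<le> (x\<^sup>2 / n\<^sup>2 + n\<^sup>2 y\<^sup>2) / 2\<close> separates the dependent factors at the cost of fourth moments.\<close>

lemma t1_bound:
  "integrable M (\<lambda>\<omega>. (t1 \<omega>)\<^sup>2)"
  "expectation (\<lambda>\<omega>. (t1 \<omega>)\<^sup>2) \<le> (C4 + 8 * A ^ 4 * (real n\<^sub>0 ^ 4 + C4) + K8) / 2 / (real n)\<^sup>2"
proof -
  let ?n = "real n"
  define W where "W \<omega> = (V \<omega> ^ 4 / ?n\<^sup>2 + (8 * A ^ 4 / ?n\<^sup>2) * (real n\<^sub>0 ^ 4 + (T \<omega> - m) ^ 4) + ?n ^ 6 * bad \<omega>) / 2 / ?n\<^sup>2" for \<omega>
  have Wi: "integrable M W" unfolding W_def[abs_def] using V4(1) T4(1) integrable_bad by simp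
  have pw: "(t1 \<omega>)\<^sup>2 \<le> W \<omega>" if w: "\<omega> \<in> space M" for \<omega>
  proof -
    let ?D = "real n - (\<sigma> + T \<omega>)"
    have am: "x * y \<le> (x\<^sup>2 / ?n\<^sup>2 + ?n\<^sup>2 * y\<^sup>2) / 2" for x y
      using zero_le_power2[of "x / ?n - ?n * y"] n_pos by (simp add: power2_eq_square field_simps)
    have D4: "?D ^ 4 \<le> 8 * (real n\<^sub>0 ^ 4 + (T \<omega> - m) ^ 4)"
    proof -
      have "?D ^ 4 = ((real n\<^sub>0 - \<sigma>) + (m - T \<omega>)) ^ 4" by (rule arg_cong[where f="\<lambda>x. x ^ 4"]) (simp add: m_eq)
      also have "\<dots> \<le> 8 * ((real n\<^sub>0 - \<sigma>) ^ 4 + (m - T \<omega>) ^ 4)" by (rule fourth_power_add)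
      also have "(m - T \<omega>) ^ 4 = (T \<omega> - m) ^ 4" by (simp add: power4_eq_xxxx algebra_simps)
      also have "(real n\<^sub>0 - \<sigma>) ^ 4 \<le> real n\<^sub>0 ^ 4" using sigma_le sigma_ge by (intro power_mono) auto
      finally show ?thesis by simp
    qed
    have key: "?n\<^sup>2 * (?D ^ 4 * L \<omega> ^ 4) \<le> (8 * A ^ 4 / ?n\<^sup>2) * (real n\<^sub>0 ^ 4 + (T \<omega> - m) ^ 4) + ?n ^ 6 * bad \<omega>"
    proof (cases "bad \<omega> = 0")
      case True
      have "L \<omega> ^ 4 \<le> (A / ?n) ^ 4" using L_pow[OF w, of 4] True by simp
      hence "?n\<^sup>2 * (?D ^ 4 * L \<omega> ^ 4) \<le> ?n\<^sup>2 * ((8 * (real n\<^sub>0 ^ 4 + (T \<omega> - m) ^ 4)) * (A / ?n) ^ 4)"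
        using D4 L_bounds[of \<omega>] by (intro mult_left_mono mult_mono) auto
      also have "\<dots> = (8 * A ^ 4 / ?n\<^sup>2) * (real n\<^sub>0 ^ 4 + (T \<omega> - m) ^ 4)"
        using n_pos by (simp add: power_divide field_simps eval_nat_numeral)
      finally show ?thesis using True by simp
    next
      case False
      hence b: "bad \<omega> = 1" using bad_cases by blast
      have "\<bar>?D\<bar> ^ 4 \<le> ?n ^ 4" by (rule power_mono[OF n_eq_of_bad[OF w b]]) simp
      hence "?D ^ 4 \<le> ?n ^ 4" by (simp add: power_even_abs)
      moreover have "L \<omega> ^ 4 \<le> 1" using L_bounds by (intro power_le_one)
      ultimately have "?n\<^sup>2 * (?D ^ 4 * L \<omega> ^ 4) \<le> ?n\<^sup>2 * (?n ^ 4 * 1)"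
        using L_bounds[of \<omega>] by (intro mult_left_mono mult_mono) auto
      moreover have "?n\<^sup>2 * ?n ^ 4 = ?n ^ 6" by (simp flip: power_add)
      moreover have "0 \<le> (8 * A ^ 4 / ?n\<^sup>2) * (real n\<^sub>0 ^ 4 + (T \<omega> - m) ^ 4)" using A_nonneg by simp
      ultimately show ?thesis unfolding b mult_1_right by linarith
    qed
    have "(t1 \<omega>)\<^sup>2 = ((V \<omega>)\<^sup>2 * (?D * L \<omega>)\<^sup>2) / ?n\<^sup>2"
      by (simp add: t1_def power_mult_distrib power_divide mult_ac)
    also have "\<dots> \<le> ((((V \<omega>)\<^sup>2)\<^sup>2 / ?n\<^sup>2 + ?n\<^sup>2 * ((?D * L \<omega>)\<^sup>2)\<^sup>2) / 2) / ?n\<^sup>2"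
      by (rule divide_right_mono[OF am]) simp
    also have "\<dots> = (V \<omega> ^ 4 / ?n\<^sup>2 + ?n\<^sup>2 * (?D ^ 4 * L \<omega> ^ 4)) / 2 / ?n\<^sup>2"
      by (simp add: power_mult_distrib)
    also have "\<dots> \<le> W \<omega>"
      unfolding W_def by (intro divide_right_mono) (use key in auto)
    finally show ?thesis .
  qed
  note bm = bound_by_majorant[OF _ Wi, of "\<lambda>\<omega>. (t1 \<omega>)\<^sup>2", OF _ _ pw]
  show "integrable M (\<lambda>\<omega>. (t1 \<omega>)\<^sup>2)" by (rule bm) auto
  have "expectation (\<lambda>\<omega>. (t1 \<omega>)\<^sup>2) \<le> expectation W" by (rule bm) auto
  also have "expectation W = (expectation (\<lambda>\<omega>. V \<omega> ^ 4) / ?n\<^sup>2 + (8 * A ^ 4 / ?n\<^sup>2) * (real n\<^sub>0 ^ 4 + expectation (\<lambda>\<omega>. (T \<omega> - m) ^ 4)) + ?n ^ 6 * expectation bad) / 2 / ?n\<^sup>2"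
    unfolding W_def[abs_def] using V4(1) T4(1) integrable_bad by (simp add: prob_space)
  also have "\<dots> \<le> (C4 + 8 * A ^ 4 * (real n\<^sub>0 ^ 4 + C4) + K8) / 2 / ?n\<^sup>2"
  proof (intro divide_right_mono add_mono)
    have n1: "1 \<le> ?n" using n_pos by simp
    show "expectation (\<lambda>\<omega>. V \<omega> ^ 4) / ?n\<^sup>2 \<le> C4" using V4(2) n_pos by (simp add: field_simps)
    show "?n ^ 6 * expectation bad \<le> K8" by (rule prob_bad_pow) simp
    have "real n\<^sub>0 ^ 4 + expectation (\<lambda>\<omega>. (T \<omega> - m) ^ 4) \<le> real n\<^sub>0 ^ 4 * ?n\<^sup>2 + C4 * ?n\<^sup>2"
      using T4(2) n1 by (intro add_mono) (auto simp: mult_le_cancel_left1)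
    hence "(8 * A ^ 4 / ?n\<^sup>2) * (real n\<^sub>0 ^ 4 + expectation (\<lambda>\<omega>. (T \<omega> - m) ^ 4)) \<le> (8 * A ^ 4 / ?n\<^sup>2) * ((real n\<^sub>0 ^ 4 + C4) * ?n\<^sup>2)"
      using A_nonneg by (intro mult_left_mono) (auto simp: distrib_right)
    also have "\<dots> = 8 * A ^ 4 * (real n\<^sub>0 ^ 4 + C4)" using n_pos by simp
    finally show "(8 * A ^ 4 / ?n\<^sup>2) * (real n\<^sub>0 ^ 4 + expectation (\<lambda>\<omega>. (T \<omega> - m) ^ 4)) \<le> 8 * A ^ 4 * (real n\<^sub>0 ^ 4 + C4)" .
  qed auto
  finally show "expectation (\<lambda>\<omega>. (t1 \<omega>)\<^sup>2) \<le> (C4 + 8 * A ^ 4 * (real n\<^sub>0 ^ 4 + C4) + K8) / 2 / ?n\<^sup>2" .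
qed

lemma t2_bound: "integrable M (\<lambda>\<omega>. (t2 \<omega>)\<^sup>2)" "expectation (\<lambda>\<omega>. (t2 \<omega>)\<^sup>2) \<le> real n\<^sub>0 / (real n)\<^sup>2"
proof -
  have *: "integrable M (\<lambda>\<omega>. (\<Sum>k\<in>{1..n\<^sub>0}. X k \<omega>)\<^sup>2) \<and> expectation (\<lambda>\<omega>. (\<Sum>k\<in>{1..n\<^sub>0}. X k \<omega>)\<^sup>2) \<le> real (card {1..n\<^sub>0}) * 1"
    by (rule sum_second_moment) (use X_facts in \<open>auto intro: indep_vars_subset[OF indep]\<close>)
  have eq: "(t2 \<omega>)\<^sup>2 = (\<Sum>k\<in>{1..n\<^sub>0}. X k \<omega>)\<^sup>2 / (real n)\<^sup>2" for \<omega>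
    using n0 by (simp add: t2_def norm_sum_def \<sigma>_def power_divide)
  show "integrable M (\<lambda>\<omega>. (t2 \<omega>)\<^sup>2)" unfolding eq using * by simp
  have "expectation (\<lambda>\<omega>. (t2 \<omega>)\<^sup>2) = expectation (\<lambda>\<omega>. (\<Sum>k\<in>{1..n\<^sub>0}. X k \<omega>)\<^sup>2) / (real n)\<^sup>2" unfolding eq by simp
  also have "\<dots> \<le> real n\<^sub>0 / (real n)\<^sup>2" using * by (intro divide_right_mono) auto
  finally show "expectation (\<lambda>\<omega>. (t2 \<omega>)\<^sup>2) \<le> real n\<^sub>0 / (real n)\<^sup>2" .
qed

text \<open>The score of \<open>S\<close> is only square integrable, so a product estimate is out of reach; but \<open>T\<close> does
  not involve the first \<open>n0\<close> variables.\<close>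

lemma score_bad:
  "integrable M (\<lambda>\<omega>. (\<rho> (S \<omega>))\<^sup>2 * bad \<omega>)"
  "expectation (\<lambda>\<omega>. (\<rho> (S \<omega>))\<^sup>2 * bad \<omega>) = expectation (\<lambda>\<omega>. (\<rho> (S \<omega>))\<^sup>2) * expectation bad"
proof -
  define y where "y x = (\<rho> ((\<Sum>j\<in>{1..n\<^sub>0}. x j) / sqrt (real n\<^sub>0)))\<^sup>2" for x :: "nat \<Rightarrow> real"
  define c where "c z = (if (\<Sum>j\<in>K. \<tau> j (z j)) < m / 2 then 1 else 0 :: real)" for z :: "nat \<Rightarrow> real"
  have ym: "y \<in> borel_measurable (PiM {1..n\<^sub>0} (\<lambda>_. borel))" unfolding y_def[abs_def] by measurable
  have "(\<lambda>z. \<tau> j (z j)) \<in> borel_measurable (PiM K (\<lambda>_. borel))" if "j \<in> K" for j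
  proof (rule measurable_compose[where g="\<tau> j" and N=borel])
    show "(\<lambda>z. z j) \<in> PiM K (\<lambda>_. borel) \<rightarrow>\<^sub>M borel"
      by (rule measurable_component_singleton) (use that in auto)
  qed (use that in auto)
  hence [measurable]: "(\<lambda>z. \<Sum>j\<in>K. \<tau> j (z j)) \<in> borel_measurable (PiM K (\<lambda>_. borel))" by (intro borel_measurable_sum)
  have cm: "c \<in> borel_measurable (PiM K (\<lambda>_. borel))" unfolding c_def[abs_def]
    by (rule measurable_If) auto
  have "indep_var (PiM {1..n\<^sub>0} (\<lambda>_. borel)) (\<lambda>\<omega>. restrict (\<lambda>i. X i \<omega>) {1..n\<^sub>0}) (PiM K (\<lambda>_. borel)) (\<lambda>\<omega>. restrict (\<lambda>i. X i \<omega>) K)"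
    by (rule indep_var_restrict[OF indep]) auto
  from indep_var_compose[OF this ym cm]
  have ind: "indep_var borel (\<lambda>\<omega>. (\<rho> (S \<omega>))\<^sup>2) borel (\<lambda>\<omega>. if T \<omega> < m / 2 then 1 else 0 :: real)"
    by (simp add: y_def c_def comp_def norm_sum_def[abs_def] T_def)
  have b: "AE \<omega> in M. (if T \<omega> < m / 2 then 1 else 0 :: real) = bad \<omega>" by (auto simp: bad_def indicator_def)
  have bi: "integrable M (\<lambda>\<omega>. if T \<omega> < m / 2 then 1 else 0 :: real)"
    by (rule integrable_const_bound[where B=1]) auto
  have cong: "\<omega> \<in> space M \<Longrightarrow> (if T \<omega> < m / 2 then 1 else 0 :: real) = bad \<omega>" for \<omega> by (auto simp: bad_def indicator_def)
  have "integrable M (\<lambda>\<omega>. (\<rho> (S \<omega>))\<^sup>2 * (if T \<omega> < m / 2 then 1 else 0))"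
    by (rule indep_var_integrable[OF ind integrable_rho_sq bi])
  thus "integrable M (\<lambda>\<omega>. (\<rho> (S \<omega>))\<^sup>2 * bad \<omega>)"
    by (subst Bochner_Integration.integrable_cong[OF refl, where g="\<lambda>\<omega>. (\<rho> (S \<omega>))\<^sup>2 * (if T \<omega> < m / 2 then 1 else 0)"]) (simp_all only: cong)
  have "expectation (\<lambda>\<omega>. (\<rho> (S \<omega>))\<^sup>2 * (if T \<omega> < m / 2 then 1 else 0)) = expectation (\<lambda>\<omega>. (\<rho> (S \<omega>))\<^sup>2) * expectation (\<lambda>\<omega>. if T \<omega> < m / 2 then 1 else 0)"
    by (rule indep_var_lebesgue_integral[OF ind integrable_rho_sq bi])
  moreover have "expectation (\<lambda>\<omega>. (\<rho> (S \<omega>))\<^sup>2 * (if T \<omega> < m / 2 then 1 else 0)) = expectation (\<lambda>\<omega>. (\<rho> (S \<omega>))\<^sup>2 * bad \<omega>)"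
    by (rule Bochner_Integration.integral_cong) (simp_all only: cong)
  moreover have "expectation (\<lambda>\<omega>. if T \<omega> < m / 2 then 1 else 0) = expectation bad"
    by (rule Bochner_Integration.integral_cong) (simp_all only: cong)
  ultimately show "expectation (\<lambda>\<omega>. (\<rho> (S \<omega>))\<^sup>2 * bad \<omega>) = expectation (\<lambda>\<omega>. (\<rho> (S \<omega>))\<^sup>2) * expectation bad" by simp
qed

lemma t3_bound:
  "integrable M (\<lambda>\<omega>. (t3 \<omega>)\<^sup>2)"
  "expectation (\<lambda>\<omega>. (t3 \<omega>)\<^sup>2) \<le> expectation (\<lambda>\<omega>. (\<rho> (S \<omega>))\<^sup>2) * (A\<^sup>2 + K8) / (real n)\<^sup>2"
proof -
  let ?n = "real n"
  define W where "W \<omega> = (A / ?n)\<^sup>2 * (\<rho> (S \<omega>))\<^sup>2 + (\<rho> (S \<omega>))\<^sup>2 * bad \<omega>" for \<omega>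
  have Wi: "integrable M W" unfolding W_def[abs_def] using score_bad(1) integrable_rho_sq by simp
  have pw: "(t3 \<omega>)\<^sup>2 \<le> W \<omega>" if w: "\<omega> \<in> space M" for \<omega>
    using mult_left_mono[OF L_pow[OF w, of 2], of "(\<rho> (S \<omega>))\<^sup>2"]
    by (simp add: t3_def W_def power_mult_distrib distrib_left mult_ac)
  note bm = bound_by_majorant[OF _ Wi, of "\<lambda>\<omega>. (t3 \<omega>)\<^sup>2", OF _ _ pw]
  show "integrable M (\<lambda>\<omega>. (t3 \<omega>)\<^sup>2)" by (rule bm) auto
  have "expectation (\<lambda>\<omega>. (t3 \<omega>)\<^sup>2) \<le> expectation W" by (rule bm) auto
  also have "\<dots> = expectation (\<lambda>\<omega>. (\<rho> (S \<omega>))\<^sup>2) * ((A / ?n)\<^sup>2 + expectation bad)"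
    unfolding W_def[abs_def] using score_bad integrable_rho_sq by (simp add: algebra_simps)
  also have "\<dots> \<le> expectation (\<lambda>\<omega>. (\<rho> (S \<omega>))\<^sup>2) * (A\<^sup>2 / ?n\<^sup>2 + K8 / ?n\<^sup>2)"
  proof (intro mult_left_mono add_mono)
    show "expectation bad \<le> K8 / ?n\<^sup>2" using prob_bad_pow[of 2] n_pos by (simp add: field_simps)
  qed (auto simp: power_divide)
  finally show "expectation (\<lambda>\<omega>. (t3 \<omega>)\<^sup>2) \<le> expectation (\<lambda>\<omega>. (\<rho> (S \<omega>))\<^sup>2) * (A\<^sup>2 + K8) / ?n\<^sup>2"
    by (simp add: add_divide_distrib distrib_left)
qed

text \<open>A sum of at most \<open>n\<close> terms of order \<open>1\<close> against \<open>L\<^sup>2\<close>. On the bad event the bound \<open>\<tau>_k L\<^sup>2 \<le> 1\<close> reduces the sum to that of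
  the \<open>|\<tau>_k'|\<close>.\<close>

lemma t4_bound:
  "integrable M (\<lambda>\<omega>. (t4 \<omega>)\<^sup>2)"
  "expectation (\<lambda>\<omega>. (t4 \<omega>)\<^sup>2) \<le> (A ^ 4 * B + (B + K8) / 2) / (real n)\<^sup>2"
proof -
  let ?n = "real n"
  let ?t = "\<lambda>k \<omega>. \<tau> k (X k \<omega>)" and ?d = "\<lambda>k \<omega>. \<delta> k (X k \<omega>)"
  define W1 where "W1 k \<omega> = (A / ?n) ^ 4 * ?n * ((?t k \<omega> ^ 4 + ?d k \<omega> ^ 4) / 2)" for k \<omega>
  define W2 where "W2 k \<omega> = ?n * ((?d k \<omega> ^ 4 / ?n ^ 4 + ?n ^ 4 * bad \<omega>) / 2)" for k \<omega>
  define W where "W \<omega> = (\<Sum>k\<in>K. W1 k \<omega> + W2 k \<omega>)" for \<omega>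
  have mom: "integrable M (\<lambda>\<omega>. ?t k \<omega> ^ 4)" "expectation (\<lambda>\<omega>. ?t k \<omega> ^ 4) \<le> B"
    "integrable M (\<lambda>\<omega>. ?d k \<omega> ^ 4)" "expectation (\<lambda>\<omega>. ?d k \<omega> ^ 4) \<le> B" if "k \<in> K" for k
    using tau4[of k] delta4[of k] that by auto
  have W12: "integrable M (W1 k)" "integrable M (W2 k)" if "k \<in> K" for k
    unfolding W1_def[abs_def] W2_def[abs_def] using mom[OF that] integrable_bad by auto
  have Wi: "integrable M W" unfolding W_def[abs_def] using W12 by auto
  have cardK: "real (card K) \<le> ?n" using m_le by (simp add: m_def)
  have cs: "(\<Sum>k\<in>K. f k)\<^sup>2 \<le> ?n * (\<Sum>k\<in>K. (f k)\<^sup>2)" for f :: "nat \<Rightarrow> real"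
  proof -
    have "(\<Sum>k\<in>K. f k)\<^sup>2 \<le> real (card K) * (\<Sum>k\<in>K. (f k)\<^sup>2)"
      using sum_squared_le_sum_of_squares[of f K] by (simp add: mult.commute)
    also have "\<dots> \<le> ?n * (\<Sum>k\<in>K. (f k)\<^sup>2)" by (rule mult_right_mono[OF cardK]) (auto intro: sum_nonneg)
    finally show ?thesis .
  qed
  have pw: "(t4 \<omega>)\<^sup>2 \<le> W \<omega>" if w: "\<omega> \<in> space M" for \<omega>
  proof (cases "bad \<omega> = 0")
    case True
    have "(t4 \<omega>)\<^sup>2 = (Q \<omega>)\<^sup>2 * L \<omega> ^ 4" by (simp add: t4_def power_mult_distrib)
    also have "\<dots> \<le> (?n * (\<Sum>k\<in>K. (?t k \<omega> * ?d k \<omega>)\<^sup>2)) * (A / ?n) ^ 4"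
      using L_pow[OF w, of 4] True cs[of "\<lambda>k. ?t k \<omega> * ?d k \<omega>"] L_bounds[of \<omega>]
      by (intro mult_mono) (auto simp: Q_def intro!: mult_nonneg_nonneg sum_nonneg)
    also have "\<dots> \<le> (?n * (\<Sum>k\<in>K. (?t k \<omega> ^ 4 + ?d k \<omega> ^ 4) / 2)) * (A / ?n) ^ 4"
    proof (intro mult_right_mono mult_left_mono sum_mono)
      show "(x * y)\<^sup>2 \<le> (x ^ 4 + y ^ 4) / 2" for x y :: real
        using zero_le_power2[of "x\<^sup>2 - y\<^sup>2"] by (simp add: power2_eq_square power4_eq_xxxx algebra_simps)
    qed (use A_nonneg in auto)
    also have "\<dots> = (\<Sum>k\<in>K. W1 k \<omega>)" by (simp add: W1_def sum_distrib_left sum_distrib_right mult_ac)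
    also have "\<dots> \<le> W \<omega>" unfolding W_def by (rule sum_mono) (auto simp: W2_def True)
    finally show ?thesis .
  next
    case False
    hence b: "bad \<omega> = 1" using bad_cases by blast
    have "\<bar>t4 \<omega>\<bar> = \<bar>\<Sum>k\<in>K. (?t k \<omega> / (\<sigma> + T \<omega>)\<^sup>2) * ?d k \<omega>\<bar>"
      by (simp add: t4_def Q_def L_def power_one_over sum_divide_distrib sum_distrib_right)
    also have "\<dots> \<le> (\<Sum>k\<in>K. \<bar>(?t k \<omega> / (\<sigma> + T \<omega>)\<^sup>2) * ?d k \<omega>\<bar>)" by (rule sum_abs)
    also have "\<dots> \<le> (\<Sum>k\<in>K. \<bar>?d k \<omega>\<bar>)"
    proof (rule sum_mono)
      fix k assume k: "k \<in> K"
      have "0 \<le> ?t k \<omega>" using k by (auto intro: tau_nonneg)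
      note tb = ratio_bounds[OF this tau_le_denominator[OF k] inv_bounds(2)]
      have "\<bar>(?t k \<omega> / (\<sigma> + T \<omega>)\<^sup>2) * ?d k \<omega>\<bar> = (?t k \<omega> / (\<sigma> + T \<omega>)\<^sup>2) * \<bar>?d k \<omega>\<bar>"
        using tb(3) by (simp only: abs_mult abs_of_nonneg)
      also have "\<dots> \<le> 1 * \<bar>?d k \<omega>\<bar>" by (rule mult_right_mono[OF tb(4)]) simp
      finally show "\<bar>(?t k \<omega> / (\<sigma> + T \<omega>)\<^sup>2) * ?d k \<omega>\<bar> \<le> \<bar>?d k \<omega>\<bar>" by simp
    qed
    finally have "\<bar>t4 \<omega>\<bar>\<^sup>2 \<le> (\<Sum>k\<in>K. \<bar>?d k \<omega>\<bar>)\<^sup>2" by (rule power_mono) simp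
    also have "\<dots> \<le> ?n * (\<Sum>k\<in>K. \<bar>?d k \<omega>\<bar>\<^sup>2)" by (rule cs)
    also have "\<dots> \<le> ?n * (\<Sum>k\<in>K. (?d k \<omega> ^ 4 / ?n ^ 4 + ?n ^ 4 * bad \<omega>) / 2)"
    proof (intro mult_left_mono sum_mono)
      show "\<bar>y\<bar>\<^sup>2 \<le> (y ^ 4 / ?n ^ 4 + ?n ^ 4 * bad \<omega>) / 2" for y
      proof -
        have "2 * (y\<^sup>2 / ?n\<^sup>2) * ?n\<^sup>2 \<le> (y\<^sup>2 / ?n\<^sup>2)\<^sup>2 + (?n\<^sup>2)\<^sup>2" by (rule sum_squares_bound)
        moreover have "2 * (y\<^sup>2 / ?n\<^sup>2) * ?n\<^sup>2 = 2 * \<bar>y\<bar>\<^sup>2" using n_pos by simp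
        moreover have "(y\<^sup>2 / ?n\<^sup>2)\<^sup>2 + (?n\<^sup>2)\<^sup>2 = y ^ 4 / ?n ^ 4 + ?n ^ 4 * bad \<omega>" using b by (simp add: power_divide)
        ultimately have "2 * \<bar>y\<bar>\<^sup>2 \<le> y ^ 4 / ?n ^ 4 + ?n ^ 4 * bad \<omega>" by (simp only:)
        thus ?thesis by simp
      qed
    qed simp
    also have "\<dots> = (\<Sum>k\<in>K. W2 k \<omega>)" by (simp add: W2_def sum_distrib_left)
    also have "\<dots> \<le> W \<omega>" unfolding W_def by (rule sum_mono) (use A_nonneg in \<open>auto simp: W1_def\<close>)
    finally show ?thesis by simp
  qed
  note bm = bound_by_majorant[OF _ Wi, of "\<lambda>\<omega>. (t4 \<omega>)\<^sup>2", OF _ _ pw]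
  show "integrable M (\<lambda>\<omega>. (t4 \<omega>)\<^sup>2)" by (rule bm) auto
  have "expectation (\<lambda>\<omega>. (t4 \<omega>)\<^sup>2) \<le> expectation W" by (rule bm) auto
  also have "expectation W = (\<Sum>k\<in>K. expectation (W1 k) + expectation (W2 k))"
    unfolding W_def[abs_def] using W12 by (simp add: Bochner_Integration.integral_sum)
  also have "\<dots> \<le> (\<Sum>k\<in>K. (A ^ 4 * B + (B + K8) / 2) / ?n ^ 3)"
  proof (rule sum_mono)
    fix k assume k: "k \<in> K"
    have "expectation (W1 k) = (A / ?n) ^ 4 * ?n * ((expectation (\<lambda>\<omega>. ?t k \<omega> ^ 4) + expectation (\<lambda>\<omega>. ?d k \<omega> ^ 4)) / 2)"
      unfolding W1_def[abs_def] using mom[OF k] by simp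
    also have "\<dots> \<le> (A / ?n) ^ 4 * ?n * B" using mom[OF k] A_nonneg by (intro mult_left_mono) auto
    also have "\<dots> = A ^ 4 * B / ?n ^ 3" using n_pos by (simp add: power_divide field_simps eval_nat_numeral)
    finally have 1: "expectation (W1 k) \<le> A ^ 4 * B / ?n ^ 3" .
    have "expectation (W2 k) = ?n * ((expectation (\<lambda>\<omega>. ?d k \<omega> ^ 4) / ?n ^ 4 + ?n ^ 4 * expectation bad) / 2)"
      unfolding W2_def[abs_def] using mom[OF k] integrable_bad by simp
    also have "\<dots> \<le> ?n * ((B / ?n ^ 4 + K8 / ?n ^ 4) / 2)"
    proof (intro mult_left_mono divide_right_mono add_mono)
      have "?n ^ 4 * (?n ^ 4 * expectation bad) \<le> K8" using prob_bad_pow[of 8] by (simp add: mult.assoc[symmetric] flip: power_add)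
      thus "?n ^ 4 * expectation bad \<le> K8 / ?n ^ 4" using n_pos by (simp add: pos_le_divide_eq mult.commute)
    qed (use mom[OF k] in auto)
    also have "\<dots> = (B + K8) / 2 / ?n ^ 3" using n_pos by (simp add: field_simps eval_nat_numeral)
    finally have 2: "expectation (W2 k) \<le> (B + K8) / 2 / ?n ^ 3" .
    show "expectation (W1 k) + expectation (W2 k) \<le> (A ^ 4 * B + (B + K8) / 2) / ?n ^ 3"
      using add_mono[OF 1 2] by (simp add: add_divide_distrib)
  qed
  also have "\<dots> = real (card K) * ((A ^ 4 * B + (B + K8) / 2) / ?n ^ 3)" by simp
  also have "\<dots> \<le> ?n * ((A ^ 4 * B + (B + K8) / 2) / ?n ^ 3)"
    by (rule mult_right_mono[OF cardK]) (use A_nonneg B1 K8_nonneg in auto)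
  also have "\<dots> = (A ^ 4 * B + (B + K8) / 2) / ?n\<^sup>2" using n_pos by (simp add: field_simps eval_nat_numeral)
  finally show "expectation (\<lambda>\<omega>. (t4 \<omega>)\<^sup>2) \<le> (A ^ 4 * B + (B + K8) / 2) / ?n\<^sup>2" .
qed

definition rate :: real where
  "rate = 4 * ((C4 + 8 * A ^ 4 * (real n\<^sub>0 ^ 4 + C4) + K8) / 2 + real n\<^sub>0
     + expectation (\<lambda>\<omega>. (\<rho> (S \<omega>))\<^sup>2) * (A\<^sup>2 + K8) + (A ^ 4 * B + (B + K8) / 2))"

lemma residual_bound:
  "integrable M (\<lambda>\<omega>. (G \<omega> - F \<omega>)\<^sup>2)" "expectation (\<lambda>\<omega>. (G \<omega> - F \<omega>)\<^sup>2) \<le> rate / real n"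
proof -
  let ?n = "real n"
  define W where "W \<omega> = 4 * ?n * ((t1 \<omega>)\<^sup>2 + (t2 \<omega>)\<^sup>2 + (t3 \<omega>)\<^sup>2 + (t4 \<omega>)\<^sup>2)" for \<omega>
  note ti = t1_bound(1) t2_bound(1) t3_bound(1) t4_bound(1)
  have Wi: "integrable M W" unfolding W_def[abs_def] using ti by simp
  have pw: "(G \<omega> - F \<omega>)\<^sup>2 \<le> W \<omega>" for \<omega>
  proof -
    have "(G \<omega> - F \<omega>)\<^sup>2 = ?n * (t1 \<omega> - t2 \<omega> - t3 \<omega> + t4 \<omega>)\<^sup>2" by (simp add: residual_eq power_mult_distrib)
    also have "\<dots> \<le> ?n * (4 * ((t1 \<omega>)\<^sup>2 + (t2 \<omega>)\<^sup>2 + (t3 \<omega>)\<^sup>2 + (t4 \<omega>)\<^sup>2))"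
      by (rule mult_left_mono[OF square_sum4]) simp
    finally show ?thesis by (simp only: W_def mult_ac)
  qed
  note bm = bound_by_majorant[OF _ Wi, of "\<lambda>\<omega>. (G \<omega> - F \<omega>)\<^sup>2", OF _ _ pw]
  show "integrable M (\<lambda>\<omega>. (G \<omega> - F \<omega>)\<^sup>2)" by (rule bm) auto
  have "expectation (\<lambda>\<omega>. (G \<omega> - F \<omega>)\<^sup>2) \<le> expectation W" by (rule bm) auto
  also have "\<dots> = 4 * ?n * (expectation (\<lambda>\<omega>. (t1 \<omega>)\<^sup>2) + expectation (\<lambda>\<omega>. (t2 \<omega>)\<^sup>2) + expectation (\<lambda>\<omega>. (t3 \<omega>)\<^sup>2) + expectation (\<lambda>\<omega>. (t4 \<omega>)\<^sup>2))"
    unfolding W_def[abs_def] using ti by simp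
  also have "\<dots> \<le> 4 * ?n * ((C4 + 8 * A ^ 4 * (real n\<^sub>0 ^ 4 + C4) + K8) / 2 / ?n\<^sup>2 + real n\<^sub>0 / ?n\<^sup>2
      + expectation (\<lambda>\<omega>. (\<rho> (S \<omega>))\<^sup>2) * (A\<^sup>2 + K8) / ?n\<^sup>2 + (A ^ 4 * B + (B + K8) / 2) / ?n\<^sup>2)"
    using t1_bound(2) t2_bound(2) t3_bound(2) t4_bound(2) by (intro mult_left_mono add_mono) auto
  also have "\<dots> = 4 * ?n * ((rate / 4) / ?n\<^sup>2)" by (simp add: rate_def add_divide_distrib)
  also have "\<dots> = rate / ?n" using n_pos by (simp add: power2_eq_square)
  finally show "expectation (\<lambda>\<omega>. (G \<omega> - F \<omega>)\<^sup>2) \<le> rate / ?n" .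
qed

lemma fisher_distance_le_rate: "fisher_distance M F \<le> ennreal (rate / real n)"
proof -
  have "integrable M (\<lambda>\<omega>. \<Sum>k=1..n. X k \<omega>)"
    by (rule Bochner_Integration.integrable_sum) (auto intro: X_facts)
  hence Fi: "integrable M F" by (simp add: norm_sum_def[abs_def])
  have "integrable M (\<lambda>\<omega>. G \<omega> - F \<omega>)"
    by (rule square_integrable_imp_integrable[OF _ residual_bound(1)]) simp
  from Bochner_Integration.integrable_add[OF this Fi] have Gi: "integrable M G" by simp
  have "fisher_distance M F \<le> ennreal (expectation (\<lambda>\<omega>. (G \<omega> - F \<omega>)\<^sup>2))"
    by (rule fisher_distance_le_score_residual[OF Fi Gi residual_bound(1) integration_by_parts])
  also have "\<dots> \<le> ennreal (rate / real n)" by (rule ennreal_leI[OF residual_bound(2)])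
  finally show ?thesis .
qed

end

section \<open>The rate with its constant\<close>

lemma abs_moment_finite_imp:
  assumes "prob_space M" "Y \<in> borel_measurable M" "abs_moment M r Y \<le> ennreal b" "0 \<le> b" "4 \<le> r"
  shows "integrable M (\<lambda>\<omega>. (Y \<omega>) ^ 4)" "integral\<^sup>L M (\<lambda>\<omega>. (Y \<omega>) ^ 4) \<le> 1 + b"
proof -
  interpret prob_space M by fact
  note [measurable] = assms(2)
  have i: "integrable M (\<lambda>\<omega>. \<bar>Y \<omega>\<bar> ^ r)"
    by (rule integrableI_bounded) (use assms(3) in \<open>auto simp: abs_moment_def intro: le_less_trans\<close>)
  have "ennreal (expectation (\<lambda>\<omega>. \<bar>Y \<omega>\<bar> ^ r)) = abs_moment M r Y"
    unfolding abs_moment_def by (rule nn_integral_eq_integral[OF i, symmetric]) simp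
  hence b: "expectation (\<lambda>\<omega>. \<bar>Y \<omega>\<bar> ^ r) \<le> b" using assms(3,4) by (metis ennreal_le_iff)
  have pw: "(Y \<omega>) ^ 4 \<le> 1 + \<bar>Y \<omega>\<bar> ^ r" for \<omega>
  proof -
    have "\<bar>Y \<omega>\<bar> ^ 4 \<le> 1 + \<bar>Y \<omega>\<bar> ^ r"
    proof (cases "\<bar>Y \<omega>\<bar> \<le> 1")
      case True
      hence "\<bar>Y \<omega>\<bar> ^ 4 \<le> 1" by (intro power_le_one) auto
      thus ?thesis by (smt (verit) abs_ge_zero zero_le_power)
    next
      case False
      thus ?thesis using power_increasing[OF assms(5), of "\<bar>Y \<omega>\<bar>"] by simp
    qed
    thus ?thesis by (simp add: power_even_abs)
  qed
  show i4: "integrable M (\<lambda>\<omega>. (Y \<omega>) ^ 4)"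
  proof (rule Bochner_Integration.integrable_bound)
    show "integrable M (\<lambda>\<omega>. 1 + \<bar>Y \<omega>\<bar> ^ r)" using i by simp
    show "AE \<omega> in M. norm (Y \<omega> ^ 4) \<le> norm (1 + \<bar>Y \<omega>\<bar> ^ r)"
      using pw by (auto simp: abs_of_nonneg)
  qed measurable
  have "expectation (\<lambda>\<omega>. (Y \<omega>) ^ 4) \<le> expectation (\<lambda>\<omega>. 1 + \<bar>Y \<omega>\<bar> ^ r)"
    by (rule integral_mono[OF i4 _ pw]) (use i in simp)
  also have "\<dots> \<le> 1 + b" using i b by (simp add: prob_space)
  finally show "expectation (\<lambda>\<omega>. (Y \<omega>) ^ 4) \<le> 1 + b" .
qed

text \<open>The expression \<open>rate\<close> with the mean square of the score of \<open>S_{n0}\<close> replaced by a parameter \<open>I\<close>, so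
  that it no longer refers to the probability space.\<close>

definition fisher_rate :: "nat \<Rightarrow> real \<Rightarrow> real \<Rightarrow> real" where
  "fisher_rate n\<^sub>0 B I =
     (let A = 2 * real n\<^sub>0; K8 = (8 * (8 * B)) ^ 8 * exp (real n\<^sub>0 / (8 * B)); C4 = 3 * (16 * B)\<^sup>2 in
      4 * ((C4 + 8 * A ^ 4 * (real n\<^sub>0 ^ 4 + C4) + K8) / 2 + real n\<^sub>0
        + I * (A\<^sup>2 + K8) + (A ^ 4 * B + (B + K8) / 2)))"

lemma fisher_rate_mono:
  assumes "0 \<le> B" "I \<le> I'"
  shows "fisher_rate n\<^sub>0 B I \<le> fisher_rate n\<^sub>0 B I'"
proof -
  define A where "A = 2 * real n\<^sub>0"
  define K8 where "K8 = (8 * (8 * B)) ^ 8 * exp (real n\<^sub>0 / (8 * B))"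
  have "0 \<le> K8" using assms by (simp add: K8_def)
  hence "I * (A\<^sup>2 + K8) \<le> I' * (A\<^sup>2 + K8)" using assms by (intro mult_right_mono) auto
  thus ?thesis unfolding fisher_rate_def Let_def A_def[symmetric] K8_def[symmetric] by simp
qed

lemma fisher_rate_pos:
  assumes "1 \<le> B" "0 \<le> I"
  shows "0 < fisher_rate n\<^sub>0 B I"
proof -
  define A where "A = 2 * real n\<^sub>0"
  define K8 where "K8 = (8 * (8 * B)) ^ 8 * exp (real n\<^sub>0 / (8 * B))"
  define C4 where "C4 = 3 * (16 * B)\<^sup>2"
  have pos: "0 \<le> A" "0 \<le> K8" "0 \<le> C4" using assms by (auto simp: A_def K8_def C4_def)
  have "0 \<le> 8 * A ^ 4 * (real n\<^sub>0 ^ 4 + C4)" "0 \<le> I * (A\<^sup>2 + K8)" "0 \<le> A ^ 4 * B"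
    using pos assms by simp_all
  note nonneg = this
  have gen: "0 < 4 * ((c + u + k) / 2 + real n\<^sub>0 + v + (w + (B + k) / 2))"
    if "0 \<le> u" "0 \<le> v" "0 \<le> w" "0 \<le> c" "0 \<le> k" for c u k v w :: real
  proof -
    have "0 \<le> (c + u + k) / 2" "0 < (B + k) / 2" using that assms(1) by simp_all
    hence "0 < (c + u + k) / 2 + real n\<^sub>0 + v + (w + (B + k) / 2)"
      using that by (intro add_nonneg_pos[OF add_nonneg_nonneg[OF add_nonneg_nonneg] add_nonneg_pos]) auto
    thus ?thesis by (rule mult_pos_pos[rotated]) simp
  qed
  have "0 < 4 * ((C4 + 8 * A ^ 4 * (real n\<^sub>0 ^ 4 + C4) + K8) / 2 + real n\<^sub>0
        + I * (A\<^sup>2 + K8) + (A ^ 4 * B + (B + K8) / 2))"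
    by (rule gen[OF nonneg pos(3,2)])
  thus ?thesis unfolding fisher_rate_def Let_def A_def[symmetric] K8_def[symmetric] C4_def[symmetric] .
qed

text \<open>The infimum defining \<open>I(S_{n0})\<close> provides a density whose information is below \<open>1 + I\<close> (any
  positive slack would do), and
  \<open>y^4 \<le> 1 + y^8\<close> turns the eighth moments into the fourth moments that the estimates use.\<close>

lemma fisher_distance_rate:
  fixes M :: "'a measure"
  assumes setting: "stein_setting M X p" and n0: "1 \<le> n\<^sub>0" "n\<^sub>0 \<le> n"
    and fi: "fisher_information M (norm_sum X n\<^sub>0) \<le> ennreal I" "0 \<le> I"
    and sb: "stein_beta M X p n\<^sub>0 \<le> ennreal b" "0 \<le> b"
  shows "fisher_distance M (norm_sum X n) \<le> ennreal (fisher_rate n\<^sub>0 (1 + b) (1 + I) / real n)"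
proof -
  interpret P: prob_space M using setting by (simp add: stein_setting_def)
  have "fisher_information M (norm_sum X n\<^sub>0) < ennreal (1 + I)"
    by (rule le_less_trans[OF fi(1)]) (use fi(2) in \<open>simp add: ennreal_less_iff\<close>)
  then obtain f f' where ff: "ac_density M (norm_sum X n\<^sub>0) f f'"
    and lt: "(\<integral>\<^sup>+ x. ennreal ((f' x)\<^sup>2 / f x) \<partial>lborel) < ennreal (1 + I)"
    unfolding fisher_information_def by (auto simp: INF_less_iff)
  interpret FF: finite_fisher M "norm_sum X n\<^sub>0" f f'
  proof
    show "(\<integral>\<^sup>+ x. ennreal ((f' x)\<^sup>2 / f x) \<partial>lborel) < \<infinity>" using lt by (rule less_trans) simp
  qed (rule ff)
  have rho: "P.expectation (\<lambda>\<omega>. (FF.\<rho> (norm_sum X n\<^sub>0 \<omega>))\<^sup>2) \<le> 1 + I"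
  proof -
    have "ennreal (P.expectation (\<lambda>\<omega>. (FF.\<rho> (norm_sum X n\<^sub>0 \<omega>))\<^sup>2)) \<le> ennreal (1 + I)"
      unfolding FF.expectation_rho_sq using lt by (rule less_imp_le)
    thus ?thesis using fi(2) by (subst (asm) ennreal_le_iff) auto
  qed
  have X_meas: "X k \<in> borel_measurable M" if "1 \<le> k" for k
    using setting that by (auto simp: stein_setting_def)
  have mom: "abs_moment M 4 (X k) \<le> ennreal b" "abs_moment M 8 (\<lambda>\<omega>. stein_kernel (p k) (X k \<omega>)) \<le> ennreal b"
    "abs_moment M 8 (\<lambda>\<omega>. deriv (stein_kernel (p k)) (X k \<omega>)) \<le> ennreal b" if k: "n\<^sub>0 < k" for k
  proof -
    have k': "k \<in> {n\<^sub>0 + 1..}" using k by simp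
    have le: "s \<le> ennreal b" if "s \<le> (SUP k\<in>{n\<^sub>0 + 1..}. g k)" "(SUP k\<in>{n\<^sub>0 + 1..}. g k) \<le> stein_beta M X p n\<^sub>0" for s g
      using that sb(1) by (meson order.trans)
    show "abs_moment M 4 (X k) \<le> ennreal b"
      by (rule le[OF SUP_upper[OF k']]) (simp add: stein_beta_def le_max_iff_disj)
    show "abs_moment M 8 (\<lambda>\<omega>. stein_kernel (p k) (X k \<omega>)) \<le> ennreal b"
      by (rule le[OF SUP_upper[OF k']]) (simp add: stein_beta_def le_max_iff_disj)
    show "abs_moment M 8 (\<lambda>\<omega>. deriv (stein_kernel (p k)) (X k \<omega>)) \<le> ennreal b"
      by (rule le[OF SUP_upper[OF k']]) (simp add: stein_beta_def le_max_iff_disj)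
  qed
  have delta: "abs_moment M 8 (\<lambda>\<omega>. stein_density.\<tau>' (p k) (X k \<omega>)) \<le> ennreal b" if k: "n\<^sub>0 < k" for k
  proof -
    interpret sd: stein_density "p k" by (rule stein_density_of_setting[OF setting]) (use k in simp)
    have "abs_moment M 8 (\<lambda>\<omega>. sd.\<tau>' (X k \<omega>)) \<le> abs_moment M 8 (\<lambda>\<omega>. deriv (stein_kernel (p k)) (X k \<omega>))"
      unfolding abs_moment_def by (rule nn_integral_mono) (auto simp: sd.\<tau>'_def indicator_def)
    thus ?thesis using mom(3)[OF k] by simp
  qed
  interpret SS: stein_sum_bounded M X n\<^sub>0 f f' p "1 + b" n
  proof
    fix k assume k: "n\<^sub>0 < k"
    interpret sd: stein_density "p k" by (rule stein_density_of_setting[OF setting]) (use k in simp)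
    have [measurable]: "X k \<in> borel_measurable M" by (rule X_meas) (use k in simp)
    show "integrable M (\<lambda>\<omega>. X k \<omega> ^ 4) \<and> P.expectation (\<lambda>\<omega>. X k \<omega> ^ 4) \<le> 1 + b"
      using abs_moment_finite_imp[OF P.prob_space_axioms _ mom(1)[OF k] sb(2)] by simp
    show "integrable M (\<lambda>\<omega>. stein_kernel (p k) (X k \<omega>) ^ 4) \<and> P.expectation (\<lambda>\<omega>. stein_kernel (p k) (X k \<omega>) ^ 4) \<le> 1 + b"
      using abs_moment_finite_imp[OF P.prob_space_axioms _ mom(2)[OF k] sb(2)] by simp
    show "integrable M (\<lambda>\<omega>. sd.\<tau>' (X k \<omega>) ^ 4) \<and> P.expectation (\<lambda>\<omega>. sd.\<tau>' (X k \<omega>) ^ 4) \<le> 1 + b"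
      using abs_moment_finite_imp[OF P.prob_space_axioms _ delta[OF k] sb(2)] by simp
  qed (use setting n0 sb in auto)
  have "SS.rate \<le> fisher_rate n\<^sub>0 (1 + b) (1 + I)"
  proof -
    have "SS.rate = fisher_rate n\<^sub>0 (1 + b) (P.expectation (\<lambda>\<omega>. (FF.\<rho> (norm_sum X n\<^sub>0 \<omega>))\<^sup>2))"
      by (simp add: SS.rate_def fisher_rate_def Let_def SS.A_def SS.K8_def SS.C4_def)
    also have "\<dots> \<le> fisher_rate n\<^sub>0 (1 + b) (1 + I)" by (rule fisher_rate_mono[OF _ rho]) (use sb in simp)
    finally show ?thesis .
  qed
  thus ?thesis using SS.fisher_distance_le_rate
    by (meson divide_right_mono ennreal_leI of_nat_0_le_iff order.trans)
qed

(* C is chosen before the probability space and the sequence. Its last argument I(S_{n0}) cannot be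
   dropped: for n = n0 the bound is a bound on I(S_{n0}) itself, which beta and beta_bar, being
   suprema over k > n0, do not control. *)
theorem theorem4p3:
  shows "\<exists>C :: nat \<Rightarrow> ennreal \<Rightarrow> ennreal \<Rightarrow> ennreal \<Rightarrow> real.
    (\<forall>n\<^sub>0 \<beta> \<beta>' i. 0 < C n\<^sub>0 \<beta> \<beta>' i) \<and>
    (\<forall>(M :: 'a measure) X p n\<^sub>0.
       stein_setting M X p \<longrightarrow> 1 \<le> n\<^sub>0 \<longrightarrow>
       fisher_information M (norm_sum X n\<^sub>0) < \<infinity> \<longrightarrow>
       stein_beta M X p n\<^sub>0 < \<infinity> \<longrightarrow>
       (\<forall>n\<ge>n\<^sub>0.
          fisher_distance M (norm_sum X n)
            \<le> ennreal (C n\<^sub>0 (stein_beta M X p n\<^sub>0) (stein_beta_bar M X p n\<^sub>0)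
                         (fisher_information M (norm_sum X n\<^sub>0)) / real n)))"
proof (intro exI conjI allI impI)
  let ?C = "\<lambda>n\<^sub>0 \<beta> (\<beta>'::ennreal) i. fisher_rate n\<^sub>0 (1 + enn2real \<beta>) (1 + enn2real i)"
  show "0 < ?C n\<^sub>0 \<beta> \<beta>' i" for n\<^sub>0 \<beta> \<beta>' i by (rule fisher_rate_pos) auto
  fix M :: "'a measure" and X p n\<^sub>0 n
  assume "stein_setting M X p" "1 \<le> n\<^sub>0" "fisher_information M (norm_sum X n\<^sub>0) < \<infinity>"
    "stein_beta M X p n\<^sub>0 < \<infinity>" "n\<^sub>0 \<le> n"
  thus "fisher_distance M (norm_sum X n)
            \<le> ennreal (?C n\<^sub>0 (stein_beta M X p n\<^sub>0) (stein_beta_bar M X p n\<^sub>0)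
                         (fisher_information M (norm_sum X n\<^sub>0)) / real n)"
    by (intro fisher_distance_rate) auto
qed

end
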